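(* Consider fair division (exchange) instances under SPLC utilities that contain only bads. If either the number of agents or the number of bads is a constant, then the complementary pivot algorithm (Algorithm 1, described in the context for this case) runs in strongly polynomial time.
   Context: **Model.** There are a finite set $N$ of $n$ agents and a finite set $M$ of $m$ divisible bads. Agent $i$ is endowed with $W_{ij}\ge 0$ units of bad $j$, every agent owns a positive amount of some bad, and $\sum_i W_{ij}=1$ for all $j$. Utilities are additively separable piecewise linear concave: $u_i(\mathbf x_i)=\sum_j u_{ij}(x_{ij})$, with $u_{ij}:\mathbb R_+\to\mathbb R$, $u_{ij}(0)=0$, non-positive, decreasing, piecewise linear and concave. The $k$-th linear piece (segment $(i,j,k)$, $1\le k\le|u_{ij}|$) has slope $-D_{ijk}$ with $0<D_{ij1}<D_{ij2}<\cdots$ and length $L_{ijk}$; the last segment is infinite, and since supply is one unit its length is set to $1$ plus a small positive constant. **LCP.** "$E\le c\ \perp\ y$" means $E\le c$, $y\ge0$, $y(E-c)=0$. Fix constants $P>0$ and $R>P/\min_{i,j,k}D_{ijk}$. In variables $p_j,r_i,f_{ijk},s_{ijk},z\ge0$: - $\forall i\in N$: $-\sum_jW_{ij}p_j-\sum_{j,k}f_{ijk}-z\le-P\sum_jW_{ij}\ \perp\ r_i$ - $\forall j\in M$: $\sum_{i,k}f_{ijk}+p_j\le P\ \perp\ p_j$ - $\forall(i,j,k)$: $D_{ijk}r_i-p_j-s_{ijk}\le D_{ijk}R-P\ \perp\ f_{ijk}$ - $\forall(i,j,k)$: $f_{ijk}+L_{ijk}p_j\le L_{ijk}P\ \perp\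 s_{ijk}$. A solution with $z=0$ and all $p_j<P$, $r_i<R$ yields the competitive equilibrium with prices $-(P-p_j)$ and allocation $x_{ij}=\sum_kf_{ijk}/(P-p_j)$. **Algorithm 1 (Lemke's scheme).** With $\mathbf y=(\mathbf p,\mathbf f,\mathbf r,\mathbf s)$, start at the vertex $\mathbf y=\mathbf 0$, $z=P\max_i\sum_jW_{ij}$ (the end of the primary ray $\{\mathbf y=\mathbf 0,\ z\text{ large}\}$). While $z>0$, at the current vertex solution take the double label (index for which both the variable is $0$ and its paired inequality is tight); if the inequality just became tight, relax the condition that the variable is zero, otherwise relax the inequality; move along the resulting edge of LCP solutions to the next vertex solution. Stop when $z=0$. (The double label is unique for nondegenerate instances; degenerate instances are handled by perturbing the input parameters.) Strongly polynomial time: the number of pivots (and of arithmetic operations) is bounded by a polynomial in $n$, $m$ and the total number of segments $\sum_{i,j}|u_{ij}|$, independently of the magnitudes of the numbers in the input. *)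

theory Defs
  imports
    "HOL-Analysis.Analysis"
    "HOL-Analysis.Finite_Function_Topology"
    "HOL-Computational_Algebra.Polynomial"
    "HOL-Library.Monad_Syntax"
    "HOL-Library.While_Combinator"
begin

section \<open>Fair division instances with bads and SPLC utilities\<close>

text \<open>
  Agents are the numbers below \<open>num_agents\<close>, bads the numbers below \<open>num_bads\<close>, and the
  segments of \<open>util i j\<close> are the numbers below \<open>pieces i j\<close>. All indices start at 0, and
  the record functions are only ever read inside these ranges.
\<close>

record splc_instance =
  num_agents :: nat
  num_bads   :: nat
  endow      :: "nat \<Rightarrow> nat \<Rightarrow> real"
  util       :: "nat \<Rightarrow> nat \<Rightarrow> real \<Rightarrow> real"
  pieces     :: "nat \<Rightarrow> nat \<Rightarrow> nat"
  steep      :: "nat \<Rightarrow> nat \<Rightarrow> nat \<Rightarrow> real"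
  seglen     :: "nat \<Rightarrow> nat \<Rightarrow> nat \<Rightarrow> real"

text \<open>
  \<open>u\<close> is the decreasing, piecewise linear and concave function on the nonnegative reals with
  \<open>K\<close> segments, where segment \<open>k\<close> has slope \<open>- D k\<close> and, unless it is the last one (which is
  infinite), length \<open>L k\<close>. The value \<open>L (K - 1)\<close> is irrelevant.
\<close>

definition plc_disutility ::
  "(real \<Rightarrow> real) \<Rightarrow> nat \<Rightarrow> (nat \<Rightarrow> real) \<Rightarrow> (nat \<Rightarrow> real) \<Rightarrow> bool" where
  "plc_disutility u K D L \<longleftrightarrow>
     0 < K \<and> (\<forall>k<K. 0 < D k) \<and> (\<forall>k. Suc k < K \<longrightarrow> D k < D (Suc k) \<and> 0 < L k) \<and>
     u 0 = 0 \<and>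
     (\<forall>k<K. \<forall>x. (\<Sum>k'<k. L k') \<le> x \<and> (Suc k < K \<longrightarrow> x \<le> (\<Sum>k'\<le>k. L k')) \<longrightarrow>
        u x = u (\<Sum>k'<k. L k') - D k * (x - (\<Sum>k'<k. L k')))"

definition bads_instance :: "splc_instance \<Rightarrow> bool" where
  "bads_instance I \<longleftrightarrow>
     0 < num_agents I \<and>
     (\<forall>i<num_agents I. \<forall>j<num_bads I. 0 \<le> endow I i j) \<and>
     (\<forall>i<num_agents I. \<exists>j<num_bads I. 0 < endow I i j) \<and>
     (\<forall>j<num_bads I. (\<Sum>i<num_agents I. endow I i j) = 1) \<and>
     (\<forall>i<num_agents I. \<forall>j<num_bads I.
        plc_disutility (util I i j) (pieces I i j) (steep I i j) (seglen I i j))"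

definition segments :: "splc_instance \<Rightarrow> (nat \<times> nat \<times> nat) set" where
  "segments I = {(i, j, k). i < num_agents I \<and> j < num_bads I \<and> k < pieces I i j}"

definition input_size :: "splc_instance \<Rightarrow> nat" where
  "input_size I =
     num_agents I + num_bads I + (\<Sum>i<num_agents I. \<Sum>j<num_bads I. pieces I i j)"

text \<open>
  \<open>\<epsilon>\<close> is the small positive constant by which the length assigned to the infinite segments
  exceeds the unit supply.
\<close>

definition lcp_constants :: "splc_instance \<Rightarrow> real \<Rightarrow> real \<Rightarrow> real \<Rightarrow> bool" where
  "lcp_constants I P R \<epsilon> \<longleftrightarrow>
     0 < P \<and> 0 < \<epsilon> \<and> P / Min ((\<lambda>(i, j, k). steep I i j k) ` segments I) < R"

text \<open>
  A perturbation changes the numerical parameters of an instance by less than \<open>\<delta>\<close> and keeps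
  its combinatorial shape; it is itself an instance, so unit supplies are preserved.
\<close>

definition perturbation :: "real \<Rightarrow> splc_instance \<Rightarrow> splc_instance \<Rightarrow> bool" where
  "perturbation \<delta> I I' \<longleftrightarrow>
     bads_instance I' \<and> num_agents I' = num_agents I \<and> num_bads I' = num_bads I \<and>
     (\<forall>i<num_agents I. \<forall>j<num_bads I.
        pieces I' i j = pieces I i j \<and> \<bar>endow I' i j - endow I i j\<bar> < \<delta> \<and>
        (\<forall>k<pieces I i j. \<bar>steep I' i j k - steep I i j k\<bar> < \<delta> \<and>
                          \<bar>seglen I' i j k - seglen I i j k\<bar> < \<delta>))"


section \<open>The linear complementarity problem\<close>

text \<open>
  A label names a variable together with its paired inequality: \<open>Agent i\<close> stands for \<open>r\<^sub>i\<close>,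
  \<open>Bad j\<close> for \<open>p\<^sub>j\<close>, \<open>Flow i j k\<close> for \<open>f\<^sub>i\<^sub>j\<^sub>k\<close> and \<open>Surplus i j k\<close> for \<open>s\<^sub>i\<^sub>j\<^sub>k\<close>. A point
  consists of the values of these variables (zero outside the labels of the instance) and
  of \<open>z\<close>.
\<close>

datatype label = Agent nat | Bad nat | Flow nat nat nat | Surplus nat nat nat

type_synonym point = "(label \<Rightarrow>\<^sub>0 real) \<times> real"

definition label_list :: "splc_instance \<Rightarrow> label list" where
  "label_list I =
     map Agent [0..<num_agents I] @ map Bad [0..<num_bads I] @
     [Flow i j k. i \<leftarrow> [0..<num_agents I], j \<leftarrow> [0..<num_bads I], k \<leftarrow> [0..<pieces I i j]] @
     [Surplus i j k. i \<leftarrow> [0..<num_agents I], j \<leftarrow> [0..<num_bads I], k \<leftarrow> [0..<pieces I i j]]"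

definition labels :: "splc_instance \<Rightarrow> label set" where
  "labels I = set (label_list I)"

abbreviation var :: "point \<Rightarrow> label \<Rightarrow> real" where
  "var x l \<equiv> Poly_Mapping.lookup (fst x) l"

abbreviation zval :: "point \<Rightarrow> real" where
  "zval x \<equiv> snd x"

datatype constr = Nonneg label | Ineq label

context
  fixes I :: splc_instance and P R \<epsilon> :: real
begin

definition len :: "nat \<Rightarrow> nat \<Rightarrow> nat \<Rightarrow> real" where
  "len i j k = (if Suc k = pieces I i j then 1 + \<epsilon> else seglen I i j k)"

fun lhs :: "point \<Rightarrow> label \<Rightarrow> real" where
  "lhs x (Agent i) =
     - (\<Sum>j<num_bads I. endow I i j * var x (Bad j))
     - (\<Sum>j<num_bads I. \<Sum>k<pieces I i j. var x (Flow i j k)) - zval x"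
| "lhs x (Bad j) = (\<Sum>i<num_agents I. \<Sum>k<pieces I i j. var x (Flow i j k)) + var x (Bad j)"
| "lhs x (Flow i j k) = steep I i j k * var x (Agent i) - var x (Bad j) - var x (Surplus i j k)"
| "lhs x (Surplus i j k) = var x (Flow i j k) + len i j k * var x (Bad j)"

fun rhs :: "label \<Rightarrow> real" where
  "rhs (Agent i) = - P * (\<Sum>j<num_bads I. endow I i j)"
| "rhs (Bad j) = P"
| "rhs (Flow i j k) = steep I i j k * R - P"
| "rhs (Surplus i j k) = len i j k * P"

definition feasible :: "point set" where
  "feasible = {x. Poly_Mapping.keys (fst x) \<subseteq> labels I \<and> 0 \<le> zval x \<and>
                  (\<forall>l\<in>labels I. 0 \<le> var x l \<and> lhs x l \<le> rhs l)}"

definition lcp_solution :: "point \<Rightarrow> bool" where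
  "lcp_solution x \<longleftrightarrow> x \<in> feasible \<and> (\<forall>l\<in>labels I. var x l * (lhs x l - rhs l) = 0)"

definition vertex_solution :: "point \<Rightarrow> bool" where
  "vertex_solution x \<longleftrightarrow> lcp_solution x \<and> x extreme_point_of feasible"


section \<open>Lemke's scheme as a path of vertex solutions\<close>

definition tight :: "point \<Rightarrow> constr set" where
  "tight x = Nonneg ` {l \<in> labels I. var x l = 0} \<union> Ineq ` {l \<in> labels I. lhs x l = rhs l}"

definition double_label :: "point \<Rightarrow> label \<Rightarrow> bool" where
  "double_label x l \<longleftrightarrow> l \<in> labels I \<and> Nonneg l \<in> tight x \<and> Ineq l \<in> tight x"

text \<open>The edge of LCP solutions at \<open>v\<close> along which the constraint \<open>c\<close> is relaxed.\<close>

definition edge :: "point \<Rightarrow> constr \<Rightarrow> point set" where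
  "edge v c = {x. lcp_solution x \<and> tight v - {c} \<subseteq> tight x}"

text \<open>
  The constraint to be relaxed at a vertex \<open>v\<close> with double label \<open>l\<close>, where \<open>u\<close> is another
  point of the edge (or primary ray) on which \<open>v\<close> was reached. Tightness of the inequality
  at both \<open>u\<close> and \<open>v\<close> means tightness on the whole edge, so at \<open>v\<close> the inequality has just
  become tight iff it is slack at \<open>u\<close>.
\<close>

definition relaxed :: "point \<Rightarrow> label \<Rightarrow> constr" where
  "relaxed u l = (if Ineq l \<in> tight u then Ineq l else Nonneg l)"

definition pivot_step :: "point \<Rightarrow> point \<Rightarrow> point \<Rightarrow> bool" where
  "pivot_step u v w \<longleftrightarrow>
     zval v > 0 \<and>
     (\<exists>l. double_label v l \<and> w \<in> edge v (relaxed u l) \<and> w \<noteq> v \<and> vertex_solution w)"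

definition start_vertex :: point where
  "start_vertex = (0, P * Max ((\<lambda>i. \<Sum>j<num_bads I. endow I i j) ` {..<num_agents I}))"

definition ray_point :: point where
  "ray_point = (0, zval start_vertex + 1)"

text \<open>
  The initial parts of executions of the algorithm, as lists of visited vertices; such an
  execution makes \<open>length vs - 1\<close> pivots.
\<close>

definition lemke_run :: "point list \<Rightarrow> bool" where
  "lemke_run vs \<longleftrightarrow>
     vs \<noteq> [] \<and> hd vs = start_vertex \<and>
     (\<forall>t. Suc t < length vs \<longrightarrow> pivot_step ((ray_point # vs) ! t) (vs ! t) (vs ! Suc t))"

text \<open>
  Only the visited vertices are constrained. With at least two bads, a unique double label at
  every vertex solution with \<open>z > 0\<close> is impossible: if \<open>p\<^sub>j = P\<close>, all other variables except
  \<open>z\<close> are 0 and \<open>z\<close> is as small as possible, then \<open>Surplus i j k\<close> is a double label for all \<open>i\<close>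
  and \<open>k\<close>, and so is some \<open>Agent i\<close>.
\<close>

definition nondegenerate :: bool where
  "nondegenerate \<longleftrightarrow>
     (\<forall>vs. lemke_run vs \<and> zval (last vs) > 0 \<longrightarrow> (\<exists>!l. double_label (last vs) l))"

end


section \<open>Counting arithmetic operations\<close>

text \<open>
  A computation returns its result and the number of arithmetic operations and comparisons on
  real numbers it has made. The programs below operate on reals only through the
  primitives that follow; reading, copying and the constants 0, 1 and -1 are free.
\<close>

type_synonym 'a counted = "'a \<times> nat"

definition return :: "'a \<Rightarrow> 'a counted" where
  "return x = (x, 0)"

definition counted_bind :: "'a counted \<Rightarrow> ('a \<Rightarrow> 'b counted) \<Rightarrow> 'b counted" where
  "counted_bind c f = (case c of (x, a) \<Rightarrow> case f x of (y, b) \<Rightarrow> (y, a + b))"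

adhoc_overloading Monad_Syntax.bind \<rightleftharpoons> counted_bind

definition add_op :: "real \<Rightarrow> real \<Rightarrow> real counted" where "add_op a b = (a + b, 1)"
definition sub_op :: "real \<Rightarrow> real \<Rightarrow> real counted" where "sub_op a b = (a - b, 1)"
definition mul_op :: "real \<Rightarrow> real \<Rightarrow> real counted" where "mul_op a b = (a * b, 1)"
definition div_op :: "real \<Rightarrow> real \<Rightarrow> real counted" where "div_op a b = (a / b, 1)"
definition less_op :: "real \<Rightarrow> real \<Rightarrow> bool counted" where "less_op a b = (a < b, 1)"

fun map_counted :: "('a \<Rightarrow> 'b counted) \<Rightarrow> 'a list \<Rightarrow> 'b list counted" where
  "map_counted f [] = return []"
| "map_counted f (x # xs) = do { y \<leftarrow> f x; ys \<leftarrow> map_counted f xs; return (y # ys) }"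

fun sum_counted :: "real list \<Rightarrow> real counted" where
  "sum_counted [] = return 0"
| "sum_counted (x # xs) = do { s \<leftarrow> sum_counted xs; add_op x s }"

fun least_counted :: "(real \<times> nat) list \<Rightarrow> (real \<times> nat) option counted" where
  "least_counted [] = return None"
| "least_counted (x # xs) = do {
     m \<leftarrow> least_counted xs;
     (case m of
       None \<Rightarrow> return (Some x)
     | Some y \<Rightarrow> do { b \<leftarrow> less_op (fst y) (fst x); return (Some (if b then y else x)) })
   }"


section \<open>Lemke's scheme on a simplex tableau\<close>

text \<open>
  With \<open>N\<close> labels, a tableau has \<open>N\<close> rows and \<open>2 * N + 2\<close> columns: column \<open>c < N\<close> belongs to the
  variable of the \<open>c\<close>-th label, column \<open>N + c\<close> to the slack of its inequality, column \<open>2 * N\<close>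
  to \<open>z\<close>, and the last column is the right-hand side. The list \<open>basis\<close> gives the basic column
  of every row, and \<open>entering\<close> is the column that enters next.
\<close>

record lemke_state =
  tableau  :: "real list list"
  basis    :: "nat list"
  entering :: nat
  running  :: bool
  visited  :: "point list"

definition pivot_tableau :: "real list list \<Rightarrow> nat \<Rightarrow> nat \<Rightarrow> real list list counted" where
  "pivot_tableau T r e = do {
     pr \<leftarrow> map_counted (\<lambda>a. div_op a (T ! r ! e)) (T ! r);
     map_counted
       (\<lambda>(q, v).
          if q = r then return pr
          else map_counted (\<lambda>(a, b). do { t \<leftarrow> mul_op (v ! e) b; sub_op a t }) (zip v pr))
       (List.enumerate 0 T)
   }"

fun ratios :: "nat \<Rightarrow> (nat \<times> real list) list \<Rightarrow> (real \<times> nat) list counted" where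
  "ratios e [] = return []"
| "ratios e ((r, v) # vs) = do {
     rs \<leftarrow> ratios e vs;
     b \<leftarrow> less_op 0 (v ! e);
     (if b then do { q \<leftarrow> div_op (last v) (v ! e); return ((q, r) # rs) } else return rs)
   }"

definition col_value :: "real list list \<Rightarrow> nat list \<Rightarrow> nat \<Rightarrow> real" where
  "col_value T B c = (case map_of (zip B (map last T)) c of None \<Rightarrow> 0 | Some v \<Rightarrow> v)"

definition partner :: "nat \<Rightarrow> nat \<Rightarrow> nat" where
  "partner N c = (if c < N then c + N else c - N)"

context
  fixes I :: splc_instance and P R \<epsilon> :: real
begin

definition tableau_point :: "real list list \<Rightarrow> nat list \<Rightarrow> point" where
  "tableau_point T B = (let ls = label_list I; N = length ls in
     ((\<Sum>c<N. Poly_Mapping.single (ls ! c) (col_value T B c)), col_value T B (2 * N)))"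

definition len_entry :: "nat \<Rightarrow> nat \<Rightarrow> nat \<Rightarrow> real counted" where
  "len_entry i j k =
     (if Suc k = pieces I i j then add_op 1 \<epsilon> else return (seglen I i j k))"

fun matrix_entry :: "label \<Rightarrow> label \<Rightarrow> real counted" where
  "matrix_entry (Agent i) (Bad j) = sub_op 0 (endow I i j)"
| "matrix_entry (Agent i) (Flow i' j k) = return (if i' = i then -1 else 0)"
| "matrix_entry (Bad j) (Bad j') = return (if j' = j then 1 else 0)"
| "matrix_entry (Bad j) (Flow i j' k) = return (if j' = j then 1 else 0)"
| "matrix_entry (Flow i j k) (Agent i') = return (if i' = i then steep I i j k else 0)"
| "matrix_entry (Flow i j k) (Bad j') = return (if j' = j then -1 else 0)"
| "matrix_entry (Flow i j k) (Surplus i' j' k') =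
     return (if (i', j', k') = (i, j, k) then -1 else 0)"
| "matrix_entry (Surplus i j k) (Bad j') = (if j' = j then len_entry i j k else return 0)"
| "matrix_entry (Surplus i j k) (Flow i' j' k') =
     return (if (i', j', k') = (i, j, k) then 1 else 0)"
| "matrix_entry _ _ = return 0"

fun rhs_entry :: "label \<Rightarrow> real counted" where
  "rhs_entry (Agent i) = do {
     s \<leftarrow> sum_counted (map (endow I i) [0..<num_bads I]);
     t \<leftarrow> mul_op P s;
     sub_op 0 t }"
| "rhs_entry (Bad j) = return P"
| "rhs_entry (Flow i j k) = do { t \<leftarrow> mul_op (steep I i j k) R; sub_op t P }"
| "rhs_entry (Surplus i j k) = do { a \<leftarrow> len_entry i j k; mul_op a P }"

definition initial_row :: "label \<Rightarrow> real list counted" where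
  "initial_row l = do {
     as \<leftarrow> map_counted (matrix_entry l) (label_list I);
     c \<leftarrow> rhs_entry l;
     return (as @ map (\<lambda>l'. if l' = l then 1 else 0) (label_list I) @
             [case l of Agent _ \<Rightarrow> -1 | _ \<Rightarrow> 0, c])
   }"

text \<open>
  The first pivot brings \<open>z\<close> into the basis in the row with the most negative right-hand side;
  this leads to the end of the primary ray.
\<close>

definition lemke_init :: "lemke_state counted" where
  "lemke_init = (let N = length (label_list I) in do {
     T0 \<leftarrow> map_counted initial_row (label_list I);
     m \<leftarrow> least_counted (zip (map last T0) [0..<N]);
     let r = snd (the m);
     T \<leftarrow> pivot_tableau T0 r (2 * N);
     let B = [N..<2 * N][r := 2 * N];
     b \<leftarrow> less_op 0 (col_value T B (2 * N));
     return \<lparr>tableau = T, basis = B, entering = partner N (N + r), running = b,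
             visited = [tableau_point T B]\<rparr>
   })"

text \<open>
  The state stops running when \<open>z\<close> reaches 0, or when no row limits the entering column
  (a secondary ray).
\<close>

definition lemke_step :: "lemke_state \<Rightarrow> lemke_state counted" where
  "lemke_step st = (let N = length (label_list I) in do {
     rs \<leftarrow> ratios (entering st) (List.enumerate 0 (tableau st));
     m \<leftarrow> least_counted rs;
     (case m of
       None \<Rightarrow> return (st\<lparr>running := False\<rparr>)
     | Some (_, r) \<Rightarrow> do {
         T \<leftarrow> pivot_tableau (tableau st) r (entering st);
         let B = (basis st)[r := entering st];
         b \<leftarrow> less_op 0 (col_value T B (2 * N));
         return \<lparr>tableau = T, basis = B, entering = partner N (basis st ! r), running = b,
                 visited = visited st @ [tableau_point T B]\<rparr>
       })
   })"

definition lemke_program :: "lemke_state counted option" where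
  "lemke_program =
     while_option (\<lambda>s. running (fst s)) (\<lambda>s. counted_bind s lemke_step) lemke_init"

text \<open>
  Every execution of Lemke's scheme makes at most \<open>b\<close> pivots, and the tableau program carries out
  an execution that ends with \<open>z = 0\<close> using at most \<open>b\<close> arithmetic operations.
\<close>

definition runs_within :: "nat \<Rightarrow> bool" where
  "runs_within b \<longleftrightarrow>
     (\<forall>vs. lemke_run I P R \<epsilon> vs \<longrightarrow> length vs - 1 \<le> b) \<and>
     (\<exists>st ops. lemke_program = Some (st, ops) \<and> ops \<le> b \<and>
        lemke_run I P R \<epsilon> (visited st) \<and> zval (last (visited st)) = 0)"

end

end

theory Submission
  imports Defs
begin

text \<open>
  Write \<open>q\<^sub>j = P - p\<^sub>j\<close> and \<open>\<rho>\<^sub>i = R - r\<^sub>i\<close>. As long as \<open>z > 0\<close>, all \<open>q\<^sub>j\<close> and hence all \<open>\<rho>\<^sub>i\<close> stay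
  positive along the path. A secondary ray would be bounded in every variable except \<open>z\<close>, so it
  would be the primary ray; Lemke's parity argument shows that no vertex is visited twice.

  A vertex is determined by its tight constraints, and these are known from the double label, the
  vanishing \<open>p\<^sub>j\<close> and \<open>r\<^sub>i\<close>, and the signs of \<open>q\<^sub>j - D\<^sub>i\<^sub>j\<^sub>k \<rho>\<^sub>i\<close>. Each agent fills its segments in decreasing
  order of \<open>q\<^sub>j / D\<^sub>i\<^sub>j\<^sub>k\<close> until its budget is met, so with few bads these signs only depend on the cell of
  \<open>(q, z)\<close> in an arrangement of polynomially many hyperplanes (comparisons of the ratios, and of the
  budgets with sums over prefixes of segments). With few agents the same argument applies to each bad
  and the cell of \<open>\<rho>\<close>. An arrangement of \<open>H\<close> hyperplanes in dimension \<open>d\<close> has at most \<open>(2 H + 1) ^ d\<close> cells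
  of all dimensions.

  For the perturbation the parameters are chosen one after another. Every tight constraint
  with a private parameter lowers the dimension of the solution set, if the parameter avoids finitely
  many values, and so \<open>N + 2\<close> constraints are never tight simultaneously, where \<open>N\<close> is the number of labels.
\<close>

section \<open>Linear algebra\<close>

text \<open>Choosing one tight constraint per label leaves exponentially many candidates, so the
  signs of \<open>q x j - D i j k * \<rho> x i\<close> must be compressed. Outside the double label
  a marginal segment (sign 0) is filled strictly partially, so the stopping point of a filling is
  unambiguous; a double label on a segment makes that segment marginal and fixes the ratio directly.
  With few bads \<open>z\<close> stays a coordinate; with few agents the constant \<open>P\<close>
  becomes one, so that all hyperplanes are linear.

  The perturbation is shaped by unit supply: the \<open>n\<close> budgets share only
  \<open>n - 1\<close> free endowments of bad \<open>0\<close>, and if all budgets are tight their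
  sum contains no parameter. This sum, the vanishing variables and the equations of the bads are
  parameter-free, so their independence is checked by explicit directions. The surplus inequality of
  a last segment has no parameter either, but its length exceeds the supply, so it is never tight at
  positive prices. Only points with positive \<open>q\<close> and \<open>\<rho>\<close> are
  considered, since these are the coefficients of the parameters.\<close>

lemma span_kernel_smaller:
  fixes h :: "'a::real_vector \<Rightarrow> real"
  assumes "finite B" "linear h" "v \<in> span B" "h v \<noteq> 0"
  obtains B' where "finite B'" "Suc (card B') \<le> card B" "B' \<subseteq> span B"
    "span B \<inter> {x. h x = 0} \<subseteq> span B'"
proof -
  interpret h: linear h by fact
  have "\<exists>b\<in>B. h b \<noteq> 0"
  proof (rule ccontr)
    assume "\<not> ?thesis"
    then have "h v = 0"
      using linear_eq_0_on_span[OF \<open>linear h\<close> _ \<open>v \<in> span B\<close>] by blast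
    with assms show False by simp
  qed
  then obtain b0 where b0: "b0 \<in> B" "h b0 \<noteq> 0" by blast
  define B' where "B' = (\<lambda>b. b - (h b / h b0) *\<^sub>R b0) ` (B - {b0})"
  have "card B' \<le> card (B - {b0})"
    unfolding B'_def using assms(1) by (intro card_image_le) auto
  also have "Suc (card (B - {b0})) = card B"
    using assms(1) b0(1) by (rule card_Suc_Diff1)
  finally have card: "Suc (card B') \<le> card B" by simp
  \<comment> \<open>The map \<open>x - (h x / h b0) *\<^sub>R b0\<close> is the projection onto the
    kernel of \<open>h\<close> along \<open>b0\<close>; it fixes kernel vectors and sends
    \<open>b0\<close> to 0.\<close>
  have key: "x - (h x / h b0) *\<^sub>R b0 \<in> span B'" if "x \<in> span B" for x
    using that
  proof (induction rule: span_induct_alt)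
    case (base)
    then show ?case by (simp add: h.zero span_zero)
  next
    case (step c x y)
    have *: "(c *\<^sub>R x + y) - (h (c *\<^sub>R x + y) / h b0) *\<^sub>R b0
      = c *\<^sub>R (x - (h x / h b0) *\<^sub>R b0) + (y - (h y / h b0) *\<^sub>R b0)"
      by (simp add: h.add h.scale algebra_simps add_divide_distrib)
    have x: "x - (h x / h b0) *\<^sub>R b0 \<in> span B'"
      using step(1) b0 by (cases "x = b0") (auto simp: B'_def span_zero intro!: span_base)
    show ?case
      unfolding * using step x by (intro span_add span_scale)
  qed
  show thesis
  proof
    show "finite B'" using assms by (simp add: B'_def)
    show "Suc (card B') \<le> card B" by fact
    show "B' \<subseteq> span B"
      unfolding B'_def using b0 by (blast intro: span_diff span_scale span_base)
    show "span B \<inter> {x. h x = 0} \<subseteq> span B'"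
      using key by force
  qed
qed

text \<open>An upper bound on the affine dimension. Points form an infinite-dimensional space, so
  the bound is expressed by a finite generating set, whose independence is not asked for.\<close>

definition covered :: "nat \<Rightarrow> 'a::real_vector set \<Rightarrow> bool" where
  "covered d S \<longleftrightarrow> (\<exists>a B. finite B \<and> card B \<le> d \<and> S \<subseteq> {x. x - a \<in> span B})"

text \<open>Recentring at a point of the intersection turns the hyperplane into the kernel of
  \<open>h\<close>, and the point \<open>s\<close> off the hyperplane supplies a difference vector
  outside that kernel.\<close>

lemma covered_cut:
  fixes h :: "'a::real_vector \<Rightarrow> real"
  assumes "covered d S" "linear h" "s \<in> S" "c + h s \<noteq> 0" "S \<inter> {x. c + h x = 0} \<noteq> {}"
  obtains d' where "d = Suc d'" "covered d' (S \<inter> {x. c + h x = 0})"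
proof -
  interpret h: linear h by fact
  obtain a B where aB: "finite B" "card B \<le> d" "S \<subseteq> {x. x - a \<in> span B}"
    using assms(1) unfolding covered_def by blast
  obtain a' where a': "a' \<in> S" "c + h a' = 0" using assms(5) by blast
  have diff: "x - y \<in> span B" if "x \<in> S" "y \<in> S" for x y
    using span_diff[of "x - a" B "y - a"] that aB by auto
  have "h (s - a') \<noteq> 0" using assms(4) a' by (simp add: h.diff)
  then obtain B' where B': "finite B'" "Suc (card B') \<le> card B"
    "span B \<inter> {x. h x = 0} \<subseteq> span B'"
    using span_kernel_smaller[OF aB(1) assms(2) diff[OF assms(3) a'(1)]] by metis
  have "S \<inter> {x. c + h x = 0} \<subseteq> {x. x - a' \<in> span B'}"
  proof
    fix x assume "x \<in> S \<inter> {x. c + h x = 0}"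
    then have "x - a' \<in> span B" "h (x - a') = 0"
      using diff a' by (auto simp: h.diff)
    then show "x \<in> {x. x - a' \<in> span B'}" using B' by auto
  qed
  then have "covered (d - 1) (S \<inter> {x. c + h x = 0})"
    unfolding covered_def using B' aB by (intro exI[of _ a'] exI[of _ B']) auto
  moreover have "d = Suc (d - 1)" using B' aB by simp
  ultimately show thesis using that by blast
qed

text \<open>Induction on the hyperplanes. An old sign vector realized in the kernel of the new
  functional extends in at most three ways, every other one in exactly one way, and the kernel needs
  one generator less. The recursion closes because \<open>(2 * H + 1) ^ d + 2 * (2 * H + 1) ^ (d -
  1) \<le> (2 * H + 3) ^ d\<close>.\<close>

lemma card_sign_vectors:
  fixes g :: "'h \<Rightarrow> 'a::real_vector \<Rightarrow> real"
  assumes "finite H" "finite B" "\<And>h. h \<in> H \<Longrightarrow> linear (g h)"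
  defines "sv \<equiv> \<lambda>H x. restrict (\<lambda>h. sgn (g h x)) H"
  shows "finite (sv H ` span B) \<and> card (sv H ` span B) \<le> (2 * card H + 1) ^ card B"
  using assms(1-3)
proof (induction H arbitrary: B rule: finite_induct)
  case empty
  have "sv {} ` span B \<subseteq> {\<lambda>_. undefined}" by (auto simp: sv_def)
  moreover from this have "card (sv {} ` span B) \<le> 1"
    using card_mono[of "{\<lambda>_. undefined}"] by simp
  ultimately show ?case using finite_subset[of _ "{\<lambda>_. undefined}"] by simp
next
  case (insert h H)
  have lin: "linear (g h)" and linH: "\<And>h'. h' \<in> H \<Longrightarrow> linear (g h')"
    using insert.prems by auto
  interpret h: linear "g h" by fact
  have sv_insert: "sv (insert h H) x = (sv H x)(h := sgn (g h x))" for x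
    by (auto simp: sv_def)
  let ?old = "sv H ` span B"
  have old: "finite ?old" "card ?old \<le> (2 * card H + 1) ^ card B"
    using insert.IH[OF insert.prems(1) linH] by auto
  have mono: "(2 * card H + 1) ^ card B \<le> (2 * card (insert h H) + 1) ^ card B"
    using insert.hyps by (intro power_mono) auto
  show ?case
  proof (cases "\<exists>v\<in>span B. g h v \<noteq> 0")
    case False
    then have "sv (insert h H) ` span B = (\<lambda>\<sigma>. \<sigma>(h := 0)) ` ?old"
      by (auto simp: sv_insert image_image intro!: image_cong)
    then show ?thesis
      using old mono card_image_le[OF old(1), of "\<lambda>\<sigma>. \<sigma>(h := 0)"] by auto
  next
    case True
    then obtain v where v: "v \<in> span B" "g h v \<noteq> 0" by blast
    obtain B' where B': "finite B'" "Suc (card B') \<le> card B" "B' \<subseteq> span B"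
      "span B \<inter> {x. g h x = 0} \<subseteq> span B'"
      using span_kernel_smaller[OF insert.prems(1) lin v] by metis
    let ?old' = "sv H ` span B'"
    have old': "finite ?old'" "card ?old' \<le> (2 * card H + 1) ^ card B'"
      using insert.IH[OF B'(1) linH] by auto
    have "span B' \<subseteq> span B"
      using B'(3) by (simp add: span_minimal)
    then have sub: "?old' \<subseteq> ?old" by blast
    \<comment> \<open>Otherwise a convex combination of \<open>x\<close> and \<open>y\<close> realizes the same sign vector in the kernel of \<open>g h\<close>.\<close>
    have unique: "sgn (g h x) = sgn (g h y)"
      if xy: "x \<in> span B" "y \<in> span B" "sv H x = sv H y" "sv H x \<notin> ?old'" for x y
    proof (rule ccontr)
      assume ne: "sgn (g h x) \<noteq> sgn (g h y)"
      have nz: "g h x \<noteq> 0" "g h y \<noteq> 0"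
        using xy B'(4) by (metis (mono_tags, lifting) IntI imageI mem_Collect_eq subsetD)+
      define a b where "a = \<bar>g h y\<bar>" and "b = \<bar>g h x\<bar>"
      have ab: "a > 0" "b > 0" using nz by (auto simp: a_def b_def)
      define w where "w = a *\<^sub>R x + b *\<^sub>R y"
      have "g h w = 0"
        using ne nz by (auto simp: w_def h.add h.scale a_def b_def sgn_if abs_if split: if_splits)
      moreover have "w \<in> span B" using xy by (simp add: w_def span_add span_scale)
      ultimately have "w \<in> span B'" using B'(4) by blast
      moreover have "sv H w = sv H x"
      proof
        fix h'
        show "sv H w h' = sv H x h'"
        proof (cases "h' \<in> H")
          case True
          interpret h': linear "g h'" using linH True by blast
          have eq: "sgn (g h' x) = sgn (g h' y)"
            using fun_cong[OF xy(3), of h'] True by (simp add: sv_def)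
          have gw: "g h' w = a * g h' x + b * g h' y"
            by (simp add: w_def h'.add h'.scale)
          consider "g h' x > 0" "g h' y > 0" | "g h' x < 0" "g h' y < 0" | "g h' x = 0" "g h' y = 0"
            using eq by (auto simp: sgn_if split: if_splits)
          then have "sgn (g h' w) = sgn (g h' x)"
          proof cases
            case 1
            then have "g h' w > 0" using ab by (simp add: gw add_pos_pos)
            with 1 show ?thesis by simp
          next
            case 2
            then have "g h' w < 0" using ab by (simp add: gw add_neg_neg mult_pos_neg)
            with 2 show ?thesis by simp
          qed (simp add: gw)
          then show ?thesis using True by (simp add: sv_def)
        qed (simp add: sv_def)
      qed
      ultimately show False using xy(4) by (metis imageI)
    qed
    \<comment> \<open>By \<open>unique\<close>, outside \<open>?old'\<close> the new sign is a
      function of the old sign vector.\<close>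
    define e where "e \<sigma> = sgn (g h (SOME x. x \<in> span B \<and> sv H x = \<sigma>))" for \<sigma>
    have e: "e (sv H x) = sgn (g h x)" if "x \<in> span B" "sv H x \<notin> ?old'" for x
    proof -
      have "(SOME y. y \<in> span B \<and> sv H y = sv H x) \<in> span B \<and>
            sv H (SOME y. y \<in> span B \<and> sv H y = sv H x) = sv H x"
        using someI_ex[of "\<lambda>y. y \<in> span B \<and> sv H y = sv H x"] that by blast
      then show ?thesis unfolding e_def using unique that by metis
    qed
    let ?N1 = "(\<lambda>(\<sigma>, s). \<sigma>(h := s)) ` (?old' \<times> {-1, 0, 1 :: real})"
    let ?N2 = "(\<lambda>\<sigma>. \<sigma>(h := e \<sigma>)) ` (?old - ?old')"
    have new: "sv (insert h H) ` span B \<subseteq> ?N1 \<union> ?N2"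
    proof
      fix \<tau> assume "\<tau> \<in> sv (insert h H) ` span B"
      then obtain x where x: "x \<in> span B" "\<tau> = (sv H x)(h := sgn (g h x))"
        by (auto simp: sv_insert)
      show "\<tau> \<in> ?N1 \<union> ?N2"
      proof (cases "sv H x \<in> ?old'")
        case True
        have "sgn (g h x) \<in> {-1, 0, 1}" by (auto simp: sgn_if)
        with True x show ?thesis by (auto intro!: image_eqI[of _ _ "(sv H x, sgn (g h x))"])
      next
        case False
        then have "sv H x \<in> ?old - ?old'" using x(1) by blast
        then have "(sv H x)(h := e (sv H x)) \<in> ?N2" by (rule imageI)
        then show ?thesis using x e[OF x(1) False] by simp
      qed
    qed
    have fin: "finite (?N1 \<union> ?N2)" using old old' by auto
    have "card (?N1 \<union> ?N2) \<le> card ?N1 + card ?N2" by (rule card_Un_le)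
    also have "card ?N1 \<le> card (?old' \<times> {-1, 0, 1 :: real})"
      using old' by (intro card_image_le) auto
    also have "\<dots> = 3 * card ?old'" by (simp add: card_cartesian_product)
    also have "card ?N2 \<le> card (?old - ?old')" using old by (intro card_image_le) auto
    also have "\<dots> = card ?old - card ?old'" using sub old' by (simp add: card_Diff_subset)
    finally have N12: "card (?N1 \<union> ?N2) \<le> card ?old + 2 * card ?old'"
      using card_mono[OF old(1) sub] by linarith
    obtain D where D: "card B = Suc D" "card B' \<le> D"
      using B'(2) by (metis Suc_le_D Suc_le_mono)
    have "card ?old + 2 * card ?old' \<le> (2 * card H + 1) ^ Suc D + 2 * (2 * card H + 1) ^ D"
      using old(2) old'(2) D power_increasing[OF D(2), of "2 * card H + 1"] by simp
    also have "\<dots> = (2 * card H + 3) * (2 * card H + 1) ^ D" by (simp add: algebra_simps)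
    also have "\<dots> \<le> (2 * card H + 3) * (2 * card H + 3) ^ D"
      by (intro mult_le_mono power_mono) auto
    finally have bound: "card ?old + 2 * card ?old' \<le> (2 * card H + 3) * (2 * card H + 3) ^ D" .
    have "card ?old + 2 * card ?old' \<le> (2 * card (insert h H) + 1) ^ card B"
    proof -
      have "2 * card (insert h H) + 1 = 2 * card H + 3" using insert.hyps by simp
      then show ?thesis unfolding D(1) power_Suc using bound by (simp only:)
    qed
    with N12 have "card (?N1 \<union> ?N2) \<le> (2 * card (insert h H) + 1) ^ card B" by linarith
    then show ?thesis
      using card_mono[OF fin new] finite_subset[OF new fin] by linarith
  qed
qed

text \<open>
  The parameters are fixed in the order of \<open>ps\<close>. Each new one avoids the values for which its constraint
  holds at some previously chosen point of the solution set, which thus loses a dimension.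
\<close>

lemma generic_parameters:
  fixes g :: "'t \<Rightarrow> 'q \<Rightarrow> ('q \<Rightarrow> real) \<Rightarrow> 'a::real_vector \<Rightarrow> real"
  assumes "finite Ts" "distinct ps" "\<delta> > 0"
    and later: "sorted_wrt (\<lambda>c c'. \<forall>T\<in>Ts. c \<in> act T \<longrightarrow> (\<forall>\<theta> t. g T c (\<theta>(c' := t)) = g T c \<theta>)) ps"
    and affine: "\<And>T c \<theta>. T \<in> Ts \<Longrightarrow> c \<in> act T \<Longrightarrow> \<exists>b h. linear h \<and> g T c \<theta> = (\<lambda>x. b + h x)"
    and finite_bad: "\<And>T c \<theta> x. T \<in> Ts \<Longrightarrow> c \<in> act T \<Longrightarrow> x \<in> G \<Longrightarrow> finite {t. g T c (\<theta>(c := t)) x = 0}"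
    and S0: "\<And>T. T \<in> Ts \<Longrightarrow> covered (d T) (S0 T)"
  shows "\<exists>\<theta>. (\<forall>c\<in>set ps. \<theta>0 c < \<theta> c \<and> \<theta> c < \<theta>0 c + \<delta>) \<and> (\<forall>c. c \<notin> set ps \<longrightarrow> \<theta> c = \<theta>0 c) \<and>
    (\<forall>T\<in>Ts. {x \<in> S0 T. \<forall>c\<in>act T \<inter> set ps. g T c \<theta> x = 0} \<inter> G \<noteq> {} \<longrightarrow>
       (\<exists>d'. d' + card (act T \<inter> set ps) = d T \<and>
          covered d' {x \<in> S0 T. \<forall>c\<in>act T \<inter> set ps. g T c \<theta> x = 0}))"
  using assms(2) later
proof (induction ps rule: rev_induct)
  case Nil
  then show ?case using S0 by (intro exI[of _ \<theta>0]) auto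
next
  case (snoc c ps)
  define S where "S \<theta> T = {x \<in> S0 T. \<forall>c\<in>act T \<inter> set ps. g T c \<theta> x = 0}" for \<theta> T
  obtain \<theta> where \<theta>: "\<forall>c\<in>set ps. \<theta>0 c < \<theta> c \<and> \<theta> c < \<theta>0 c + \<delta>" "\<forall>c. c \<notin> set ps \<longrightarrow> \<theta> c = \<theta>0 c"
    and IH: "\<And>T. T \<in> Ts \<Longrightarrow> S \<theta> T \<inter> G \<noteq> {} \<Longrightarrow>
       \<exists>d'. d' + card (act T \<inter> set ps) = d T \<and> covered d' (S \<theta> T)"
    using snoc.IH snoc.prems unfolding S_def by (auto simp: sorted_wrt_append)
  \<comment> \<open>The sample point is fixed before the new value \<open>t\<close> is chosen and
    lies in \<open>G\<close> whenever possible: there each constraint excludes only finitely many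
    \<open>t\<close>.\<close>
  define s where "s T = (SOME x. x \<in> S \<theta> T \<inter> G)" for T
  have s: "s T \<in> S \<theta> T \<inter> G" if "S \<theta> T \<inter> G \<noteq> {}" for T
    unfolding s_def using that by (meson ex_in_conv someI_ex)
  define bad where "bad = (\<Union>T\<in>{T\<in>Ts. c \<in> act T \<and> S \<theta> T \<inter> G \<noteq> {}}. {t. g T c (\<theta>(c := t)) (s T) = 0})"
  have "finite bad"
    unfolding bad_def using assms(1) s finite_bad by (intro finite_UN_I) auto
  moreover have "infinite {\<theta>0 c<..<\<theta>0 c + \<delta>}" using \<open>\<delta> > 0\<close> by (simp add: infinite_Ioo)
  ultimately obtain t where t: "\<theta>0 c < t" "t < \<theta>0 c + \<delta>" "t \<notin> bad"
    by (metis (no_types, opaque_lifting) finite_subset greaterThanLessThan_iff subsetI)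
  have [simp]: "c \<notin> set ps" using snoc.prems by simp
  have g_upd: "g T c' (\<theta>(c := t)) = g T c' \<theta>" if "T \<in> Ts" "c' \<in> act T" "c' \<in> set ps" for T c'
    using snoc.prems(2) that unfolding sorted_wrt_append by fastforce
  have goal: "\<exists>d'. d' + card (act T \<inter> set (ps @ [c])) = d T \<and>
        covered d' {x \<in> S0 T. \<forall>c'\<in>act T \<inter> set (ps @ [c]). g T c' (\<theta>(c := t)) x = 0}"
    if T: "T \<in> Ts" and ne: "{x \<in> S0 T. \<forall>c'\<in>act T \<inter> set (ps @ [c]). g T c' (\<theta>(c := t)) x = 0} \<inter> G \<noteq> {}" for T
  proof (cases "c \<in> act T")
    case False
    then have eq: "act T \<inter> set (ps @ [c]) = act T \<inter> set ps" by auto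
    have "{x \<in> S0 T. \<forall>c'\<in>act T \<inter> set (ps @ [c]). g T c' (\<theta>(c := t)) x = 0} = S \<theta> T"
      unfolding eq S_def using g_upd T by auto
    then show ?thesis using IH[OF T] ne eq by simp
  next
    case True
    obtain b h where bh: "linear h" "g T c (\<theta>(c := t)) = (\<lambda>x. b + h x)"
      using affine[OF T True] by blast
    have eq: "act T \<inter> set (ps @ [c]) = insert c (act T \<inter> set ps)" using True by auto
    have S': "{x \<in> S0 T. \<forall>c'\<in>act T \<inter> set (ps @ [c]). g T c' (\<theta>(c := t)) x = 0}
        = S \<theta> T \<inter> {x. b + h x = 0}"
      unfolding eq S_def using g_upd T bh(2) by (auto simp: fun_eq_iff)
    have ne': "S \<theta> T \<inter> G \<noteq> {}" "S \<theta> T \<inter> {x. b + h x = 0} \<noteq> {}" using ne S' by auto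
    then obtain d' where d': "d' + card (act T \<inter> set ps) = d T" "covered d' (S \<theta> T)"
      using IH[OF T] by blast
    have "b + h (s T) \<noteq> 0" using t(3) T True ne' bh(2) unfolding bad_def by auto
    then obtain d'' where "d' = Suc d''" "covered d'' (S \<theta> T \<inter> {x. b + h x = 0})"
      using covered_cut[OF d'(2) bh(1)] s[OF ne'(1)] ne'(2) by (metis IntD1)
    then show ?thesis unfolding S' using d'(1) eq by auto
  qed
  show ?case
  proof (intro exI[of _ "\<theta>(c := t)"] conjI ballI impI allI)
    fix T assume "T \<in> Ts" "{x \<in> S0 T. \<forall>c'\<in>act T \<inter> set (ps @ [c]). g T c' (\<theta>(c := t)) x = 0} \<inter> G \<noteq> {}"
    then show "\<exists>d'. d' + card (act T \<inter> set (ps @ [c])) = d T \<and>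
        covered d' {x \<in> S0 T. \<forall>c'\<in>act T \<inter> set (ps @ [c]). g T c' (\<theta>(c := t)) x = 0}"
      by (rule goal)
  qed (use \<theta> t in auto)
qed

section \<open>Geometry of complementary paths\<close>

lemma lookup_scaleR: "Poly_Mapping.lookup (r *\<^sub>R x) l = r *\<^sub>R Poly_Mapping.lookup x l"
  for x :: "'a \<Rightarrow>\<^sub>0 'b::real_vector"
proof -
  have "finite {l. r *\<^sub>R Poly_Mapping.lookup x l \<noteq> 0}"
    by (rule finite_subset[of _ "Poly_Mapping.keys x"]) (auto simp: in_keys_iff)
  then show ?thesis by (simp add: scaleR_poly_mapping_def)
qed

declare lookup_add [simp] lookup_minus [simp] lookup_scaleR [simp]

lemma linear_var: "linear (\<lambda>x :: point. var x l)" "linear (zval :: point \<Rightarrow> real)"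
  by (rule linearI; simp)+

lemma point_eqI: "(\<And>l. var x l = var y l) \<Longrightarrow> zval x = zval y \<Longrightarrow> x = y"
  by (auto simp: prod_eq_iff intro: poly_mapping_eqI)

text \<open>With \<open>f\<close> as slacks and \<open>g\<close> as rates of change, a step of
  length \<open>t\<close> in either direction keeps all slacks nonnegative.\<close>

lemma small_step:
  fixes f g :: "'a \<Rightarrow> real"
  assumes "finite A" "\<And>a. a \<in> A \<Longrightarrow> 0 < f a"
  shows "\<exists>t>0. \<forall>a\<in>A. t * \<bar>g a\<bar> \<le> f a"
  using assms
proof (induction rule: finite_induct)
  case empty
  show ?case by (intro exI[of _ 1]) simp
next
  case (insert a A)
  then obtain t where t: "t > 0" "\<forall>a\<in>A. t * \<bar>g a\<bar> \<le> f a" by auto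
  \<comment> \<open>The summand 1 covers the case \<open>g a = 0\<close>.\<close>
  define t' where "t' = min t (f a / (\<bar>g a\<bar> + 1))"
  have "t' > 0" using t insert.prems by (simp add: t'_def)
  moreover have "t' * \<bar>g a\<bar> \<le> f a"
  proof -
    have "t' * \<bar>g a\<bar> \<le> f a / (\<bar>g a\<bar> + 1) * \<bar>g a\<bar>"
      by (intro mult_right_mono) (auto simp: t'_def)
    also have "\<dots> \<le> f a" using insert.prems[of a] by (simp add: field_simps)
    finally show ?thesis .
  qed
  moreover have "t' * \<bar>g b\<bar> \<le> f b" if "b \<in> A" for b
    using mult_right_mono[of t' t "\<bar>g b\<bar>"] t that by (force simp: t'_def)
  ultimately show ?case by blast
qed

lemma independent_if_dual:
  fixes \<phi> :: "'a::real_vector \<Rightarrow> 'a \<Rightarrow> real"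
  assumes "\<And>b. b \<in> B \<Longrightarrow> linear (\<phi> b)" "\<And>b. b \<in> B \<Longrightarrow> \<phi> b b \<noteq> 0"
    "\<And>b b'. b \<in> B \<Longrightarrow> b' \<in> B \<Longrightarrow> b' \<noteq> b \<Longrightarrow> \<phi> b b' = 0"
  shows "independent B"
proof
  assume "dependent B"
  then obtain b where b: "b \<in> B" "b \<in> span (B - {b})" by (auto simp: dependent_def)
  then have "\<phi> b b = 0"
    using linear_eq_0_on_span[of "\<phi> b" "B - {b}" b] assms by auto
  with b assms show False by auto
qed

fun label_of :: "constr \<Rightarrow> label" where
  "label_of (Nonneg l) = l"
| "label_of (Ineq l) = l"

fun opp :: "constr \<Rightarrow> constr" where
  "opp (Nonneg l) = Ineq l"
| "opp (Ineq l) = Nonneg l"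

lemma opp_opp [simp]: "opp (opp c) = c" by (cases c) auto
lemma label_of_opp [simp]: "label_of (opp c) = label_of c" by (cases c) auto
lemma opp_neq [simp]: "opp c \<noteq> c" "c \<noteq> opp c" by (cases c; simp)+
lemma same_label_iff: "label_of c = label_of c' \<longleftrightarrow> c' = c \<or> c' = opp c"
  by (cases c; cases c') auto

locale bads_lcp =
  fixes I :: splc_instance and P R \<epsilon> :: real
  assumes inst: "bads_instance I" and const: "lcp_constants I P R \<epsilon>"
begin

abbreviation "n \<equiv> num_agents I"
abbreviation "m \<equiv> num_bads I"
abbreviation "seg i j k \<equiv> i < n \<and> j < m \<and> k < pieces I i j"
abbreviation "D \<equiv> steep I"
abbreviation "W \<equiv> endow I"
abbreviation "L \<equiv> len I \<epsilon>"
abbreviation "Lbl \<equiv> labels I"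
abbreviation "tight' \<equiv> tight I P R \<epsilon>"
abbreviation "lcp \<equiv> lcp_solution I P R \<epsilon>"
abbreviation "vertex \<equiv> vertex_solution I P R \<epsilon>"
abbreviation "feas \<equiv> feasible I P R \<epsilon>"
abbreviation "start \<equiv> start_vertex I P"
abbreviation "ray \<equiv> ray_point I P"
abbreviation "lhs' \<equiv> lhs I \<epsilon>"
abbreviation "rhs' \<equiv> rhs I P R \<epsilon>"
abbreviation "double \<equiv> double_label I P R \<epsilon>"
abbreviation "relax \<equiv> relaxed I P R \<epsilon>"
abbreviation "is_run \<equiv> lemke_run I P R \<epsilon>"
abbreviation "nondeg \<equiv> nondegenerate I P R \<epsilon>"

lemma mem_labels [simp]:
  "Agent i \<in> Lbl \<longleftrightarrow> i < n" "Bad j \<in> Lbl \<longleftrightarrow> j < m"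
  "Flow i j k \<in> Lbl \<longleftrightarrow> seg i j k" "Surplus i j k \<in> Lbl \<longleftrightarrow> seg i j k"
  unfolding labels_def label_list_def by (auto simp: image_iff; force)+

lemma finite_labels [simp]: "finite Lbl"
  by (simp add: labels_def)

lemma n_pos: "0 < n" using inst by (simp add: bads_instance_def)

lemma m_pos: "0 < m"
proof -
  obtain j where "j < m" using inst n_pos unfolding bads_instance_def by blast
  then show ?thesis by simp
qed

lemma W_nonneg: "i < n \<Longrightarrow> j < m \<Longrightarrow> 0 \<le> W i j"
  and W_pos: "i < n \<Longrightarrow> \<exists>j<m. 0 < W i j"
  and W_sum: "j < m \<Longrightarrow> (\<Sum>i<n. W i j) = 1"
  using inst by (auto simp: bads_instance_def)

lemma plc: "i < n \<Longrightarrow> j < m \<Longrightarrow> plc_disutility (util I i j) (pieces I i j) (D i j) (seglen I i j)"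
  using inst by (auto simp: bads_instance_def)

lemma pieces_pos: "i < n \<Longrightarrow> j < m \<Longrightarrow> 0 < pieces I i j"
  and D_pos: "seg i j k \<Longrightarrow> 0 < D i j k"
  using plc[of i j] by (auto simp: plc_disutility_def)

lemma D_mono:
  assumes "seg i j k'" "k < k'"
  shows "D i j k < D i j k'"
  using assms(2,1)
proof (induction rule: strict_inc_induct)
  case (base k)
  then show ?case using plc[of i j] by (auto simp: plc_disutility_def)
next
  case (step k)
  have "Suc k < pieces I i j" using step by auto
  then have "D i j k < D i j (Suc k)"
    using step plc[of i j] unfolding plc_disutility_def by auto
  then show ?case using step by auto
qed

lemma P_pos: "0 < P" and eps_pos: "0 < \<epsilon>"
  using const by (auto simp: lcp_constants_def)

lemma finite_segments: "finite (segments I)"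
proof -
  have "segments I = (\<Union>i<n. \<Union>j<m. (\<lambda>k. (i, j, k)) ` {..<pieces I i j})"
    by (auto simp: segments_def)
  then show ?thesis by simp
qed

text \<open>Clears the denominator in \<open>lcp_constants\<close>. It makes the right-hand side of
  every flow inequality positive, so the primary ray satisfies these inequalities strictly.\<close>

lemma DR: assumes "seg i j k" shows "P < D i j k * R"
proof -
  let ?S = "(\<lambda>(i, j, k). D i j k) ` segments I"
  have mem: "D i j k \<in> ?S" using assms by (force simp: segments_def)
  have fin: "finite ?S" using finite_segments by simp
  have "Min ?S \<in> ?S" using fin mem by (intro Min_in) auto
  then have pos: "0 < Min ?S" using D_pos by (auto simp: segments_def)
  have "P < R * Min ?S"
    using const pos by (simp add: lcp_constants_def field_simps)
  moreover from this have "0 < R * Min ?S" using P_pos by linarith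
  then have "0 < R" using pos by (simp add: zero_less_mult_iff)
  then have "R * Min ?S \<le> R * D i j k" using Min_le[OF fin mem] by simp
  ultimately show ?thesis by (simp add: mult.commute)
qed

lemma R_pos: "0 < R"
proof -
  have "seg 0 0 0" using n_pos m_pos pieces_pos by auto
  from DR[OF this] D_pos[OF this] P_pos show ?thesis
    by (metis less_trans zero_less_mult_pos)
qed

lemma L_pos: "seg i j k \<Longrightarrow> 0 < L i j k"
  using plc[of i j] eps_pos by (auto simp: plc_disutility_def len_def)

section \<open>Slacks of constraints, extreme points and edges\<close>

definition cons :: "constr set" where
  "cons = Nonneg ` Lbl \<union> Ineq ` Lbl"

fun cval :: "constr \<Rightarrow> point \<Rightarrow> real" where
  "cval (Nonneg l) x = var x l"
| "cval (Ineq l) x = rhs' l - lhs' x l"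

text \<open>The linear part of \<open>cval\<close>: the rate at which the slack changes along a
  direction.\<close>

fun clin :: "constr \<Rightarrow> point \<Rightarrow> real" where
  "clin (Nonneg l) x = var x l"
| "clin (Ineq l) x = - lhs' x l"

text \<open>Cuts the space of points down to the finitely many coordinates of the instance; tight
  constraints say nothing about the others.\<close>

definition supp :: "point \<Rightarrow> bool" where
  "supp x \<longleftrightarrow> (\<forall>l. l \<notin> Lbl \<longrightarrow> var x l = 0)"

lemma supp_simps [simp]:
  "supp x \<Longrightarrow> supp y \<Longrightarrow> supp (x + y)" "supp x \<Longrightarrow> supp y \<Longrightarrow> supp (x - y)"
  "supp x \<Longrightarrow> supp (r *\<^sub>R x)" "supp (0, z)"
  by (auto simp: supp_def)

lemma finite_cons [simp]: "finite cons" by (simp add: cons_def)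

lemma mem_cons: "c \<in> cons \<longleftrightarrow> label_of c \<in> Lbl"
  by (cases c) (auto simp: cons_def)

lemma lhs_linear: "lhs' (x + y) l = lhs' x l + lhs' y l" "lhs' (r *\<^sub>R x) l = r * lhs' x l"
  by (cases l; simp add: sum.distrib algebra_simps sum_distrib_left)+

lemma linear_clin: "linear (clin c)"
  by (cases c) (rule linearI; simp add: lhs_linear)+

lemma cval_clin: "cval c x = cval c 0 + clin c x"
proof (cases c)
  case (Ineq l)
  moreover have "lhs' 0 l = 0" using lhs_linear(2)[of 0 0 l] by simp
  ultimately show ?thesis by simp
qed simp

lemma clin_diff: "clin c (x - y) = cval c x - cval c y"
  using linear_diff[OF linear_clin, of c x y] by (simp add: cval_clin[of c x] cval_clin[of c y])

lemma cval_add_clin: "cval c (x + d) = cval c x + clin c d"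
  using clin_diff[of c "x + d" x] by simp

lemma cval_convex: "cval c ((1 - t) *\<^sub>R x + t *\<^sub>R y) = (1 - t) * cval c x + t * cval c y"
proof -
  have "(1 - t) *\<^sub>R x + t *\<^sub>R y = x + t *\<^sub>R (y - x)" by (simp add: algebra_simps)
  then show ?thesis
    by (simp only: cval_add_clin linear_scale[OF linear_clin] clin_diff) (simp add: algebra_simps)
qed

lemma supp_iff: "supp x \<longleftrightarrow> Poly_Mapping.keys (fst x) \<subseteq> Lbl"
  by (auto simp: supp_def in_keys_iff subset_iff)

lemma feas_iff: "x \<in> feas \<longleftrightarrow> supp x \<and> 0 \<le> zval x \<and> (\<forall>c\<in>cons. 0 \<le> cval c x)"
  by (auto simp: feasible_def supp_iff cons_def ball_Un)

lemma tight_iff: "c \<in> tight' x \<longleftrightarrow> c \<in> cons \<and> cval c x = 0"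
  by (cases c) (auto simp: tight_def cons_def)

lemma lcp_iff: "lcp x \<longleftrightarrow> x \<in> feas \<and> (\<forall>l\<in>Lbl. Nonneg l \<in> tight' x \<or> Ineq l \<in> tight' x)"
  by (auto simp: lcp_solution_def tight_def)

lemma double_iff: "double x l \<longleftrightarrow> Nonneg l \<in> tight' x \<and> Ineq l \<in> tight' x"
  by (auto simp: double_label_def tight_iff mem_cons)

lemma lcp_feas: "lcp x \<Longrightarrow> x \<in> feas" by (simp add: lcp_iff)
lemma vertex_lcp: "vertex x \<Longrightarrow> lcp x" by (simp add: vertex_solution_def)
lemma vertex_feas: "vertex x \<Longrightarrow> x \<in> feas" by (simp add: vertex_lcp lcp_feas)
lemma vertex_extreme: "vertex x \<Longrightarrow> x extreme_point_of feas" by (simp add: vertex_solution_def)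
lemma feas_supp: "x \<in> feas \<Longrightarrow> supp x" by (simp add: feas_iff)

lemma lcp_opp: "lcp x \<Longrightarrow> c \<in> cons \<Longrightarrow> c \<in> tight' x \<or> opp c \<in> tight' x"
  by (cases c) (auto simp: lcp_iff cons_def)

text \<open>A nonzero direction that changes no tight constraint could be followed a little both
  ways. The constraint on the sign of \<open>z\<close> carries no label and is not in
  \<open>cons\<close>, so it has to be slack.\<close>

lemma vertex_kernel:
  assumes "x extreme_point_of feas" "0 < zval x" "supp d" "\<And>c. c \<in> tight' x \<Longrightarrow> clin c d = 0"
  shows "d = 0"
proof (rule ccontr)
  assume "d \<noteq> 0"
  have x: "x \<in> feas" using assms(1) by (simp add: extreme_point_of_def)
  have "\<forall>c\<in>cons - tight' x. 0 < cval c x"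
    using x by (auto simp: feas_iff tight_iff less_le)
  then obtain t1 where t1: "t1 > 0" "\<forall>c\<in>cons - tight' x. t1 * \<bar>clin c d\<bar> \<le> cval c x"
    using small_step[of "cons - tight' x" "\<lambda>c. cval c x" "\<lambda>c. clin c d"] by auto
  obtain t2 where t2: "t2 > 0" "t2 * \<bar>zval d\<bar> \<le> zval x"
    using small_step[of "{()}" "\<lambda>_. zval x" "\<lambda>_. zval d"] assms(2) by auto
  define t where "t = min t1 t2"
  have t: "t > 0" "t * \<bar>zval d\<bar> \<le> zval x" "\<And>c. c \<in> cons \<Longrightarrow> c \<notin> tight' x \<Longrightarrow> t * \<bar>clin c d\<bar> \<le> cval c x"
  proof -
    show "t > 0" using t1 t2 by (simp add: t_def)
    show "t * \<bar>zval d\<bar> \<le> zval x"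
      using t2 mult_right_mono[of t t2 "\<bar>zval d\<bar>"] by (simp add: t_def)
    fix c assume "c \<in> cons" "c \<notin> tight' x"
    then have "t1 * \<bar>clin c d\<bar> \<le> cval c x" using t1 by blast
    moreover have "t * \<bar>clin c d\<bar> \<le> t1 * \<bar>clin c d\<bar>" by (intro mult_right_mono) (auto simp: t_def)
    ultimately show "t * \<bar>clin c d\<bar> \<le> cval c x" by linarith
  qed
  have "x + s *\<^sub>R d \<in> feas" if s: "\<bar>s\<bar> = t" for s
  proof -
    have 1: "- (t * \<bar>y\<bar>) \<le> s * y" for y
      using s by (metis abs_le_iff abs_mult minus_le_iff order_refl)
    show ?thesis
      unfolding feas_iff
    proof (intro conjI ballI)
      show "supp (x + s *\<^sub>R d)" using x assms(3) by (simp add: feas_iff)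
      show "0 \<le> zval (x + s *\<^sub>R d)" using 1[of "zval d"] t(2) by simp
    next
      fix c assume c: "c \<in> cons"
      have eq: "cval c (x + s *\<^sub>R d) = cval c x + s * clin c d"
        by (simp add: cval_add_clin linear_scale[OF linear_clin])
      show "0 \<le> cval c (x + s *\<^sub>R d)"
      proof (cases "c \<in> tight' x")
        case True
        then show ?thesis using assms(4) eq by (simp add: tight_iff)
      next
        case False
        then show ?thesis using t(3)[OF c] 1[of "clin c d"] eq by simp
      qed
    qed
  qed
  from this[of t] this[of "-t"] have feas: "x + t *\<^sub>R d \<in> feas" "x + (- t) *\<^sub>R d \<in> feas"
    using t(1) by auto
  have "x = (1 - 1/2) *\<^sub>R (x + t *\<^sub>R d) + (1/2) *\<^sub>R (x + (- t) *\<^sub>R d)"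
    by (simp add: algebra_simps flip: scaleR_add_left)
  moreover have "x + t *\<^sub>R d \<noteq> x + (- t) *\<^sub>R d"
    using t(1) \<open>d \<noteq> 0\<close> by (simp add: eq_neg_iff_add_eq_0 flip: scaleR_add_left)
  ultimately have "x \<in> open_segment (x + t *\<^sub>R d) (x + (- t) *\<^sub>R d)"
    unfolding in_segment by (intro conjI exI[of _ "1/2"]) auto
  then show False using assms(1) feas by (auto simp: extreme_point_of_def)
qed

lemma vertex_eq:
  assumes "x extreme_point_of feas" "0 < zval x" "supp y" "tight' x \<subseteq> tight' y"
  shows "y = x"
proof -
  have "supp x" using assms(1) by (simp add: extreme_point_of_def feas_iff)
  moreover have "clin c (y - x) = 0" if "c \<in> tight' x" for c
    using that assms(4) by (auto simp: clin_diff tight_iff)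
  ultimately have "y - x = 0" using assms(3) by (intro vertex_kernel[OF assms(1,2)]) simp_all
  then show ?thesis by simp
qed

text \<open>If a convex combination has slack 0, so do both endpoints, because slacks are
  nonnegative. The sign constraint of \<open>z\<close> is treated apart since it has no
  label.\<close>

lemma extremeI:
  assumes "x \<in> feas"
    "\<And>y. y \<in> feas \<Longrightarrow> tight' x \<subseteq> tight' y \<Longrightarrow> zval x = 0 \<longrightarrow> zval y = 0 \<Longrightarrow> y = x"
  shows "x extreme_point_of feas"
  unfolding extreme_point_of_def
proof (intro conjI ballI assms(1) notI)
  fix a b assume ab: "a \<in> feas" "b \<in> feas" "x \<in> open_segment a b"
  then obtain u where u: "0 < u" "u < 1" "x = (1 - u) *\<^sub>R a + u *\<^sub>R b" and "a \<noteq> b"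
    unfolding in_segment by blast
  have nn: "s = 0 \<and> t = 0" if "(1 - u) * s + u * t = 0" "0 \<le> s" "0 \<le> t" for s t :: real
    using that u by (smt (verit) mult_nonneg_nonneg mult_pos_pos)
  have "cval c a = 0 \<and> cval c b = 0" if "c \<in> tight' x" for c
    using that ab u(3) by (intro nn) (auto simp: tight_iff feas_iff cval_convex)
  then have "tight' x \<subseteq> tight' a" "tight' x \<subseteq> tight' b" by (auto simp: tight_iff)
  moreover have "zval a = 0 \<and> zval b = 0" if "zval x = 0"
    using that ab u(3) by (intro nn) (auto simp: feas_iff)
  ultimately have "a = x" "b = x" using assms(2) ab by blast+
  with \<open>a \<noteq> b\<close> show False by simp
qed

text \<open>Leaving \<open>v\<close> with all tight constraints but \<open>c\<close> kept, the slack
  of \<open>c\<close> must grow, and by \<open>vertex_kernel\<close> its growth determines the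
  direction up to a positive factor \<open>r\<close>. Of two points on one ray the nearer lies
  between \<open>v\<close> and the farther, so it could not be extreme.\<close>

lemma edge_unique:
  assumes v: "v extreme_point_of feas" "0 < zval v"
    and w: "w extreme_point_of feas" "w \<noteq> v" "tight' v - {c} \<subseteq> tight' w"
    and w': "w' extreme_point_of feas" "w' \<noteq> v" "tight' v - {c} \<subseteq> tight' w'"
  shows "w = w'"
proof -
  have fv: "v \<in> feas" using v(1) by (simp add: extreme_point_of_def)
  have dir: "clin c (u - v) > 0 \<and> supp (u - v) \<and> (\<forall>c'\<in>tight' v - {c}. clin c' (u - v) = 0)"
    if u: "u extreme_point_of feas" "u \<noteq> v" "tight' v - {c} \<subseteq> tight' u" for u
  proof -
    have fu: "u \<in> feas" using u(1) by (simp add: extreme_point_of_def)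
    have 0: "\<forall>c'\<in>tight' v - {c}. clin c' (u - v) = 0"
      using u(3) by (auto simp: clin_diff tight_iff subset_iff)
    have "\<exists>c'\<in>tight' v. clin c' (u - v) \<noteq> 0"
      using vertex_kernel[OF v, of "u - v"] u(2) fu fv by (auto simp: feas_supp)
    with 0 have c: "c \<in> tight' v" "clin c (u - v) \<noteq> 0" by auto
    then have "clin c (u - v) = cval c u" by (simp add: clin_diff tight_iff)
    moreover have "0 \<le> cval c u" using fu c(1) by (auto simp: feas_iff tight_iff)
    ultimately show ?thesis using 0 c fu fv by (auto simp: feas_supp)
  qed
  note d = dir[OF w] and d' = dir[OF w']
  define r where "r = clin c (w' - v) / clin c (w - v)"
  have "r > 0" using d d' by (simp add: r_def)
  have "(w' - v) - r *\<^sub>R (w - v) = 0"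
  proof (rule vertex_kernel[OF v])
    show "supp ((w' - v) - r *\<^sub>R (w - v))" using d d' by simp
    fix c' assume "c' \<in> tight' v"
    then show "clin c' ((w' - v) - r *\<^sub>R (w - v)) = 0"
      using d d' by (cases "c' = c")
        (auto simp: linear_diff[OF linear_clin] linear_scale[OF linear_clin] r_def)
  qed
  then have eq: "w' = (1 - r) *\<^sub>R v + r *\<^sub>R w" by (simp add: algebra_simps)
  consider "r < 1" | "r = 1" | "r > 1" by linarith
  then show ?thesis
  proof cases
    case 1
    then have "w' \<in> open_segment v w"
      unfolding in_segment using eq \<open>r > 0\<close> w(2) by blast
    then show ?thesis using w'(1) w(1) fv by (auto simp: extreme_point_of_def)
  next
    case 2
    then show ?thesis using eq by simp
  next
    case 3
    have "w = (1 - 1/r) *\<^sub>R v + (1/r) *\<^sub>R w'"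
      unfolding eq using \<open>r > 0\<close> by (simp add: algebra_simps diff_divide_distrib flip: scaleR_add_left)
    then have "w \<in> open_segment v w'"
      unfolding in_segment using 3 w'(2) by (intro conjI exI[of _ "1/r"]) auto
    then show ?thesis using w'(1) w(1) fv by (auto simp: extreme_point_of_def)
  qed
qed

definition unit_point :: "label \<Rightarrow> point" where
  "unit_point l = (Poly_Mapping.single l 1, 0)"

lemma unit_point_simps [simp]: "var (unit_point l) l' = (if l' = l then 1 else 0)"
  "zval (unit_point l) = 0"
  by (auto simp: unit_point_def lookup_single when_def)

lemma supp_unit_point: "l \<in> Lbl \<Longrightarrow> supp (unit_point l)"
  by (auto simp: supp_def)

text \<open>Fewer than \<open>N + 1\<close> tight constraints cannot determine a point of the \<open>N + 1\<close>-dimensional space.\<close>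

lemma double_label_exists:
  assumes v: "vertex v" "0 < zval v"
  shows "\<exists>l. double v l"
proof (rule ccontr)
  assume no: "\<not> ?thesis"
  \<comment> \<open>Without a double label \<open>c l\<close> is the only tight constraint of
    \<open>l\<close>.\<close>
  define c where "c l = (if Nonneg l \<in> tight' v then Nonneg l else Ineq l)" for l
  have tight: "c' = c (label_of c')" if "c' \<in> tight' v" for c'
    using that no by (cases c') (auto simp: c_def double_iff)
  define T where "T = unit_point ` Lbl"
  define B where "B = insert (0, 1) T"
  have "independent B"
  proof (rule independent_if_dual)
    show "linear (\<lambda>x :: point. if fst b = 0 then zval x else var x (SOME l. b = unit_point l))"
      for b :: point
      using linear_var by (cases "fst b = 0") auto
    have some: "(SOME l'. unit_point l = unit_point l') = l" for l
      by (rule some_equality) (metis unit_point_simps(1) zero_neq_one)+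
    have nz: "fst (unit_point l) \<noteq> 0" for l
      by (metis unit_point_simps(1) lookup_zero zero_neq_one)
    show "b \<in> B \<Longrightarrow> (if fst b = 0 then zval b else var b (SOME l. b = unit_point l)) \<noteq> 0" for b
      by (auto simp: B_def T_def some nz)
    show "b \<in> B \<Longrightarrow> b' \<in> B \<Longrightarrow> b' \<noteq> b \<Longrightarrow>
      (if fst b = 0 then zval b' else var b' (SOME l. b = unit_point l)) = 0" for b b'
      by (auto simp: B_def T_def some nz)
  qed
  have finT: "finite T" by (simp add: T_def)
  have "(0, 1) \<notin> T" unfolding T_def by (auto simp: unit_point_def)
  then have cardB: "card B = Suc (card T)" using finT by (simp add: B_def)
  \<comment> \<open>\<open>F\<close> collects the rates of change of the chosen constraints. It maps
    the span of \<open>B\<close> into the span of \<open>T\<close>, which has one generator less, so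
    some nonzero direction changes no tight constraint, against
    \<open>vertex_kernel\<close>.\<close>
  define F where "F d = (\<Sum>l\<in>Lbl. clin (c l) d *\<^sub>R unit_point l)" for d :: point
  have "linear F"
    unfolding F_def
    by (intro linear_compose_sum ballI linearI)
      (auto simp: linear_add[OF linear_clin] linear_scale[OF linear_clin] scaleR_add_left)
  have F_span: "F d \<in> span T" for d
    unfolding F_def T_def by (intro span_sum span_scale span_base) auto
  have F_var: "var (F d) l = clin (c l) d" if "l \<in> Lbl" for d l
  proof -
    have "var (F d) l = (\<Sum>l'\<in>Lbl. clin (c l') d * var (unit_point l') l)"
      unfolding F_def by (simp add: fst_sum lookup_sum)
    also have "\<dots> = (\<Sum>l'\<in>Lbl. if l' = l then clin (c l') d else 0)"
      by (intro sum.cong) auto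
    finally show ?thesis using that by simp
  qed
  have "\<not> inj_on F (span B)"
  proof
    assume inj: "inj_on F (span B)"
    then have "independent (F ` B)"
      using linear_independent_injective_image[OF \<open>linear F\<close> \<open>independent B\<close>] by simp
    moreover have "F ` B \<subseteq> span T" using F_span by auto
    ultimately have "card (F ` B) \<le> card T" using independent_span_bound[OF finT] by blast
    moreover have "card (F ` B) = card B"
      using inj by (intro card_image) (meson inj_on_subset span_superset)
    ultimately show False using cardB by simp
  qed
  then obtain d where d: "d \<in> span B" "F d = 0" "d \<noteq> 0"
    using linear_inj_on_iff_eq_0[OF \<open>linear F\<close> subspace_span] by blast
  have "supp d"
  proof -
    have "var d l = 0" if "l \<notin> Lbl" for l
      by (rule linear_eq_0_on_span[OF linear_var(1) _ d(1)]) (use that in \<open>auto simp: B_def T_def\<close>)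
    then show ?thesis by (simp add: supp_def)
  qed
  moreover have "clin c' d = 0" if "c' \<in> tight' v" for c'
  proof -
    have "label_of c' \<in> Lbl" using that by (simp add: tight_iff mem_cons)
    then have "clin (c (label_of c')) d = 0" using F_var[of "label_of c'" d] d(2) by simp
    then show ?thesis using tight[OF that] by simp
  qed
  ultimately have "d = 0" using vertex_kernel[OF vertex_extreme[OF v(1)] v(2)] by blast
  with d show False by simp
qed

subsection \<open>Executions do not cycle\<close>

lemma relaxed_cases: "relax u l = (if Ineq l \<in> tight' u then Ineq l else Nonneg l)"
  by (simp add: relaxed_def)

lemma label_of_relaxed [simp]: "label_of (relax u l) = l"
  by (simp add: relaxed_cases)

definition generic :: "point \<Rightarrow> bool" where
  "generic v \<longleftrightarrow> vertex v \<and> 0 < zval v \<and> (\<exists>!l. double v l)"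

text \<open>An edge traversed from \<open>u\<close> to \<open>v\<close> is the edge at \<open>v\<close> that is not taken next.\<close>

lemma back_edge:
  assumes u: "generic u" and v: "generic v" and "u \<noteq> v"
    and lu: "double u lu" and lv: "double v lv"
    and c: "label_of c = lu" and sub: "tight' u - {c} \<subseteq> tight' v"
  shows "tight' v - {opp (relax u lv)} \<subseteq> tight' u"
proof -
  have uniq_v: "c' \<in> tight' v \<Longrightarrow> opp c' \<in> tight' v \<Longrightarrow> label_of c' = lv" for c'
    using v lv unfolding generic_def double_iff by (cases c'; auto)
  have lcp_u: "lcp u" using u by (simp add: generic_def vertex_lcp)
  have opp_c: "opp c \<in> tight' u"
    using lu c by (cases c) (auto simp: double_iff)
  have A: "c' \<in> tight' u - {c}" if "c' \<in> tight' v" "label_of c' \<noteq> lv" for c'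
  proof (rule ccontr)
    assume no: "c' \<notin> tight' u - {c}"
    have "c' \<in> cons" using that by (simp add: tight_iff)
    then have "opp c' \<in> tight' u - {c}"
      using lcp_opp[OF lcp_u] no opp_c by auto
    then have "opp c' \<in> tight' v" using sub by blast
    then show False using that uniq_v by blast
  qed
  have B: "c' \<in> tight' u - {c} \<or> opp c' \<in> tight' u - {c}" if "label_of c' = lv" for c'
  proof -
    have "c' \<in> cons" using that lv by (auto simp: double_iff tight_iff mem_cons)
    then show ?thesis using lcp_opp[OF lcp_u] opp_c by auto
  qed
  \<comment> \<open>If both constraints of \<open>lv\<close> were tight at \<open>u\<close>,
    everything tight at \<open>v\<close> would be tight at \<open>u\<close>, and the two vertices
    would coincide.\<close>
  have ne: "\<exists>c'. label_of c' = lv \<and> c' \<notin> tight' u"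
  proof (rule ccontr)
    assume *: "\<not> ?thesis"
    then have "tight' v \<subseteq> tight' u" using A by blast
    then have "u = v"
      using u v by (intro vertex_eq) (auto simp: generic_def vertex_extreme vertex_feas feas_supp)
    with \<open>u \<noteq> v\<close> show False by simp
  qed
  \<comment> \<open>Exactly one constraint of \<open>lv\<close> is tight at \<open>u\<close>, and
    \<open>relax u lv\<close> is that one; its opposite has just become tight at
    \<open>v\<close>.\<close>
  have "opp (relax u lv) \<notin> tight' u"
    using ne B by (auto simp: relaxed_cases) (metis label_of.simps opp.simps constr.exhaust)+
  then have "relax u lv \<in> tight' u"
    using B[of "relax u lv"] by auto
  then show ?thesis
    using A by (auto simp: same_label_iff[of _ "relax u lv"]) (metis label_of_relaxed same_label_iff)
qed

section \<open>The start vertex and the primary ray\<close>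

lemma zval_start_ge: "i < n \<Longrightarrow> P * (\<Sum>j<m. W i j) \<le> zval start"
  using P_pos by (auto simp: start_vertex_def)

lemma zval_start: "\<exists>i<n. zval start = P * (\<Sum>j<m. W i j)"
proof -
  have "Max ((\<lambda>i. \<Sum>j<m. W i j) ` {..<n}) \<in> (\<lambda>i. \<Sum>j<m. W i j) ` {..<n}"
    using n_pos by (intro Max_in) auto
  then show ?thesis by (auto simp: start_vertex_def)
qed

lemma sum_W_pos: "i < n \<Longrightarrow> 0 < (\<Sum>j<m. W i j)"
  using W_nonneg W_pos[of i] by (force intro!: sum_pos2)

lemma zval_start_pos: "0 < zval start"
  using zval_start sum_W_pos P_pos by (metis mult_pos_pos)

lemma zero_z_feas: "(0, z) \<in> feas \<longleftrightarrow> zval start \<le> z"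
proof
  show "zval start \<le> z" if "(0, z) \<in> feas"
  proof -
    note f = that
    obtain i where i: "i < n" "zval start = P * (\<Sum>j<m. W i j)" using zval_start by blast
    have "0 \<le> cval (Ineq (Agent i)) (0, z)" using f i by (simp add: feas_iff mem_cons del: cval.simps)
    then show ?thesis using i by simp
  qed
next
  assume z: "zval start \<le> z"
  have "0 \<le> cval c (0, z)" if c: "c \<in> cons" for c
  proof (cases c)
    case (Ineq l)
    show ?thesis
    proof (cases l)
      case (Agent i)
      have "i < n" using c Ineq Agent by (simp add: mem_cons)
      then show ?thesis using zval_start_ge[of i] z Ineq Agent by simp
    next
      case (Bad j)
      then show ?thesis using Ineq P_pos by simp
    next
      case (Flow i j k)
      have "seg i j k" using c Ineq Flow by (simp add: mem_cons)
      then show ?thesis using Ineq Flow DR[of i j k] by simp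
    next
      case (Surplus i j k)
      have "seg i j k" using c Ineq Surplus by (simp add: mem_cons)
      then show ?thesis using Ineq Surplus L_pos[of i j k] P_pos by simp
    qed
  qed simp
  then show "(0, z) \<in> feas" using z zval_start_pos by (auto simp: feas_iff)
qed

lemma zero_z_tight: "l \<in> Lbl \<Longrightarrow> Nonneg l \<in> tight' (0, z)"
  by (simp add: tight_iff mem_cons)

lemma zero_z_lcp: "lcp (0, z) \<longleftrightarrow> zval start \<le> z"
  by (auto simp: lcp_iff zero_z_feas zero_z_tight)

lemma var_zero_if_tight: "supp y \<Longrightarrow> Nonneg ` Lbl \<subseteq> tight' y \<Longrightarrow> y = (0, zval y)"
proof (rule point_eqI)
  fix l assume "supp y" "Nonneg ` Lbl \<subseteq> tight' y"
  then show "var y l = var (0, zval y) l"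
    by (cases "l \<in> Lbl") (auto simp: tight_iff supp_def)
qed simp

lemma start_eq: "start = (0, zval start)" by (simp add: start_vertex_def)
lemma ray_eq: "ray = (0, zval start + 1)" by (simp add: ray_point_def)

text \<open>The vanishing variables fix all coordinates but \<open>z\<close>, and the budget
  inequality of an agent attaining the maximum fixes \<open>z\<close>.\<close>

lemma start_vertex: "vertex start"
  unfolding vertex_solution_def
proof
  show "lcp start" by (metis start_eq zero_z_lcp order_refl)
  show "start extreme_point_of feas"
  proof (rule extremeI)
    show "start \<in> feas" by (metis start_eq zero_z_feas order_refl)
    fix y assume y: "y \<in> feas" "tight' start \<subseteq> tight' y"
    have "Nonneg ` Lbl \<subseteq> tight' start" using zero_z_tight by (subst start_eq) auto
    then have eq: "y = (0, zval y)" using y by (intro var_zero_if_tight feas_supp) auto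
    obtain i where i: "i < n" "zval start = P * (\<Sum>j<m. W i j)" using zval_start by blast
    then have "Ineq (Agent i) \<in> tight' start"
      by (subst start_eq) (simp add: tight_iff mem_cons)
    then have "cval (Ineq (Agent i)) y = 0" using y(2) tight_iff by blast
    then have "cval (Ineq (Agent i)) (0, zval y) = 0" using eq by metis
    then have "zval y = zval start" using i by simp
    then show "y = start" using eq start_eq by metis
  qed
qed

text \<open>Inside the primary ray every inequality is slack, so at the start vertex the double
  label's inequality has just become tight and its variable is released.\<close>

lemma ray_relaxed: "l \<in> Lbl \<Longrightarrow> relax ray l = Nonneg l"
proof -
  assume l: "l \<in> Lbl"
  have "0 < cval (Ineq l) ray"
  proof (cases l)
    case (Agent i)
    then show ?thesis using zval_start_ge[of i] l by (simp add: ray_eq)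
  next
    case (Flow i j k)
    then show ?thesis using DR[of i j k] l by (simp add: ray_eq)
  next
    case (Surplus i j k)
    then show ?thesis using L_pos[of i j k] P_pos l by (simp add: ray_eq)
  qed (use P_pos in \<open>simp add: ray_eq\<close>)
  then show ?thesis by (simp add: relaxed_cases tight_iff)
qed

lemma zero_z_vertex: "vertex (0, z) \<Longrightarrow> (0, z) = start"
proof (rule ccontr)
  assume v: "vertex (0, z)" and "(0, z) \<noteq> start"
  then have z: "zval start < z"
    using zero_z_feas[of z] vertex_feas[OF v] start_eq by (metis order_le_less)
  have "(0, z) = (1 - 1/2) *\<^sub>R start + (1/2) *\<^sub>R (0, 2 * z - zval start)"
    by (subst start_eq) (simp add: field_simps)
  moreover have "start \<noteq> (0, 2 * z - zval start)" using z by (subst start_eq) simp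
  ultimately have "(0, z) \<in> open_segment start (0, 2 * z - zval start)"
    unfolding in_segment by (intro conjI exI[of _ "1/2"]) auto
  moreover have "start \<in> feas" "(0, 2 * z - zval start) \<in> feas"
    using start_vertex vertex_feas z by (auto simp: zero_z_feas)
  ultimately show False using vertex_extreme[OF v] by (auto simp: extreme_point_of_def)
qed

lemma run_vertex:
  assumes "is_run vs" "t < length vs"
  shows "vertex (vs ! t)"
proof (cases t)
  case 0
  then show ?thesis using assms start_vertex by (auto simp: lemke_run_def hd_conv_nth)
next
  case (Suc s)
  then show ?thesis using assms by (auto simp: lemke_run_def pivot_step_def)
qed

lemma run_take:
  assumes "is_run vs" "t < length vs"
  shows "is_run (take (Suc t) vs)"
proof -
  have "(ray # take (Suc t) vs) ! s = (ray # vs) ! s" if "s \<le> t" for s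
    using that by (cases s) auto
  with assms show ?thesis by (auto simp: lemke_run_def hd_take)
qed

lemma last_take_Suc: "t < length vs \<Longrightarrow> last (take (Suc t) vs) = vs ! t"
  by (simp add: take_Suc_conv_app_nth)

lemma run_generic:
  assumes "nondeg" "is_run vs" "t < length vs" "0 < zval (vs ! t)"
  shows "generic (vs ! t)"
  using assms run_take[OF assms(2,3)] last_take_Suc[OF assms(3)] run_vertex[OF assms(2,3)]
  unfolding nondegenerate_def generic_def by metis

lemma run_step:
  assumes "is_run vs" "Suc t < length vs"
  obtains l where "0 < zval (vs ! t)" "double (vs ! t) l" "vs ! Suc t \<noteq> vs ! t"
    "tight' (vs ! t) - {relax ((ray # vs) ! t) l} \<subseteq> tight' (vs ! Suc t)"
  using assms unfolding lemke_run_def pivot_step_def edge_def by blast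

text \<open>The edge on which a vertex was reached is the second edge of its double label. For the
  first vertex the primary ray takes the place of this edge; later it is
  \<open>back_edge\<close>.\<close>

lemma run_back:
  assumes nd: "nondeg" and run: "is_run vs" "t < length vs"
    and z: "0 < zval (vs ! t)" and l: "double (vs ! t) l"
  shows "tight' (vs ! t) - {opp (relax ((ray # vs) ! t) l)} \<subseteq> tight' ((ray # vs) ! t)"
proof (cases t)
  case 0
  have "l \<in> Lbl" using l by (simp add: double_label_def)
  have vs0: "vs ! 0 = start" using run by (auto simp: lemke_run_def hd_conv_nth)
  have "c \<in> tight' ray" if "c \<in> tight' start" "c \<noteq> Ineq l" for c
  proof -
    have "c \<noteq> Ineq l'" for l'
    proof
      assume c: "c = Ineq l'"
      have "Nonneg l' \<in> tight' start" using that c zero_z_tight[of l'] start_eq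
        by (metis label_of.simps(2) mem_cons tight_iff)
      with that c have "double (vs ! t) l'" by (simp add: double_iff vs0 0)
      then have "l' = l" using run_generic[OF nd run z] l unfolding generic_def by blast
      with that c show False by simp
    qed
    then obtain l' where "c = Nonneg l'" by (cases c) auto
    with that show ?thesis by (simp add: ray_eq tight_iff)
  qed
  with \<open>l \<in> Lbl\<close> show ?thesis by (auto simp: 0 vs0 ray_relaxed)
next
  case (Suc s)
  then obtain l' where l': "0 < zval (vs ! s)" "double (vs ! s) l'" "vs ! Suc s \<noteq> vs ! s"
    "tight' (vs ! s) - {relax ((ray # vs) ! s) l'} \<subseteq> tight' (vs ! Suc s)"
    using run_step[OF run(1), of s] run(2) by auto
  have g: "generic (vs ! s)" "generic (vs ! t)"
    using run_generic[OF nd run(1)] l'(1) z Suc run(2) by auto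
  have "tight' (vs ! t) - {opp (relax (vs ! s) l)} \<subseteq> tight' (vs ! s)"
    by (rule back_edge[OF g _ l'(2) l, where c = "relax ((ray # vs) ! s) l'"])
      (use l'(3,4) Suc in auto)
  then show ?thesis using Suc by simp
qed

text \<open>Take the first index \<open>b\<close> at which a vertex recurs, equal to the one at
  \<open>a\<close>. Its predecessor \<open>t\<close> lies on one of the two edges at this vertex,
  and each edge has at most one other end. So the vertex at \<open>t\<close> already neighbours
  \<open>a\<close> in the run, which the minimality of \<open>b\<close> reduces to an immediate
  reversal or a return along the primary ray.\<close>

theorem run_distinct:
  assumes nd: "nondeg" and run: "is_run vs"
  shows "distinct vs"
proof (rule ccontr)
  assume "\<not> distinct vs"
  then have ex: "\<exists>b<length vs. \<exists>a<b. vs ! a = vs ! b"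
    unfolding distinct_conv_nth by (metis linorder_neqE_nat)
  define b where "b = (LEAST b. b < length vs \<and> (\<exists>a<b. vs ! a = vs ! b))"
  have b: "b < length vs" "\<exists>a<b. vs ! a = vs ! b"
    unfolding b_def using LeastI_ex[OF ex] by blast+
  then obtain a where a: "a < b" "vs ! a = vs ! b" by blast
  obtain t where t: "b = Suc t" using a by (cases b) auto
  have dist: "x = y" if "vs ! x = vs ! y" "x < b" "y < b" for x y
  proof -
    have least: "\<not> (y < length vs \<and> (\<exists>a<y. vs ! a = vs ! y))" if "y < b" for y
      using that unfolding b_def by (rule not_less_Least)
    show ?thesis
      using least[of x] least[of y] that b(1) by (metis linorder_neqE_nat order.strict_trans)
  qed
  have tl: "Suc t < length vs" using b t by simp
  have al: "Suc a < length vs" using a b by simp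
  obtain lt where lt: "0 < zval (vs ! t)" "double (vs ! t) lt" "vs ! b \<noteq> vs ! t"
    "tight' (vs ! t) - {relax ((ray # vs) ! t) lt} \<subseteq> tight' (vs ! b)"
    using run_step[OF run tl] t by metis
  obtain la where la: "0 < zval (vs ! a)" "double (vs ! a) la" "vs ! Suc a \<noteq> vs ! a"
    "tight' (vs ! a) - {relax ((ray # vs) ! a) la} \<subseteq> tight' (vs ! Suc a)"
    using run_step[OF run al] by metis
  have "a \<noteq> t" using lt(3) a by auto
  then have "a < t" using a t by simp
  have vert: "x < length vs \<Longrightarrow> vs ! x extreme_point_of feas" for x
    using run_vertex[OF run] vertex_extreme by blast
  have back_t: "tight' (vs ! a) - {opp (relax (vs ! t) la)} \<subseteq> tight' (vs ! t)"
    using run_back[OF nd run b(1), of la] la a t by simp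
  have at: "vs ! t \<noteq> vs ! a" using lt(3) a by auto
  \<comment> \<open>The two edges at the repeated vertex: the one by which the run left it, and the
    one by which it was first reached.\<close>
  consider (forward) "opp (relax (vs ! t) la) = relax ((ray # vs) ! a) la"
    | (backward) "opp (relax (vs ! t) la) = opp (relax ((ray # vs) ! a) la)"
    using same_label_iff[of "relax (vs ! t) la" "relax ((ray # vs) ! a) la"]
    by auto
  then show False
  proof cases
    case forward
    have "vs ! t = vs ! Suc a"
      using edge_unique[OF vert la(1) vert at back_t vert la(3)] la(4) forward al tl by simp
    \<comment> \<open>Now the run would turn back on the edge just traversed. Both constraints of
      the double label \<open>lt\<close> would then be kept in turn, so everything tight at
      \<open>t\<close> is tight at \<open>a\<close>.\<close>
    then have t_eq: "t = Suc a" using dist[of t "Suc a"] \<open>a < t\<close> t by simp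
    have "tight' (vs ! t) - {opp (relax (vs ! a) lt)} \<subseteq> tight' (vs ! a)"
      using run_back[OF nd run _ lt(1,2)] tl t_eq by simp
    moreover have "tight' (vs ! t) - {relax (vs ! a) lt} \<subseteq> tight' (vs ! a)"
      using lt(4) a t_eq by simp
    ultimately have "tight' (vs ! t) \<subseteq> tight' (vs ! a)"
      using opp_neq by blast
    then have "vs ! a = vs ! t"
      using vertex_eq[OF vert lt(1)] tl run_vertex[OF run, of a] al
      by (simp add: feas_supp vertex_feas)
    with at show False by simp
  next
    case backward
    have back_a: "tight' (vs ! a) - {opp (relax (vs ! t) la)} \<subseteq> tight' ((ray # vs) ! a)"
      using run_back[OF nd run _ la(1,2)] al backward by simp
    show False
    proof (cases a)
      \<comment> \<open>Here the second edge at \<open>a\<close> is the primary ray, and its only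
        vertex is the start vertex.\<close>
      case 0
      have "la \<in> Lbl" using la(2) by (simp add: double_label_def)
      then have "opp (relax (vs ! t) la) = Ineq la"
        using backward 0 by (simp add: ray_relaxed)
      moreover have "vs ! a = start" using 0 run by (auto simp: lemke_run_def hd_conv_nth)
      ultimately have "Nonneg ` Lbl \<subseteq> tight' (vs ! t)"
      proof -
        assume 1: "opp (relax (vs ! t) la) = Ineq la" and 2: "vs ! a = start"
        show ?thesis
        proof
          fix c assume "c \<in> Nonneg ` Lbl"
          then obtain l where l: "l \<in> Lbl" "c = Nonneg l" by blast
          have "Nonneg l \<in> tight' start" using zero_z_tight[OF l(1)] by (subst start_eq)
          then show "c \<in> tight' (vs ! t)" using back_t l unfolding 1 2 by blast
        qed
      qed
      then have "vs ! t = (0, zval (vs ! t))"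
        using run_vertex[OF run, of t] tl by (intro var_zero_if_tight feas_supp vertex_feas) auto
      then have "vs ! t = start" using zero_z_vertex run_vertex[OF run, of t] tl by (metis Suc_lessD)
      with \<open>vs ! a = start\<close> at show False by simp
    next
      case (Suc a')
      have ne: "vs ! a' \<noteq> vs ! a" using dist[of a' a] Suc a by auto
      have "vs ! t = vs ! a'"
        using edge_unique[OF vert la(1) vert at back_t vert ne] back_a al tl Suc by simp
      then show False using dist[of t a'] Suc \<open>a < t\<close> t by simp
    qed
  qed
qed

section \<open>Complementary solutions of the market\<close>

text \<open>In these terms the LCP is a market: \<open>q\<close> are the prices paid for doing bads
  and \<open>\<rho>\<close> is an agent's marginal earning rate per unit of disutility. A segment is
  worth filling while \<open>q x j / D i j k\<close> exceeds \<open>\<rho> x i\<close>, and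
  \<open>su\<close> is its excess.\<close>

abbreviation "q x j \<equiv> P - var x (Bad j)"
abbreviation "\<rho> x i \<equiv> R - var x (Agent i)"
abbreviation "fl x i j k \<equiv> var x (Flow i j k)"
abbreviation "su x i j k \<equiv> var x (Surplus i j k)"
abbreviation "earn x i \<equiv> \<Sum>j<m. \<Sum>k<pieces I i j. fl x i j k"
abbreviation "paid x j \<equiv> \<Sum>i<n. \<Sum>k<pieces I i j. fl x i j k"
abbreviation "due x i \<equiv> (\<Sum>j<m. W i j * q x j)"

lemma cval_market:
  "cval (Ineq (Agent i)) x = earn x i + zval x - due x i"
  "cval (Ineq (Bad j)) x = q x j - paid x j"
  "cval (Ineq (Flow i j k)) x = D i j k * \<rho> x i - q x j + su x i j k"
  "cval (Ineq (Surplus i j k)) x = L i j k * q x j - fl x i j k"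
  by (simp_all add: algebra_simps sum_subtractf sum_distrib_left sum_negf)

lemmas [simp del] = cval.simps(2)

lemma feas_market:
  assumes "x \<in> feas"
  shows "i < n \<Longrightarrow> due x i \<le> earn x i + zval x" "j < m \<Longrightarrow> paid x j \<le> q x j"
    "seg i j k \<Longrightarrow> q x j - D i j k * \<rho> x i \<le> su x i j k" "seg i j k \<Longrightarrow> fl x i j k \<le> L i j k * q x j"
    "0 \<le> var x l" "0 \<le> zval x"
proof -
  have c: "c \<in> cons \<Longrightarrow> 0 \<le> cval c x" for c using assms by (simp add: feas_iff)
  show "i < n \<Longrightarrow> due x i \<le> earn x i + zval x" using c[of "Ineq (Agent i)"] by (simp add: mem_cons cval_market)
  show "j < m \<Longrightarrow> paid x j \<le> q x j" using c[of "Ineq (Bad j)"] by (simp add: mem_cons cval_market)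
  show "seg i j k \<Longrightarrow> q x j - D i j k * \<rho> x i \<le> su x i j k"
    using c[of "Ineq (Flow i j k)"] by (simp add: mem_cons cval_market)
  show "seg i j k \<Longrightarrow> fl x i j k \<le> L i j k * q x j"
    using c[of "Ineq (Surplus i j k)"] by (simp add: mem_cons cval_market)
  show "0 \<le> var x l"
    using c[of "Nonneg l"] assms by (cases "l \<in> Lbl") (auto simp: mem_cons feas_iff supp_def)
  show "0 \<le> zval x" using assms by (simp add: feas_iff)
qed

lemma lcp_market:
  assumes "lcp x"
  shows "i < n \<Longrightarrow> var x (Agent i) \<noteq> 0 \<Longrightarrow> due x i = earn x i + zval x"
    "j < m \<Longrightarrow> var x (Bad j) \<noteq> 0 \<Longrightarrow> paid x j = q x j"
    "seg i j k \<Longrightarrow> fl x i j k \<noteq> 0 \<Longrightarrow> su x i j k = q x j - D i j k * \<rho> x i"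
    "seg i j k \<Longrightarrow> su x i j k \<noteq> 0 \<Longrightarrow> fl x i j k = L i j k * q x j"
proof -
  have c: "l \<in> Lbl \<Longrightarrow> var x l \<noteq> 0 \<Longrightarrow> cval (Ineq l) x = 0" for l
    using assms unfolding lcp_iff tight_iff by force
  show "i < n \<Longrightarrow> var x (Agent i) \<noteq> 0 \<Longrightarrow> due x i = earn x i + zval x"
    using c[of "Agent i"] by (simp add: cval_market)
  show "j < m \<Longrightarrow> var x (Bad j) \<noteq> 0 \<Longrightarrow> paid x j = q x j" using c[of "Bad j"] by (simp add: cval_market)
  show "seg i j k \<Longrightarrow> fl x i j k \<noteq> 0 \<Longrightarrow> su x i j k = q x j - D i j k * \<rho> x i"
    using c[of "Flow i j k"] by (simp add: cval_market)
  show "seg i j k \<Longrightarrow> su x i j k \<noteq> 0 \<Longrightarrow> fl x i j k = L i j k * q x j"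
    using c[of "Surplus i j k"] by (simp add: cval_market)
qed

lemma flow_le_q:
  assumes "x \<in> feas" "seg i j k"
  shows "fl x i j k \<le> q x j"
proof -
  note nn = feas_market(5)[OF assms(1)]
  have "fl x i j k \<le> (\<Sum>k<pieces I i j. fl x i j k)"
    using assms nn by (intro member_le_sum) auto
  also have "\<dots> \<le> paid x j"
    using assms nn by (intro member_le_sum[of i "{..<n}" "\<lambda>i. \<Sum>k<pieces I i j. fl x i j k"]) (auto intro: sum_nonneg)
  also have "\<dots> \<le> q x j" using assms feas_market(2) by blast
  finally show ?thesis .
qed

lemma q_nonneg: "x \<in> feas \<Longrightarrow> j < m \<Longrightarrow> 0 \<le> q x j"
  using flow_le_q[of x 0 j 0] feas_market(5)[of x "Flow 0 j 0"] n_pos pieces_pos[of 0 j] by force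

lemma q_le: "x \<in> feas \<Longrightarrow> q x j \<le> P"
  using feas_market(5)[of x "Bad j"] by simp

text \<open>
  An agent with a nonpositive \<open>\<rho>\<close> would saturate the last segment, which is longer than the supply.
\<close>

lemma rho_pos:
  assumes "lcp x" "j < m" "0 < q x j" "i < n"
  shows "0 < \<rho> x i"
proof (rule ccontr)
  assume *: "\<not> 0 < \<rho> x i"
  define k where "k = pieces I i j - 1"
  have k: "seg i j k" "Suc k = pieces I i j" using pieces_pos[of i j] assms by (auto simp: k_def)
  have "D i j k * \<rho> x i \<le> 0" using * D_pos[OF k(1)] by (simp add: mult_nonneg_nonpos)
  then have "0 < su x i j k"
    using feas_market(3)[OF lcp_feas[OF assms(1)] k(1)] assms(3) by linarith
  then have "fl x i j k = L i j k * q x j" using lcp_market(4)[OF assms(1) k(1)] by simp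
  also have "L i j k = 1 + \<epsilon>" using k by (simp add: len_def)
  finally show False
    using flow_le_q[OF lcp_feas[OF assms(1)] k(1)] eps_pos assms(3) by (simp add: mult_le_cancel_right1)
qed

section \<open>Positive prices along the path, and secondary rays\<close>

definition pos :: "point \<Rightarrow> bool" where
  "pos x \<longleftrightarrow> (\<forall>j<m. 0 < q x j)"

lemma pos_rho: "lcp x \<Longrightarrow> pos x \<Longrightarrow> i < n \<Longrightarrow> 0 < \<rho> x i"
  using rho_pos[of x 0 i] m_pos by (simp add: pos_def)

lemma tight_midpoint:
  assumes "x \<in> feas" "y \<in> feas"
  shows "tight' ((1 - 1/2) *\<^sub>R x + (1/2) *\<^sub>R y) = tight' x \<inter> tight' y"
    "(1 - 1/2) *\<^sub>R x + (1/2) *\<^sub>R y \<in> feas"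
proof -
  have nn: "c \<in> cons \<Longrightarrow> 0 \<le> cval c x \<and> 0 \<le> cval c y" for c using assms by (simp add: feas_iff)
  show "tight' ((1 - 1/2) *\<^sub>R x + (1/2) *\<^sub>R y) = tight' x \<inter> tight' y"
    unfolding set_eq_iff Int_iff tight_iff cval_convex using nn by (force simp: add_nonneg_eq_0_iff)
  show "(1 - 1/2) *\<^sub>R x + (1/2) *\<^sub>R y \<in> feas"
    unfolding feas_iff cval_convex using nn assms by (auto simp: feas_iff)
qed

text \<open>Suppose a price \<open>q w j\<close> reaches 0. The midpoint \<open>h\<close> of the
  edge is still a solution, and there bad \<open>j\<close> is fully paid for at a positive price, so
  some flow of it is positive. The corresponding flow inequality is tight at \<open>h\<close>, hence
  at \<open>w\<close>, and forces \<open>\<rho> w i \<le> 0\<close> for its agent. By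
  \<open>rho_pos\<close> all prices at \<open>w\<close> are then 0; the agent earns and owes
  nothing, while its budget is tight because \<open>\<rho>\<close> is nonpositive, so
  \<open>z\<close> is 0.\<close>

lemma pos_step:
  assumes "lcp v" "pos v" "lcp w" "0 < zval w"
    and l: "double v l" "label_of c = l" and sub: "tight' v - {c} \<subseteq> tight' w"
  shows "pos w"
proof (rule ccontr)
  assume "\<not> pos w"
  then obtain j where j: "j < m" "q w j = 0"
    using q_nonneg[OF lcp_feas[OF assms(3)]] unfolding pos_def by (metis less_le)
  define h where "h = (1 - 1/2) *\<^sub>R v + (1/2) *\<^sub>R w"
  have h: "tight' h = tight' v \<inter> tight' w" "h \<in> feas"
    using tight_midpoint assms by (auto simp: h_def lcp_feas)
  have "lcp h"
    unfolding lcp_iff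
  proof (intro conjI ballI h(2))
    fix l' assume l': "l' \<in> Lbl"
    show "Nonneg l' \<in> tight' h \<or> Ineq l' \<in> tight' h"
    proof (cases "l' = l")
      case True
      then show ?thesis using l sub h by (cases c) (auto simp: double_iff)
    next
      case False
      then have "c \<noteq> Nonneg l'" "c \<noteq> Ineq l'" using l by auto
      then show ?thesis using assms(1) l' sub h unfolding lcp_iff by blast
    qed
  qed
  have "0 < q h j" using assms(2) j by (simp add: h_def pos_def field_simps)
  moreover have "var h (Bad j) \<noteq> 0"
    using j P_pos feas_market(5)[OF lcp_feas[OF assms(1)], of "Bad j"] by (simp add: h_def)
  ultimately have "0 < paid h j" using lcp_market(2)[OF \<open>lcp h\<close> j(1)] by simp
  then obtain i k where ik: "i < n" "k < pieces I i j" "fl h i j k \<noteq> 0"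
    by (metis (mono_tags, lifting) less_irrefl lessThan_iff sum.neutral)
  then have seg: "seg i j k" using j by simp
  have "Nonneg (Flow i j k) \<notin> tight' h" using ik by (simp add: tight_iff)
  then have "Ineq (Flow i j k) \<in> tight' h" using \<open>lcp h\<close> seg unfolding lcp_iff by force
  then have "Ineq (Flow i j k) \<in> tight' w" using h by simp
  then have "D i j k * \<rho> w i + su w i j k = 0" by (simp add: tight_iff cval_market j)
  then have "D i j k * \<rho> w i \<le> 0"
    using feas_market(5)[OF lcp_feas[OF assms(3)], of "Surplus i j k"] by linarith
  then have rho: "\<rho> w i \<le> 0" using D_pos[OF seg] by (simp add: mult_le_0_iff)
  then have q0: "q w j' = 0" if "j' < m" for j'
    using rho_pos[OF assms(3) that _ ik(1)] q_nonneg[OF lcp_feas[OF assms(3)] that] by force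
  have "fl w i j' k' = 0" if "j' < m" "k' < pieces I i j'" for j' k'
    using flow_le_q[OF lcp_feas[OF assms(3)], of i j' k'] q0[of j'] that ik
      feas_market(5)[OF lcp_feas[OF assms(3)], of "Flow i j' k'"] by simp
  then have "earn w i = 0" by simp
  moreover have "due w i = 0" using q0 by simp
  moreover have "var w (Agent i) \<noteq> 0" using rho R_pos by simp
  ultimately show False using lcp_market(1)[OF assms(3) ik(1)] assms(4) by simp
qed

lemma pos_start: "pos start" using P_pos by (simp add: pos_def start_vertex_def)

lemma run_pos:
  assumes run: "is_run vs" and "t < length vs" "0 < zval (vs ! t)"
  shows "pos (vs ! t)"
  using assms(2,3)
proof (induction t)
  case 0
  then show ?case using run pos_start by (auto simp: lemke_run_def hd_conv_nth)
next
  case (Suc t)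
  obtain l where l: "0 < zval (vs ! t)" "double (vs ! t) l"
    "tight' (vs ! t) - {relax ((ray # vs) ! t) l} \<subseteq> tight' (vs ! Suc t)"
    using run_step[OF run Suc.prems(1)] by metis
  have "pos (vs ! t)" using Suc l by simp
  then show ?case
    using pos_step[OF vertex_lcp _ vertex_lcp Suc.prems(2) l(2) _ l(3)] run_vertex[OF run] Suc.prems
    by simp
qed

lemma bounded_slope:
  fixes a b c :: real
  assumes "\<And>t. 0 \<le> t \<Longrightarrow> a + t * b \<le> c"
  shows "b \<le> 0"
proof (rule ccontr)
  assume "\<not> b \<le> 0"
  then have b: "b > 0" by simp
  have "0 \<le> (\<bar>c - a\<bar> + 1) / b" using b by simp
  from assms[OF this] b show False by simp
qed

text \<open>All variables but \<open>z\<close> are bounded: \<open>p\<close> and \<open>r\<close>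
  since \<open>q\<close> and \<open>\<rho>\<close> stay positive, flows by prices, and a positive
  surplus because it forces a positive flow and therefore equals \<open>q - D * \<rho>\<close>. With
  nonnegative slopes, only \<open>z\<close> can move.\<close>

lemma no_secondary_ray:
  assumes ray: "\<And>t. 0 \<le> t \<Longrightarrow> lcp (v + t *\<^sub>R d)" and "pos v"
  shows "d = 0 \<or> fst v = 0 \<and> fst d = 0"
proof -
  note fs = lcp_feas[OF ray]
  have lcp_v: "lcp v" using ray[of 0] by simp
  have nn: "0 \<le> var d l" for l
  proof -
    have "- var d l \<le> 0"
    proof (rule bounded_slope)
      show "0 \<le> t \<Longrightarrow> - var v l + t * (- var d l) \<le> 0" for t
        using feas_market(5)[OF fs, of t l] by simp
    qed
    then show ?thesis by simp
  qed
  have p: "var d (Bad j) = 0" if "j < m" for j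
    using bounded_slope[of "var v (Bad j)" "var d (Bad j)" P] q_nonneg[OF fs that] nn[of "Bad j"] by force
  have pos: "pos (v + t *\<^sub>R d)" for t using assms(2) p by (auto simp: pos_def)
  have r: "var d (Agent i) = 0" if "i < n" for i
  proof -
    have "var v (Agent i) + t * var d (Agent i) \<le> R" if "0 \<le> t" for t
      using pos_rho[OF ray[OF that] pos \<open>i < n\<close>] by simp
    then show ?thesis using bounded_slope nn[of "Agent i"] by force
  qed
  have f: "fl d i j k = 0" if "seg i j k" for i j k
  proof -
    have "fl v i j k + t * fl d i j k \<le> P" if "0 \<le> t" for t
      using flow_le_q[OF fs[OF that] \<open>seg i j k\<close>] q_le[OF fs[OF that], of j] by simp
    then show ?thesis using bounded_slope nn[of "Flow i j k"] by force
  qed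
  have s: "su d i j k = 0" if seg: "seg i j k" for i j k
  proof -
    have "su v i j k + t * su d i j k \<le> P" if t: "0 \<le> t" for t
    proof (cases "su (v + t *\<^sub>R d) i j k = 0")
      case True
      then show ?thesis using P_pos by simp
    next
      case False
      let ?x = "v + t *\<^sub>R d"
      have "fl ?x i j k = L i j k * q ?x j" by (rule lcp_market(4)[OF ray[OF t] seg False])
      moreover have "L i j k * q ?x j > 0" using L_pos[OF seg] pos[of t] seg unfolding pos_def by simp
      ultimately have "fl ?x i j k \<noteq> 0" by linarith
      then have "su ?x i j k = q ?x j - D i j k * \<rho> ?x i"
        by (rule lcp_market(3)[OF ray[OF t] seg])
      moreover have "0 < D i j k * \<rho> ?x i" using D_pos[OF seg] pos_rho[OF ray[OF t] pos] seg by simp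
      ultimately have "su ?x i j k \<le> P" using q_le[OF fs[OF t], of j] by linarith
      then show ?thesis by simp
    qed
    then show ?thesis using bounded_slope nn[of "Surplus i j k"] by force
  qed
  have d0: "var d l = 0" for l
  proof (cases "l \<in> Lbl")
    case True
    then show ?thesis using p r f s by (cases l) auto
  next
    case False
    then show ?thesis using feas_supp[OF fs[of 1]] feas_supp[OF fs[of 0]] by (simp add: supp_def)
  qed
  then have fst_d: "fst d = 0" by (intro poly_mapping_eqI) simp
  show ?thesis
  proof (cases "zval d = 0")
    case True
    then show ?thesis using fst_d by (simp add: prod_eq_iff)
  next
    case False
    note fv = lcp_feas[OF lcp_v]
    \<comment> \<open>If \<open>z\<close> changes, a budget cannot be tight at two points of the
      ray, so \<open>r\<close> vanishes. Then \<open>D * R > P\<close> excludes every flow, without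
      flows no positive price is paid, so \<open>p\<close> vanishes, and so does the
      surplus.\<close>
    have r0: "var v (Agent i) = 0" if "i < n" for i
    proof (rule ccontr)
      assume "var v (Agent i) \<noteq> 0"
      then have "due v i = earn v i + zval v"
        "due (v + 1 *\<^sub>R d) i = earn (v + 1 *\<^sub>R d) i + zval (v + 1 *\<^sub>R d)"
        using lcp_market(1)[OF lcp_v that] lcp_market(1)[OF ray[of 1] that] d0 by auto
      with False show False by (simp add: d0)
    qed
    have f0: "fl v i j k = 0" if seg: "seg i j k" for i j k
    proof (rule ccontr)
      assume "fl v i j k \<noteq> 0"
      then have "su v i j k = q v j - D i j k * \<rho> v i" by (rule lcp_market(3)[OF lcp_v seg])
      then show False
        using r0[of i] DR[OF seg] seg q_le[OF fv, of j] feas_market(5)[OF fv, of "Surplus i j k"] by simp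
    qed
    have p0: "var v (Bad j) = 0" if "j < m" for j
    proof (rule ccontr)
      assume "var v (Bad j) \<noteq> 0"
      then have "paid v j = q v j" by (rule lcp_market(2)[OF lcp_v that])
      moreover have "paid v j = 0" using f0 that by simp
      moreover have "0 < q v j" using assms(2) that unfolding pos_def by blast
      ultimately show False by linarith
    qed
    have s0: "su v i j k = 0" if seg: "seg i j k" for i j k
    proof (rule ccontr)
      assume "su v i j k \<noteq> 0"
      then have "fl v i j k = L i j k * q v j" by (rule lcp_market(4)[OF lcp_v seg])
      moreover have "0 < L i j k * q v j" using L_pos[OF seg] assms(2) seg unfolding pos_def by simp
      ultimately show False using f0[OF seg] by linarith
    qed
    have "var v l = 0" for l
    proof (cases "l \<in> Lbl")
      case True
      then show ?thesis using p0 r0 f0 s0 by (cases l) auto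
    next
      case False
      then show ?thesis using feas_supp[OF fv] by (simp add: supp_def)
    qed
    then have "fst v = 0" by (intro poly_mapping_eqI) simp
    then show ?thesis using fst_d by simp
  qed
qed

end

section \<open>Counting the vertices\<close>

text \<open>
  Items of sizes \<open>w\<close> are filled in decreasing order of their keys \<open>\<kappa>\<close> until the amount \<open>a\<close> is reached. Where this
  stops only depends on the order of the keys and on the comparison of \<open>a\<close> with sums over upper sets.
\<close>

lemma threshold_subset:
  fixes \<kappa> \<kappa>' w w' :: "'e \<Rightarrow> real" and a a' t t' :: real
  assumes fin: "finite S"
    and w: "\<And>x. x \<in> S \<Longrightarrow> 0 < w x" "\<And>x. x \<in> S \<Longrightarrow> 0 < w' x"
    and ord: "\<And>x y. x \<in> S \<Longrightarrow> y \<in> S \<Longrightarrow> \<kappa> x < \<kappa> y \<longleftrightarrow> \<kappa>' x < \<kappa>' y"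
    and sgn: "\<And>U. U \<in> {{x \<in> S. t < \<kappa> x}, {x \<in> S. t' \<le> \<kappa>' x}} \<Longrightarrow> sgn (a - sum w U) = sgn (a' - sum w' U)"
    and cond: "sum w {x \<in> S. t < \<kappa> x} \<le> a" "a \<le> sum w {x \<in> S. t \<le> \<kappa> x}"
      "\<And>x. x \<in> S \<Longrightarrow> \<kappa> x = t \<Longrightarrow> sum w {x \<in> S. t < \<kappa> x} < a \<and> a < sum w {x \<in> S. t \<le> \<kappa> x}"
    and cond': "sum w' {x \<in> S. t' < \<kappa>' x} \<le> a'" "a' \<le> sum w' {x \<in> S. t' \<le> \<kappa>' x}"
      "\<And>x. x \<in> S \<Longrightarrow> \<kappa>' x = t' \<Longrightarrow> sum w' {x \<in> S. t' < \<kappa>' x} < a' \<and> a' < sum w' {x \<in> S. t' \<le> \<kappa>' x}"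
  shows "{x \<in> S. t < \<kappa> x} \<subseteq> {x \<in> S. t' < \<kappa>' x} \<and> {x \<in> S. t \<le> \<kappa> x} \<subseteq> {x \<in> S. t' \<le> \<kappa>' x}"
proof -
  let ?C = "{x \<in> S. t < \<kappa> x}" and ?G = "{x \<in> S. t \<le> \<kappa> x}"
  let ?C' = "{x \<in> S. t' < \<kappa>' x}" and ?G' = "{x \<in> S. t' \<le> \<kappa>' x}"
  have mono: "sum u A < sum u B" if u: "\<And>x. x \<in> S \<Longrightarrow> 0 < u x" and AB: "A \<subset> B" "B \<subseteq> S" for u :: "'e \<Rightarrow> real" and A B
  proof -
    obtain b where b: "b \<in> B" "b \<notin> A" using AB by blast
    have "finite B" using AB fin finite_subset by blast
    then show ?thesis
    proof (rule sum_strict_mono2)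
      show "0 \<le> u x" if "x \<in> B" for x using u[of x] that AB by auto
    qed (use u AB b in auto)
  qed
  have mono_le: "sum u A \<le> sum u B" if "\<And>x. x \<in> S \<Longrightarrow> 0 < u x" "A \<subseteq> B" "B \<subseteq> S" for u :: "'e \<Rightarrow> real" and A B
    using mono[of u A B] that by (cases "A = B") (auto intro: less_imp_le)
  have sC: "sgn (a - sum w ?C) = sgn (a' - sum w' ?C)" and sG': "sgn (a - sum w ?G') = sgn (a' - sum w' ?G')"
    using sgn by auto
  have 1: "?C \<subseteq> ?C'"
  proof
    fix x assume x: "x \<in> ?C"
    show "x \<in> ?C'"
    proof (rule ccontr)
      assume "x \<notin> ?C'"
      then have le: "\<kappa>' x \<le> t'" using x by auto
      \<comment> \<open>This nesting squeezes \<open>a'\<close> between two equal sums over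
        \<open>?G'\<close> and \<open>?C\<close>. Positive weights make the sets equal, so
        \<open>x\<close> sits exactly at level \<open>t'\<close>, where \<open>a'\<close> must be
        strictly below the sum. The second inclusion runs the same squeeze with
        \<open>w\<close>.\<close>
      have sub: "?G' \<subseteq> ?C"
      proof
        fix y assume "y \<in> ?G'"
        then have "y \<in> S" "\<not> \<kappa>' y < \<kappa>' x" using le by auto
        then show "y \<in> ?C" using ord[of y x] x by auto
      qed
      have "0 \<le> a' - sum w' ?C" using sC cond(1) by (auto simp: sgn_if split: if_splits)
      moreover have "sum w' ?G' \<le> sum w' ?C" using mono_le[OF w(2) sub] by auto
      ultimately have eq: "a' = sum w' ?G'" "sum w' ?G' = sum w' ?C" using cond'(2) by linarith+
      have "\<not> ?G' \<subset> ?C" using mono[OF w(2), of "\<lambda>x. x" ?G' ?C] eq(2) by auto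
      with sub have "?G' = ?C" by blast
      with x have "t' \<le> \<kappa>' x" by blast
      with le have "\<kappa>' x = t'" by simp
      then show False using cond'(3)[of x] x eq(1) by auto
    qed
  qed
  have 2: "?G \<subseteq> ?G'"
  proof
    fix x assume x: "x \<in> ?G"
    show "x \<in> ?G'"
    proof (rule ccontr)
      assume "x \<notin> ?G'"
      then have lt: "\<kappa>' x < t'" using x by auto
      have sub: "?G' \<subseteq> ?C"
      proof
        fix y assume "y \<in> ?G'"
        then have "y \<in> S" "\<kappa>' x < \<kappa>' y" using lt by auto
        then show "y \<in> ?C" using ord[of x y] x by auto
      qed
      have "a - sum w ?G' \<le> 0" using sG' cond'(2) by (auto simp: sgn_if split: if_splits)
      moreover have "sum w ?G' \<le> sum w ?C" using mono_le[OF w(1) sub] by auto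
      ultimately have eq: "a = sum w ?C" "sum w ?G' = sum w ?C" using cond(1) by linarith+
      have "\<not> ?G' \<subset> ?C" using mono[OF w(1), of "\<lambda>x. x" ?G' ?C] eq(2) by auto
      with sub have eqC: "?G' = ?C" by blast
      have "\<kappa> x \<noteq> t" using cond(3)[of x] eq(1) x by auto
      then have "x \<in> ?C" using x by auto
      then have "x \<in> ?G'" by (simp only: eqC)
      with lt show False by simp
    qed
  qed
  from 1 2 show ?thesis by blast
qed

lemma threshold_unique:
  fixes \<kappa> \<kappa>' w w' :: "'e \<Rightarrow> real" and a a' t t' :: real
  assumes fin: "finite S"
    and w: "\<And>x. x \<in> S \<Longrightarrow> 0 < w x" "\<And>x. x \<in> S \<Longrightarrow> 0 < w' x"
    and ord: "\<And>x y. x \<in> S \<Longrightarrow> y \<in> S \<Longrightarrow> \<kappa> x < \<kappa> y \<longleftrightarrow> \<kappa>' x < \<kappa>' y"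
    and sgn: "\<And>U. U \<in> {{x \<in> S. t < \<kappa> x}, {x \<in> S. t' < \<kappa>' x}, {x \<in> S. t \<le> \<kappa> x}, {x \<in> S. t' \<le> \<kappa>' x}} \<Longrightarrow>
        sgn (a - sum w U) = sgn (a' - sum w' U)"
    and cond: "sum w {x \<in> S. t < \<kappa> x} \<le> a" "a \<le> sum w {x \<in> S. t \<le> \<kappa> x}"
      "\<And>x. x \<in> S \<Longrightarrow> \<kappa> x = t \<Longrightarrow> sum w {x \<in> S. t < \<kappa> x} < a \<and> a < sum w {x \<in> S. t \<le> \<kappa> x}"
    and cond': "sum w' {x \<in> S. t' < \<kappa>' x} \<le> a'" "a' \<le> sum w' {x \<in> S. t' \<le> \<kappa>' x}"
      "\<And>x. x \<in> S \<Longrightarrow> \<kappa>' x = t' \<Longrightarrow> sum w' {x \<in> S. t' < \<kappa>' x} < a' \<and> a' < sum w' {x \<in> S. t' \<le> \<kappa>' x}"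
    and x: "x \<in> S"
  shows "sgn (\<kappa> x - t) = sgn (\<kappa>' x - t')"
proof -
  have "{x \<in> S. t < \<kappa> x} \<subseteq> {x \<in> S. t' < \<kappa>' x} \<and> {x \<in> S. t \<le> \<kappa> x} \<subseteq> {x \<in> S. t' \<le> \<kappa>' x}"
    by (rule threshold_subset[OF fin w ord _ cond cond']) (use sgn in auto)
  moreover have "{x \<in> S. t' < \<kappa>' x} \<subseteq> {x \<in> S. t < \<kappa> x} \<and> {x \<in> S. t' \<le> \<kappa>' x} \<subseteq> {x \<in> S. t \<le> \<kappa> x}"
    by (rule threshold_subset[OF fin w(2,1) ord[symmetric] _ cond' cond]) (use sgn in \<open>auto simp: eq_commute\<close>)
  ultimately have "t < \<kappa> x \<longleftrightarrow> t' < \<kappa>' x" "t \<le> \<kappa> x \<longleftrightarrow> t' \<le> \<kappa>' x" using x by blast+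
  then show ?thesis by (auto simp: sgn_if)
qed

lemma down_closed_nat:
  fixes A :: "nat set"
  assumes "finite A" "\<And>k k'. k \<in> A \<Longrightarrow> k' < k \<Longrightarrow> k' \<in> A"
  shows "A = {..<card A}"
proof (cases "A = {}")
  case False
  then have "Max A \<in> A" using assms(1) by simp
  then have "A = {..Max A}"
    using assms(2) Max_ge[OF assms(1)] by (fastforce simp: le_less)
  then show ?thesis by (metis card_atMost lessThan_Suc_atMost)
qed simp

lemma sgn_eq_cmp:
  fixes a b :: real
  assumes "sgn a = sgn b"
  shows "a < 0 \<longleftrightarrow> b < 0" "0 < a \<longleftrightarrow> 0 < b" "a = 0 \<longleftrightarrow> b = 0"
  using assms by (auto simp: sgn_if split: if_splits)

context bads_lcp
begin

section \<open>Vertices determined by signs\<close>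

abbreviation "side x i j k \<equiv> sgn (q x j - D i j k * \<rho> x i)"

text \<open>At positive prices a positive surplus forces the full flow, which is positive, and a
  positive flow makes the flow inequality tight. So the sign decides between empty, full and
  marginal segments.\<close>

lemma side_facts:
  assumes "lcp x" "pos x" and seg: "seg i j k"
  shows "su x i j k = max 0 (q x j - D i j k * \<rho> x i)"
    "q x j < D i j k * \<rho> x i \<Longrightarrow> fl x i j k = 0"
    "D i j k * \<rho> x i < q x j \<Longrightarrow> fl x i j k = L i j k * q x j"
proof -
  have Lq: "0 < L i j k * q x j" using L_pos[OF seg] assms(2) seg unfolding pos_def by simp
  note f = feas_market[OF lcp_feas[OF assms(1)]] and l = lcp_market[OF assms(1)]
  have A: "su x i j k \<noteq> 0 \<Longrightarrow> su x i j k = q x j - D i j k * \<rho> x i"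
    using l(3,4)[OF seg] Lq by linarith
  show "su x i j k = max 0 (q x j - D i j k * \<rho> x i)"
    using A f(3)[OF seg] f(5)[of "Surplus i j k"] by (cases "su x i j k = 0") (auto simp: max_def)
  then show "q x j < D i j k * \<rho> x i \<Longrightarrow> fl x i j k = 0"
    "D i j k * \<rho> x i < q x j \<Longrightarrow> fl x i j k = L i j k * q x j"
    using l(3,4)[OF seg] by (auto simp: max_def split: if_splits)
qed

text \<open>For every label but the double one, exactly one of the two constraints is tight. It
  suffices to know one of them, and that is visible from the signs or from a vanishing
  variable.\<close>

lemma tight_market:
  assumes x: "lcp x" "pos x" and l: "\<And>l'. double x l' \<longleftrightarrow> l' = l"
  shows "i < n \<Longrightarrow> Nonneg (Agent i) \<in> tight' x \<longleftrightarrow> var x (Agent i) = 0"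
    "i < n \<Longrightarrow> Ineq (Agent i) \<in> tight' x \<longleftrightarrow> var x (Agent i) \<noteq> 0 \<or> l = Agent i"
    "j < m \<Longrightarrow> Nonneg (Bad j) \<in> tight' x \<longleftrightarrow> var x (Bad j) = 0"
    "j < m \<Longrightarrow> Ineq (Bad j) \<in> tight' x \<longleftrightarrow> var x (Bad j) \<noteq> 0 \<or> l = Bad j"
    "seg i j k \<Longrightarrow> Ineq (Flow i j k) \<in> tight' x \<longleftrightarrow> 0 \<le> side x i j k"
    "seg i j k \<Longrightarrow> Nonneg (Flow i j k) \<in> tight' x \<longleftrightarrow> side x i j k < 0 \<or> l = Flow i j k"
    "seg i j k \<Longrightarrow> Nonneg (Surplus i j k) \<in> tight' x \<longleftrightarrow> side x i j k \<le> 0"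
    "seg i j k \<Longrightarrow> Ineq (Surplus i j k) \<in> tight' x \<longleftrightarrow> side x i j k > 0 \<or> l = Surplus i j k"
proof -
  have one: "Nonneg l' \<in> tight' x \<or> Ineq l' \<in> tight' x" if "l' \<in> Lbl" for l'
    using x(1) that by (simp add: lcp_iff)
  have both: "Nonneg l' \<in> tight' x \<and> Ineq l' \<in> tight' x \<longleftrightarrow> l' = l" for l'
    using l by (simp add: double_iff)
  show a: "i < n \<Longrightarrow> Nonneg (Agent i) \<in> tight' x \<longleftrightarrow> var x (Agent i) = 0"
    by (simp add: tight_iff mem_cons)
  show b: "j < m \<Longrightarrow> Nonneg (Bad j) \<in> tight' x \<longleftrightarrow> var x (Bad j) = 0"
    by (simp add: tight_iff mem_cons)
  show "i < n \<Longrightarrow> Ineq (Agent i) \<in> tight' x \<longleftrightarrow> var x (Agent i) \<noteq> 0 \<or> l = Agent i"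
    using one[of "Agent i"] both[of "Agent i"] a by auto
  show "j < m \<Longrightarrow> Ineq (Bad j) \<in> tight' x \<longleftrightarrow> var x (Bad j) \<noteq> 0 \<or> l = Bad j"
    using one[of "Bad j"] both[of "Bad j"] b by auto
  assume seg: "seg i j k"
  show c: "Ineq (Flow i j k) \<in> tight' x \<longleftrightarrow> 0 \<le> side x i j k"
    using seg side_facts(1)[OF x seg] by (auto simp: tight_iff mem_cons cval_market)
  show d: "Nonneg (Surplus i j k) \<in> tight' x \<longleftrightarrow> side x i j k \<le> 0"
    using seg side_facts(1)[OF x seg] by (auto simp: tight_iff mem_cons)
  show "Nonneg (Flow i j k) \<in> tight' x \<longleftrightarrow> side x i j k < 0 \<or> l = Flow i j k"
    using one[of "Flow i j k"] both[of "Flow i j k"] seg c by auto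
  show "Ineq (Surplus i j k) \<in> tight' x \<longleftrightarrow> side x i j k > 0 \<or> l = Surplus i j k"
    using one[of "Surplus i j k"] both[of "Surplus i j k"] seg d by auto
qed

definition good :: "point \<Rightarrow> label \<Rightarrow> bool" where
  "good x l \<longleftrightarrow> generic x \<and> pos x \<and> double x l"

lemma goodD:
  assumes "good x l"
  shows "lcp x" "pos x" "vertex x" "0 < zval x" "x \<in> feas" "l \<in> Lbl" "double x l' \<longleftrightarrow> l' = l"
  using assms by (auto simp: good_def generic_def vertex_lcp vertex_feas double_label_def)

lemmas good_tight = tight_market[OF goodD(1,2,7)]

lemma vertex_determined:
  assumes x: "good x l" and y: "good y l"
    and side: "\<And>i j k. seg i j k \<Longrightarrow> side x i j k = side y i j k"
    and r: "\<And>i. i < n \<Longrightarrow> var x (Agent i) = 0 \<longleftrightarrow> var y (Agent i) = 0"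
    and p: "\<And>j. j < m \<Longrightarrow> var x (Bad j) = 0 \<longleftrightarrow> var y (Bad j) = 0"
  shows "x = y"
proof -
  have "c \<in> tight' x \<longleftrightarrow> c \<in> tight' y" if "c \<in> cons" for c
  proof -
    obtain l' where "c = Nonneg l' \<or> c = Ineq l'" by (cases c) auto
    with that show ?thesis
      using good_tight[OF x x x] good_tight[OF y y y] side r p
      by (cases l') (auto simp: mem_cons simp del: sgn_less sgn_greater sgn_le_0_iff zero_le_sgn_iff)
  qed
  then have "tight' y \<subseteq> tight' x" by (auto simp: tight_iff)
  then show ?thesis
    using vertex_eq[OF vertex_extreme[OF goodD(3)[OF y]] goodD(4)[OF y] feas_supp[OF goodD(5)[OF x]]]
    by simp
qed

text \<open>A tight flow inequality excludes a negative sign and a vanishing surplus excludes a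
  positive one; the second tight constraint, flow 0 or full flow, excludes the opposite
  sign.\<close>

lemma double_side:
  assumes "good x l" "seg i j k" "l = Flow i j k \<or> l = Surplus i j k"
  shows "q x j = D i j k * \<rho> x i"
proof -
  note g = good_tight[OF assms(1) assms(1) assms(1)]
  have "Nonneg l \<in> tight' x" "Ineq l \<in> tight' x"
    using goodD(7)[OF assms(1), of l] by (auto simp: double_iff)
  then have "side x i j k = 0 "
    using assms(3) g(5)[OF assms(2)] g(7)[OF assms(2)] side_facts(2,3)[OF goodD(1,2)[OF assms(1)] assms(2)] 
      L_pos[OF assms(2)] goodD(2)[OF assms(1)] assms(2)
    by (auto simp: tight_iff cval_market pos_def sgn_if split: if_splits)
  then show ?thesis by (simp add: sgn_0_0)
qed

text \<open>Supplies the strict inequalities that \<open>threshold_unique\<close> demands of items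
  exactly at the threshold.\<close>

lemma flow_strict:
  assumes "good x l" "seg i j k" "q x j = D i j k * \<rho> x i" "l \<noteq> Flow i j k" "l \<noteq> Surplus i j k"
  shows "0 < fl x i j k" "fl x i j k < L i j k * q x j"
proof -
  note g = good_tight[OF assms(1) assms(1) assms(1)]
  note f = feas_market[OF goodD(5)[OF assms(1)]]
  have "Nonneg (Flow i j k) \<notin> tight' x" "Ineq (Surplus i j k) \<notin> tight' x"
    using g(6)[OF assms(2)] g(8)[OF assms(2)] assms by auto
  then show "0 < fl x i j k" "fl x i j k < L i j k * q x j"
    using f(5)[of "Flow i j k"] f(4)[OF assms(2)] assms(2) by (auto simp: tight_iff mem_cons cval_market)
qed

text \<open>The full items lie above the threshold and the empty ones below, so the total flow is
  caught between the two upper sets; a strictly partial item at the threshold separates it from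
  both.\<close>

lemma fill_bounds:
  fixes w fl \<kappa> :: "'e \<Rightarrow> real"
  assumes "finite S" "\<And>x. x \<in> S \<Longrightarrow> 0 \<le> fl x \<and> fl x \<le> w x"
    "\<And>x. x \<in> S \<Longrightarrow> t < \<kappa> x \<Longrightarrow> fl x = w x" "\<And>x. x \<in> S \<Longrightarrow> \<kappa> x < t \<Longrightarrow> fl x = 0"
  shows "sum w {x \<in> S. t < \<kappa> x} \<le> sum fl S" "sum fl S \<le> sum w {x \<in> S. t \<le> \<kappa> x}"
    "x \<in> S \<Longrightarrow> \<kappa> x = t \<Longrightarrow> 0 < fl x \<Longrightarrow> fl x < w x \<Longrightarrow>
      sum w {x \<in> S. t < \<kappa> x} < sum fl S \<and> sum fl S < sum w {x \<in> S. t \<le> \<kappa> x}"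
proof -
  have C: "sum w {x \<in> S. t < \<kappa> x} = sum fl {x \<in> S. t < \<kappa> x}"
    using assms(3) by (intro sum.cong) auto
  have G: "sum fl S = sum fl {x \<in> S. t \<le> \<kappa> x}"
    using assms(1) by (intro sum.mono_neutral_right) (auto simp: not_le intro: assms(4))
  show "sum w {x \<in> S. t < \<kappa> x} \<le> sum fl S"
    unfolding C using assms(1,2) by (intro sum_mono2) auto
  show "sum fl S \<le> sum w {x \<in> S. t \<le> \<kappa> x}"
    unfolding G using assms(2) by (intro sum_mono) auto
  assume x: "x \<in> S" "\<kappa> x = t" "0 < fl x" "fl x < w x"
  have "sum w {x \<in> S. t < \<kappa> x} < sum fl S"
    unfolding C using assms(1,2) x by (intro sum_strict_mono2[of S _ x]) auto
  moreover have "sum fl S < sum w {x \<in> S. t \<le> \<kappa> x}"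
    unfolding G using assms(1,2) x by (intro sum_strict_mono_ex1) auto
  ultimately show "sum w {x \<in> S. t < \<kappa> x} < sum fl S \<and> sum fl S < sum w {x \<in> S. t \<le> \<kappa> x}" by simp
qed

text \<open>If \<open>r\<close> is 0, then \<open>D * R > P \<ge> q\<close> makes every segment too
  painful, so the agent earns nothing; its budget inequality is slack unless it is the double
  label.\<close>

lemma agent_due:
  assumes "good x l" "i < n" "l \<noteq> Agent i"
  shows "var x (Agent i) = 0 \<longleftrightarrow> due x i - zval x < 0"
    "var x (Agent i) \<noteq> 0 \<Longrightarrow> due x i - zval x = earn x i"
proof -
  note g = good_tight[OF assms(1) assms(1) assms(1)]
  note f = feas_market[OF goodD(5)[OF assms(1)]]
  have earn: "0 \<le> earn x i" using f(5) by (intro sum_nonneg) auto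
  show 1: "var x (Agent i) \<noteq> 0 \<Longrightarrow> due x i - zval x = earn x i"
    using lcp_market(1)[OF goodD(1)[OF assms(1)] assms(2)] by simp
  show "var x (Agent i) = 0 \<longleftrightarrow> due x i - zval x < 0"
  proof
    assume r: "var x (Agent i) = 0"
    have "fl x i j k = 0" if "j < m" "k < pieces I i j" for j k
    proof -
      have seg: "seg i j k" using that assms(2) by simp
      have "q x j < D i j k * \<rho> x i" using DR[OF seg] q_le[OF goodD(5)[OF assms(1)], of j] r by simp
      then show ?thesis by (rule side_facts(2)[OF goodD(1,2)[OF assms(1)] seg])
    qed
    then have "earn x i = 0" by simp
    moreover have "Ineq (Agent i) \<notin> tight' x" using g(2)[OF assms(2)] r assms(3) by simp
    then have "cval (Ineq (Agent i)) x \<noteq> 0" using assms(2) by (simp add: tight_iff mem_cons)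
    ultimately show "due x i - zval x < 0" using f(1)[OF assms(2)] by (simp add: cval_market)
  next
    assume "due x i - zval x < 0"
    then show "var x (Agent i) = 0" using 1 earn by linarith
  qed
qed

abbreviation "K \<equiv> input_size I"

lemma pieces_le: "i < n \<Longrightarrow> j < m \<Longrightarrow> pieces I i j \<le> K"
proof -
  assume ij: "i < n" "j < m"
  have "pieces I i j \<le> (\<Sum>j<m. pieces I i j)" using ij by (intro member_le_sum) auto
  also have "\<dots> \<le> (\<Sum>i<n. \<Sum>j<m. pieces I i j)"
    using ij by (intro member_le_sum[of i "{..<n}" "\<lambda>i. \<Sum>j<m. pieces I i j"]) auto
  finally show ?thesis by (simp add: input_size_def)
qed

text \<open>If \<open>r\<close> vanishes, all signs are negative. If the double label is a segment
  of agent \<open>i\<close>, it expresses \<open>\<rho>\<close> by a price, and the signs become key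
  comparisons. Otherwise the agent fills segments of size \<open>L i j k * q x j\<close> by
  decreasing key \<open>q x j / D i j k\<close> up to the amount \<open>due x i - zval x\<close>,
  and the threshold argument applies.\<close>

lemma agent_side:
  assumes x: "good x l" and y: "good y l" and i: "i < n"
    and ord: "\<And>j k j' k'. seg i j k \<Longrightarrow> seg i j' k' \<Longrightarrow>
      sgn (q x j * D i j' k' - q x j' * D i j k) = sgn (q y j * D i j' k' - q y j' * D i j k)"
    and pre: "\<And>c. c \<in> {..<m} \<rightarrow>\<^sub>E {..K} \<Longrightarrow>
      sgn (due x i - zval x - (\<Sum>j<m. \<Sum>k<c j. L i j k * q x j)) =
      sgn (due y i - zval y - (\<Sum>j<m. \<Sum>k<c j. L i j k * q y j))"
  shows "var x (Agent i) = 0 \<longleftrightarrow> var y (Agent i) = 0" "seg i j k \<Longrightarrow> side x i j k = side y i j k"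
proof -
  show r: "var x (Agent i) = 0 \<longleftrightarrow> var y (Agent i) = 0"
  proof (cases "l = Agent i")
    case True
    then have "Nonneg (Agent i) \<in> tight' x" "Nonneg (Agent i) \<in> tight' y"
      using goodD(7)[OF x] goodD(7)[OF y] unfolding double_iff by blast+
    then show ?thesis by (simp add: tight_iff)
  next
    case False
    have "sgn (due x i - zval x) = sgn (due y i - zval y)"
      using pre[of "restrict (\<lambda>_. 0) {..<m}"] by simp
    then have "due x i - zval x < 0 \<longleftrightarrow> due y i - zval y < 0" by (rule sgn_eq_cmp)
    then show ?thesis using agent_due(1)[OF x i False] agent_due(1)[OF y i False] by blast
  qed
  assume seg: "seg i j k"
  \<comment> \<open>Substituting the equation of the marginal segment turns the cross-multiplied key
    comparison into a positive multiple of the wanted sign.\<close>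
  have ord_side: "side x i j k = side y i j k"
    if "seg i j' k'" "q x j' = D i j' k' * \<rho> x i" "q y j' = D i j' k' * \<rho> y i" for j' k'
  proof -
    have D': "0 < D i j' k'" using D_pos[OF that(1)] .
    have "sgn (q z j * D i j' k' - q z j' * D i j k) = side z i j k"
      if z: "q z j' = D i j' k' * \<rho> z i" for z :: point
    proof -
      have "q z j * D i j' k' - q z j' * D i j k = D i j' k' * (q z j - D i j k * \<rho> z i)"
        unfolding z by (simp add: algebra_simps)
      then show ?thesis using D' by (simp add: sgn_mult)
    qed
    then show ?thesis using ord[OF seg that(1)] that(2,3) by metis
  qed
  show "side x i j k = side y i j k"
  proof (cases "var x (Agent i) = 0")
    case True
    then show ?thesis
      using r DR[OF seg] q_le[OF goodD(5)[OF x], of j] q_le[OF goodD(5)[OF y], of j] by simp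
  next
    case False
    show ?thesis
    proof (cases "\<exists>j' k'. seg i j' k' \<and> (l = Flow i j' k' \<or> l = Surplus i j' k')")
      case True
      then obtain j' k' where "seg i j' k'" "l = Flow i j' k' \<or> l = Surplus i j' k'" by blast
      then show ?thesis using ord_side double_side[OF x] double_side[OF y] by blast
    next
      case no: False
      have nl: "l \<noteq> Agent i"
      proof
        assume "l = Agent i"
        then have "Nonneg (Agent i) \<in> tight' x" using goodD(7)[OF x, of l] unfolding double_iff by blast
        with False show False by (simp add: tight_iff)
      qed
      define S where "S = Sigma {..<m} (\<lambda>j. {..<pieces I i j})"
      define \<kappa> where "\<kappa> z = (\<lambda>(j, k). q z j / D i j k)" for z
      define w where "w z = (\<lambda>(j, k). L i j k * q z j)" for z
      define fl' where "fl' z = (\<lambda>(j, k). fl z i j k)" for z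
      have S: "finite S" by (simp add: S_def)
      have segS: "seg i (fst e) (snd e)" if "e \<in> S" for e using that i by (auto simp: S_def)
      have key: "sgn (\<kappa> z e - \<rho> z i) = side z i (fst e) (snd e)" if "e \<in> S" for z e
      proof -
        have "\<kappa> z e - \<rho> z i = (q z (fst e) - D i (fst e) (snd e) * \<rho> z i) / D i (fst e) (snd e)"
          using D_pos[OF segS[OF that]] by (simp add: \<kappa>_def case_prod_beta field_simps)
        then show ?thesis using D_pos[OF segS[OF that]] by (simp add: sgn_divide)
      qed
      have w_pos: "0 < w z e" if "good z l" "e \<in> S" for z e
        using L_pos[OF segS[OF that(2)]] goodD(2)[OF that(1)] segS[OF that(2)]
        by (simp add: w_def pos_def case_prod_beta)
      have fb: "sum (w z) {e \<in> S. \<rho> z i < \<kappa> z e} \<le> due z i - zval z"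
        "due z i - zval z \<le> sum (w z) {e \<in> S. \<rho> z i \<le> \<kappa> z e}"
        "e \<in> S \<Longrightarrow> \<kappa> z e = \<rho> z i \<Longrightarrow> sum (w z) {e \<in> S. \<rho> z i < \<kappa> z e} < due z i - zval z \<and>
           due z i - zval z < sum (w z) {e \<in> S. \<rho> z i \<le> \<kappa> z e}"
        if z: "good z l" "var z (Agent i) \<noteq> 0" for z e
      proof -
        have eq: "due z i - zval z = sum (fl' z) S"
          unfolding agent_due(2)[OF z(1) i nl z(2)] S_def fl'_def by (simp add: sum.Sigma)
        have 1: "0 \<le> fl' z e \<and> fl' z e \<le> w z e" if "e \<in> S" for e
          using feas_market(4)[OF goodD(5)[OF z(1)] segS[OF that]] feas_market(5)[OF goodD(5)[OF z(1)]]
          by (simp add: fl'_def w_def case_prod_beta)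
        have 2: "fl' z e = w z e" if "e \<in> S" "\<rho> z i < \<kappa> z e" for e
        proof -
          have "sgn (\<kappa> z e - \<rho> z i) = 1" using that by simp
          then have "D i (fst e) (snd e) * \<rho> z i < q z (fst e)"
            unfolding key[OF that(1)] by (simp add: sgn_1_pos)
          then show ?thesis using side_facts(3)[OF goodD(1,2)[OF z(1)] segS[OF that(1)]]
            by (simp add: fl'_def w_def case_prod_beta)
        qed
        have 3: "fl' z e = 0" if "e \<in> S" "\<kappa> z e < \<rho> z i" for e
        proof -
          have "sgn (\<kappa> z e - \<rho> z i) = -1" using that by simp
          then have "D i (fst e) (snd e) * \<rho> z i > q z (fst e)"
            unfolding key[OF that(1)] by (simp add: sgn_1_neg)
          then show ?thesis using side_facts(2)[OF goodD(1,2)[OF z(1)] segS[OF that(1)]]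
            by (simp add: fl'_def case_prod_beta)
        qed
        note fb = fill_bounds[OF S 1 2 3]
        show "sum (w z) {e \<in> S. \<rho> z i < \<kappa> z e} \<le> due z i - zval z"
          "due z i - zval z \<le> sum (w z) {e \<in> S. \<rho> z i \<le> \<kappa> z e}"
          unfolding eq by (rule fb(1), assumption+, rule fb(2))
        assume e: "e \<in> S" "\<kappa> z e = \<rho> z i"
        have "sgn (\<kappa> z e - \<rho> z i) = 0" using e by simp
        then have "q z (fst e) = D i (fst e) (snd e) * \<rho> z i" unfolding key[OF e(1)] by (simp add: sgn_0_0)
        then have "0 < fl' z e \<and> fl' z e < w z e"
          using flow_strict[OF z(1) segS[OF e(1)]] no segS[OF e(1)]
          by (simp add: fl'_def w_def case_prod_beta)
        then show "sum (w z) {e \<in> S. \<rho> z i < \<kappa> z e} < due z i - zval z \<and>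
           due z i - zval z < sum (w z) {e \<in> S. \<rho> z i \<le> \<kappa> z e}"
          unfolding eq using e by (intro fb(3)) auto
      qed
      have "sgn (\<kappa> x (j, k) - \<rho> x i) = sgn (\<kappa> y (j, k) - \<rho> y i)"
      proof (rule threshold_unique[OF S w_pos[OF x] w_pos[OF y]])
        show "\<kappa> x e < \<kappa> x e' \<longleftrightarrow> \<kappa> y e < \<kappa> y e'" if "e \<in> S" "e' \<in> S" for e e'
        proof -
          have "\<kappa> z e < \<kappa> z e' \<longleftrightarrow>
            sgn (q z (fst e) * D i (fst e') (snd e') - q z (fst e') * D i (fst e) (snd e)) = -1" for z
            using D_pos[OF segS[OF that(1)]] D_pos[OF segS[OF that(2)]]
            by (simp add: \<kappa>_def case_prod_beta sgn_1_neg divide_simps)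
          then show ?thesis using ord[OF segS[OF that(1)] segS[OF that(2)]] by simp
        qed
        fix U assume U: "U \<in> {{e \<in> S. \<rho> x i < \<kappa> x e}, {e \<in> S. \<rho> y i < \<kappa> y e},
          {e \<in> S. \<rho> x i \<le> \<kappa> x e}, {e \<in> S. \<rho> y i \<le> \<kappa> y e}}"
        then have "U \<subseteq> S" by auto
        \<comment> \<open>Slopes grow with \<open>k\<close>, so keys decrease: an upper set meets
          each bad in an initial run of segments. This restricts the sums to compare to those named
          by prefix lengths.\<close>
        have down: "(j, k') \<in> U" if U': "(j, k) \<in> U" and k': "k' < k" for j k k'
        proof -
          have jk: "(j, k) \<in> S" "(j, k') \<in> S" using U' \<open>U \<subseteq> S\<close> k' by (auto simp: S_def)
          have "\<kappa> z (j, k) \<le> \<kappa> z (j, k')" if "good z l" for z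
            using frac_le[of "q z j" "q z j" "D i j k'" "D i j k"] D_mono[of i j k k'] segS[OF jk(1)]
              segS[OF jk(2)] k' D_pos[of i j k'] goodD(2)[OF that]
            by (simp add: \<kappa>_def pos_def less_imp_le)
          from this[OF x] this[OF y] show ?thesis using U U' jk by auto
        qed
        \<comment> \<open>\<open>c j\<close> is the length of the prefix of bad \<open>j\<close>
          inside \<open>U\<close>; the bound \<open>K\<close> on it gives all agents the same index
          set.\<close>
        define c where "c = restrict (\<lambda>j. card {k. (j, k) \<in> U}) {..<m}"
        have fin: "finite {k. (j, k) \<in> U}" "card {k. (j, k) \<in> U} \<le> pieces I i j" for j
        proof -
          have "{k. (j, k) \<in> U} \<subseteq> {..<pieces I i j}" using \<open>U \<subseteq> S\<close> by (auto simp: S_def)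
          from finite_subset[OF this] card_mono[OF _ this]
          show "finite {k. (j, k) \<in> U}" "card {k. (j, k) \<in> U} \<le> pieces I i j" by auto
        qed
        have "c \<in> {..<m} \<rightarrow>\<^sub>E {..K}"
          using fin(2) pieces_le[OF i] by (auto simp: c_def intro: order_trans)
        moreover have "U = Sigma {..<m} (\<lambda>j. {..<c j})"
        proof -
          have "{k. (j, k) \<in> U} = {..<card {k. (j, k) \<in> U}}" for j
            using down by (intro down_closed_nat fin) auto
          then show ?thesis using \<open>U \<subseteq> S\<close> by (fastforce simp: c_def S_def)
        qed
        then have "sum (w z) U = (\<Sum>j<m. \<Sum>k<c j. L i j k * q z j)" for z
          by (simp add: w_def sum.Sigma)
        ultimately show "sgn (due x i - zval x - sum (w x) U) = sgn (due y i - zval y - sum (w y) U)"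
          using pre by simp
      qed (use fb[OF x] fb[OF y] False r seg in \<open>auto simp: S_def\<close>)
      then show ?thesis using key[of "(j, k)"] seg by (simp add: S_def)
    qed
  qed
qed

text \<open>After division by the price, the segments of all agents for bad \<open>j\<close> have
  constant sizes \<open>L i j k\<close>, the amount is 1, and the keys are
  \<open>- (D i j k * \<rho> x i)\<close>. So the order of the products \<open>D * \<rho>\<close>
  suffices when \<open>p\<close> is positive; their comparison with \<open>P\<close> decides whether
  \<open>p\<close> vanishes.\<close>

lemma bad_side:
  assumes x: "good x l" and y: "good y l" and j: "j < m"
    and ord: "\<And>i k i' k'. seg i j k \<Longrightarrow> seg i' j k' \<Longrightarrow>
      sgn (D i j k * \<rho> x i - D i' j k' * \<rho> x i') = sgn (D i j k * \<rho> y i - D i' j k' * \<rho> y i')"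
    and price: "\<And>i k. seg i j k \<Longrightarrow> sgn (D i j k * \<rho> x i - P) = sgn (D i j k * \<rho> y i - P)"
  shows "var x (Bad j) = 0 \<longleftrightarrow> var y (Bad j) = 0" "seg i j k \<Longrightarrow> side x i j k = side y i j k"
proof -
  define S where "S = Sigma {..<n} (\<lambda>i. {..<pieces I i j})"
  define \<kappa> where "\<kappa> z = (\<lambda>(i, k). - (D i j k * \<rho> z i))" for z
  define w where "w = (\<lambda>(i, k). L i j k)"
  define fl' where "fl' z = (\<lambda>(i, k). fl z i j k / q z j)" for z
  have S: "finite S" by (simp add: S_def)
  have segS: "seg (fst e) j (snd e)" if "e \<in> S" for e using that j by (auto simp: S_def)
  have key: "\<kappa> z e - (- q z j) = q z j - D (fst e) j (snd e) * \<rho> z (fst e)" for z e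
    by (simp add: \<kappa>_def case_prod_beta)
  have w_pos: "0 < w e" if "e \<in> S" for e
    using L_pos[OF segS[OF that]] by (simp add: w_def case_prod_beta)
  have at_double: "q z j = D i j k * \<rho> z i"
    if "good z l" "seg i j k" "l = Flow i j k \<or> l = Surplus i j k" for z i k
    using double_side[OF that(1,2)] that(3) by blast
  show r: "var x (Bad j) = 0 \<longleftrightarrow> var y (Bad j) = 0"
    and "seg i j k \<Longrightarrow> side x i j k = side y i j k"
  proof -
    have fb: "sum w {e \<in> S. - q z j < \<kappa> z e} \<le> sum (fl' z) S"
        "sum (fl' z) S \<le> sum w {e \<in> S. - q z j \<le> \<kappa> z e}"
        "\<And>e. \<nexists>i k. seg i j k \<and> (l = Flow i j k \<or> l = Surplus i j k) \<Longrightarrow> e \<in> S \<Longrightarrow> \<kappa> z e = - q z j \<Longrightarrow>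
          sum w {e \<in> S. - q z j < \<kappa> z e} < sum (fl' z) S \<and>
          sum (fl' z) S < sum w {e \<in> S. - q z j \<le> \<kappa> z e}"
        and fl_sum: "sum (fl' z) S = paid z j / q z j"
      if z: "good z l" for z
    proof -
      have qz: "0 < q z j" using goodD(2)[OF z] j by (simp add: pos_def)
      show "sum (fl' z) S = paid z j / q z j"
        unfolding S_def fl'_def by (simp add: sum.Sigma sum_divide_distrib case_prod_beta)
      have 1: "0 \<le> fl' z e \<and> fl' z e \<le> w e" if "e \<in> S" for e
        using feas_market(4)[OF goodD(5)[OF z] segS[OF that]] feas_market(5)[OF goodD(5)[OF z]] qz
        by (simp add: fl'_def w_def case_prod_beta pos_divide_le_eq)
      have 2: "fl' z e = w e" if "e \<in> S" "- q z j < \<kappa> z e" for e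
        using side_facts(3)[OF goodD(1,2)[OF z] segS[OF that(1)]] that(2) key[of z e] qz
        by (simp add: fl'_def w_def case_prod_beta)
      have 3: "fl' z e = 0" if "e \<in> S" "\<kappa> z e < - q z j" for e
        using side_facts(2)[OF goodD(1,2)[OF z] segS[OF that(1)]] that(2) key[of z e]
        by (simp add: fl'_def case_prod_beta)
      note fb = fill_bounds[OF S 1 2 3]
      show "sum w {e \<in> S. - q z j < \<kappa> z e} \<le> sum (fl' z) S"
        "sum (fl' z) S \<le> sum w {e \<in> S. - q z j \<le> \<kappa> z e}"
        by (rule fb(1), assumption+, rule fb(2))
      fix e assume no: "\<nexists>i k. seg i j k \<and> (l = Flow i j k \<or> l = Surplus i j k)"
        and e: "e \<in> S" "\<kappa> z e = - q z j"
      have "q z j = D (fst e) j (snd e) * \<rho> z (fst e)" using key[of z e] e by simp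
      then have "0 < fl' z e \<and> fl' z e < w e"
        using flow_strict[OF z segS[OF e(1)]] no segS[OF e(1)] qz
        by (simp add: fl'_def w_def case_prod_beta pos_divide_less_eq)
      then show "sum w {e \<in> S. - q z j < \<kappa> z e} < sum (fl' z) S \<and>
          sum (fl' z) S < sum w {e \<in> S. - q z j \<le> \<kappa> z e}"
        using e by (intro fb(3)) auto
    qed
    have one: "sum (fl' z) S = 1" if "good z l" "var z (Bad j) \<noteq> 0" for z
    proof -
      have "0 < q z j" using goodD(2)[OF that(1)] j by (simp add: pos_def)
      then show ?thesis
        using lcp_market(2)[OF goodD(1)[OF that(1)] j that(2)] by (simp add: fl_sum[OF that(1)])
    qed
    have less_one: "sum (fl' z) S < 1" if "good z l" "var z (Bad j) = 0" "l \<noteq> Bad j" for z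
    proof -
      have "Ineq (Bad j) \<notin> tight' z"
        using good_tight(4)[OF that(1) that(1) that(1) j] that(2,3) by simp
      then have "paid z j < q z j"
        using feas_market(2)[OF goodD(5)[OF that(1)] j] j by (auto simp: tight_iff mem_cons cval_market)
      moreover have "0 < q z j" using goodD(2)[OF that(1)] j by (simp add: pos_def)
      ultimately show ?thesis by (simp add: fl_sum[OF that(1)])
    qed
    \<comment> \<open>If \<open>p\<close> vanishes only at \<open>x'\<close>, its price there is
      \<open>P\<close>, while at \<open>y'\<close> it is smaller. A double label on a segment of bad
      \<open>j\<close> contradicts \<open>pr\<close>. Otherwise the segments of total size at least
      1 that are filled or marginal at \<open>y'\<close> have \<open>D * \<rho> < P\<close>, so by
      \<open>pr\<close> all are full at \<open>x'\<close>, where less than 1 is filled.\<close>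
    have zero: "var y' (Bad j) = 0"
      if good: "good x' l" "good y' l" and p: "var x' (Bad j) = 0"
        and pr: "\<And>i k. seg i j k \<Longrightarrow> sgn (D i j k * \<rho> x' i - P) = sgn (D i j k * \<rho> y' i - P)" for x' y'
    proof (rule ccontr)
      assume py: "var y' (Bad j) \<noteq> 0"
      have qy: "q y' j < P" using py feas_market(5)[OF goodD(5)[OF good(2)], of "Bad j"] by simp
      show False
      proof (cases "\<exists>i k. seg i j k \<and> (l = Flow i j k \<or> l = Surplus i j k)")
        case True
        then obtain i k where ik: "seg i j k" "l = Flow i j k \<or> l = Surplus i j k" by blast
        have "D i j k * \<rho> x' i = P" "D i j k * \<rho> y' i = q y' j"
          using at_double[OF good(1) ik] at_double[OF good(2) ik] p by simp_all
        then show False using sgn_eq_cmp(3)[OF pr[OF ik(1)]] qy by simp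
      next
        case False
        have l: "l \<noteq> Bad j"
        proof
          assume "l = Bad j"
          then have "Nonneg (Bad j) \<in> tight' y'" using goodD(7)[OF good(2), of l] unfolding double_iff by blast
          with py show False by (simp add: tight_iff)
        qed
        have "1 \<le> sum w {e \<in> S. - q y' j \<le> \<kappa> y' e}"
          using fb(2)[OF good(2)] one[OF good(2) py] by simp
        also have "\<dots> \<le> sum w {e \<in> S. - q x' j < \<kappa> x' e}"
        proof (rule sum_mono2)
          show "{e \<in> S. - q y' j \<le> \<kappa> y' e} \<subseteq> {e \<in> S. - q x' j < \<kappa> x' e}"
          proof
            fix e assume e: "e \<in> {e \<in> S. - q y' j \<le> \<kappa> y' e}"
            then have "D (fst e) j (snd e) * \<rho> y' (fst e) - P < 0"
              using key[of y' e] qy by simp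
            then have "D (fst e) j (snd e) * \<rho> x' (fst e) - P < 0"
              using sgn_eq_cmp(1)[OF pr[OF segS]] e by blast
            then show "e \<in> {e \<in> S. - q x' j < \<kappa> x' e}" using e key[of x' e] p by simp
          qed
        qed (use S w_pos in \<open>auto intro: less_imp_le\<close>)
        also have "\<dots> < 1" using fb(1)[OF good(1)] less_one[OF good(1) p l] by simp
        finally show False by simp
      qed
    qed
    show r: "var x (Bad j) = 0 \<longleftrightarrow> var y (Bad j) = 0"
      using zero[OF x y _ price] zero[OF y x _ price[symmetric]] by blast
    assume seg: "seg i j k"
    show "side x i j k = side y i j k"
    proof (cases "var x (Bad j) = 0")
      case True
      have "sgn (P - D i j k * \<rho> z i) = - sgn (D i j k * \<rho> z i - P)" for z
        using sgn_minus[of "D i j k * \<rho> z i - P"] by simp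
      then show ?thesis using True r price[OF seg] by simp
    next
      case False
      show ?thesis
      proof (cases "\<exists>i k. seg i j k \<and> (l = Flow i j k \<or> l = Surplus i j k)")
        case True
        then obtain i' k' where ik: "seg i' j k'" "l = Flow i' j k' \<or> l = Surplus i' j k'" by blast
        show ?thesis
          using ord[OF ik(1) seg] unfolding at_double[OF x ik] at_double[OF y ik] .
      next
        case no: False
        have "sgn (\<kappa> x (i, k) - (- q x j)) = sgn (\<kappa> y (i, k) - (- q y j))"
        proof (rule threshold_unique[OF S w_pos w_pos, where a = 1 and a' = 1])
          show "\<kappa> x e < \<kappa> x e' \<longleftrightarrow> \<kappa> y e < \<kappa> y e'" if "e \<in> S" "e' \<in> S" for e e'
            using sgn_eq_cmp(2)[OF ord[OF segS[OF that(1)] segS[OF that(2)]]]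
            by (simp add: \<kappa>_def case_prod_beta)
        qed (use fb[OF x] fb[OF y] one[OF x] one[OF y] False r no seg in \<open>auto simp: S_def\<close>)
        then show ?thesis unfolding key by simp
      qed
    qed
  qed
qed

lemma vertices_agree_few_bads:
  assumes "good x l" "good y l"
    and "\<And>j. j < m \<Longrightarrow> var x (Bad j) = 0 \<longleftrightarrow> var y (Bad j) = 0"
    and "\<And>i j k j' k'. seg i j k \<Longrightarrow> seg i j' k' \<Longrightarrow>
      sgn (q x j * D i j' k' - q x j' * D i j k) = sgn (q y j * D i j' k' - q y j' * D i j k)"
    and "\<And>i c. i < n \<Longrightarrow> c \<in> {..<m} \<rightarrow>\<^sub>E {..K} \<Longrightarrow>
      sgn (due x i - zval x - (\<Sum>j<m. \<Sum>k<c j. L i j k * q x j)) =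
      sgn (due y i - zval y - (\<Sum>j<m. \<Sum>k<c j. L i j k * q y j))"
  shows "x = y"
proof (rule vertex_determined[OF assms(1,2)])
  show "side x i j k = side y i j k" if seg: "seg i j k" for i j k
    by (rule agent_side(2)[OF assms(1,2) _ assms(4,5) seg]) (use seg in auto)
  show "var x (Agent i) = 0 \<longleftrightarrow> var y (Agent i) = 0" if "i < n" for i
    by (rule agent_side(1)[OF assms(1,2) that assms(4,5)]) (use that in auto)
qed (rule assms(3))

lemma vertices_agree_few_agents:
  assumes "good x l" "good y l"
    and "\<And>i. i < n \<Longrightarrow> var x (Agent i) = 0 \<longleftrightarrow> var y (Agent i) = 0"
    and "\<And>i j k i' k'. seg i j k \<Longrightarrow> seg i' j k' \<Longrightarrow>
      sgn (D i j k * \<rho> x i - D i' j k' * \<rho> x i') = sgn (D i j k * \<rho> y i - D i' j k' * \<rho> y i')"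
    and "\<And>i j k. seg i j k \<Longrightarrow> sgn (D i j k * \<rho> x i - P) = sgn (D i j k * \<rho> y i - P)"
  shows "x = y"
proof (rule vertex_determined[OF assms(1,2)])
  show "side x i j k = side y i j k" if seg: "seg i j k" for i j k
    by (rule bad_side(2)[OF assms(1,2) _ assms(4,5) seg]) (use seg in auto)
  show "var x (Bad j) = 0 \<longleftrightarrow> var y (Bad j) = 0" if "j < m" for j
    by (rule bad_side(1)[OF assms(1,2) that assms(4,5)]) auto
qed (rule assms(3))

end

section \<open>Coding vertices by faces of an arrangement, zero sets and double labels\<close>

lemma card_by_code:
  fixes \<phi> :: "'x \<Rightarrow> 'a::real_vector" and g :: "'h \<Rightarrow> 'a \<Rightarrow> real"
  assumes fin: "finite H" "finite B" "finite \<L>" and lin: "\<And>h. h \<in> H \<Longrightarrow> linear (g h)"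
    and range: "\<And>x. x \<in> X \<Longrightarrow> \<phi> x \<in> span B" "\<And>x. x \<in> X \<Longrightarrow> Z x \<subseteq> {..<e}" "\<And>x. x \<in> X \<Longrightarrow> dl x \<in> \<L>"
    and inj: "\<And>x y. x \<in> X \<Longrightarrow> y \<in> X \<Longrightarrow> dl x = dl y \<Longrightarrow> Z x = Z y \<Longrightarrow>
      (\<And>h. h \<in> H \<Longrightarrow> sgn (g h (\<phi> x)) = sgn (g h (\<phi> y))) \<Longrightarrow> x = y"
  shows "card X \<le> (2 * card H + 1) ^ card B * 2 ^ e * card \<L>"
proof -
  define sv where "sv y = restrict (\<lambda>h. sgn (g h y)) H" for y
  have sv: "finite (sv ` span B)" "card (sv ` span B) \<le> (2 * card H + 1) ^ card B"
    using card_sign_vectors[OF fin(1,2) lin] unfolding sv_def by auto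
  define code where "code x = (sv (\<phi> x), Z x, dl x)" for x
  have "inj_on code X"
  proof (rule inj_onI)
    fix x y assume xy: "x \<in> X" "y \<in> X" "code x = code y"
    then have "sgn (g h (\<phi> x)) = sgn (g h (\<phi> y))" if "h \<in> H" for h
      using that by (auto simp: code_def sv_def dest: fun_cong[of _ _ h])
    then show "x = y" using inj[OF xy(1,2)] xy(3) by (simp add: code_def)
  qed
  then have "card X = card (code ` X)" by (simp add: card_image)
  also have "\<dots> \<le> card (sv ` span B \<times> Pow {..<e} \<times> \<L>)"
    using sv(1) fin range by (intro card_mono) (auto simp: code_def)
  also have "\<dots> = card (sv ` span B) * 2 ^ e * card \<L>"
    by (simp add: card_cartesian_product card_Pow)
  also have "\<dots> \<le> (2 * card H + 1) ^ card B * 2 ^ e * card \<L>"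
    using sv(2) by simp
  finally show ?thesis .
qed

text \<open>The summand \<open>(d + 3) * (d + 1)\<close> bounds the faces of
  \<open>2 * (K + 1) ^ (d + 2)\<close> hyperplanes in a span of \<open>d + 1\<close> vectors;
  \<open>d\<close> accounts for the zero sets and \<open>2\<close> for the double labels. The base
  \<open>K + 5\<close> used with it absorbs the numerical constants.\<close>

definition vertex_bound_degree :: "nat \<Rightarrow> nat" where
  "vertex_bound_degree d = (d + 3) * (d + 1) + d + 2"

lemma code_bound:
  fixes H B e N K d :: nat
  assumes "H \<le> 2 * (K + 1) ^ (d + 2)" "B \<le> d + 1" "e \<le> d" "N \<le> 2 * K"
  shows "(2 * H + 1) ^ B * 2 ^ e * N \<le> (K + 5) ^ vertex_bound_degree d"
proof -
  have "2 * H + 1 \<le> 4 * (K + 1) ^ (d + 2) + 1" using assms(1) by simp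
  also have "\<dots> \<le> 5 * (K + 1) ^ (d + 2)" using one_le_power[of "K + 1" "d + 2"] by linarith
  also have "\<dots> \<le> (K + 5) * (K + 5) ^ (d + 2)" by (intro mult_le_mono power_mono) auto
  also have "\<dots> = (K + 5) ^ (d + 3)" by (simp flip: power_Suc add: numeral_3_eq_3)
  finally have "(2 * H + 1) ^ B \<le> ((K + 5) ^ (d + 3)) ^ B" by (intro power_mono) auto
  also have "\<dots> \<le> ((K + 5) ^ (d + 3)) ^ (d + 1)" using assms(2) by (intro power_increasing) auto
  finally have 1: "(2 * H + 1) ^ B \<le> (K + 5) ^ ((d + 3) * (d + 1))" by (simp only: power_mult)
  have "(2 :: nat) ^ e \<le> (K + 5) ^ e" by (intro power_mono) auto
  also have "\<dots> \<le> (K + 5) ^ d" using assms(3) by (intro power_increasing) auto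
  finally have 2: "2 ^ e \<le> (K + 5) ^ d" .
  have "N \<le> (K + 5) * (K + 5)" using assms(4) by (simp add: algebra_simps)
  then have 3: "N \<le> (K + 5) ^ 2" by (simp only: power2_eq_square)
  have "(2 * H + 1) ^ B * 2 ^ e * N \<le> (K + 5) ^ ((d + 3) * (d + 1)) * (K + 5) ^ d * (K + 5) ^ 2"
    using 1 2 3 by (intro mult_le_mono)
  then show ?thesis by (simp only: vertex_bound_degree_def power_add)
qed

lemma le_mult_power: "a \<le> a * (b + 1) ^ d" for a b :: nat
  by simp

lemma mult_mult_power: "x * x * x ^ d = x ^ (d + 2)" for x :: nat
  by (simp add: power_add power2_eq_square)

lemma length_label_list:
  "length (label_list I) = num_agents I + num_bads I + 2 * (\<Sum>i<num_agents I. \<Sum>j<num_bads I. pieces I i j)"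
  by (simp add: label_list_def length_concat comp_def interv_sum_list_conv_sum_set_nat atLeast0LessThan)

context bads_lcp
begin

lemma card_labels_le: "card Lbl \<le> 2 * K"
  using card_length[of "label_list I"] by (simp add: labels_def length_label_list input_size_def)

lemma card_segments: "card (segments I) \<le> K"
proof -
  have eq: "segments I = (SIGMA i:{..<n}. SIGMA j:{..<m}. {..<pieces I i j})"
    by (auto simp: segments_def)
  show ?thesis by (simp add: eq input_size_def)
qed

lemma vertices_few_bads:
  assumes m: "m \<le> d" and X: "\<And>x. x \<in> X \<Longrightarrow> good x (dl x)"
  shows "card X \<le> (K + 5) ^ vertex_bound_degree d"
proof -
  \<comment> \<open>The left summands index comparisons of two keys, the right ones comparisons of a
    net budget with a prefix sum; the prefix vectors \<open>c\<close> give the factor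
    \<open>(K + 1) ^ m\<close>.\<close>
  define H :: "((nat \<times> nat \<times> nat) \<times> (nat \<times> nat \<times> nat) + nat \<times> (nat \<Rightarrow> nat)) set"
    where "H = Inl ` (segments I \<times> segments I) \<union> Inr ` ({..<n} \<times> ({..<m} \<rightarrow>\<^sub>E {..K}))"
  define g where "g h y = (case h of
      Inl ((i, j, k), (i', j', k')) \<Rightarrow> var y (Bad j) * D i' j' k' - var y (Bad j') * D i j k
    | Inr (i, c) \<Rightarrow> (\<Sum>j<m. W i j * var y (Bad j)) - zval y - (\<Sum>j<m. \<Sum>k<c j. L i j k * var y (Bad j)))"
    for h :: "(nat \<times> nat \<times> nat) \<times> (nat \<times> nat \<times> nat) + nat \<times> (nat \<Rightarrow> nat)" and y :: point
  define B where "B = insert (0, 1) (unit_point ` Bad ` {..<m})"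
  \<comment> \<open>\<open>\<phi>\<close> replaces the variables \<open>p\<close> by the prices
    \<open>q\<close> and keeps \<open>z\<close>, so that both kinds of comparison are
    homogeneous.\<close>
  define \<phi> where "\<phi> x = zval x *\<^sub>R (0, 1) + (\<Sum>j<m. q x j *\<^sub>R unit_point (Bad j))" for x
  have \<phi>_var: "var (\<phi> x) (Bad j) = q x j" if "j < m" for x j
  proof -
    have "var (\<phi> x) (Bad j) = (\<Sum>j'<m. q x j' * (if j = j' then 1 else 0))"
      by (simp add: \<phi>_def fst_sum lookup_sum)
    also have "\<dots> = (\<Sum>j'<m. if j = j' then q x j' else 0)" by (intro sum.cong) auto
    finally show ?thesis using that by simp
  qed
  have \<phi>_z: "zval (\<phi> x) = zval x" for x by (simp add: \<phi>_def snd_sum)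
  have "card X \<le> (2 * card H + 1) ^ card B * 2 ^ m * card Lbl"
  proof (rule card_by_code)
    show "finite H" using finite_segments by (auto simp: H_def intro!: finite_PiE)
    show "finite B" "finite Lbl" by (simp_all add: B_def)
    show "linear (g h)" for h
      unfolding g_def
      by (rule linearI; cases h) (auto simp: algebra_simps sum.distrib sum_distrib_left split: prod.splits)
    show "\<phi> x \<in> span B" for x
      unfolding \<phi>_def B_def by (intro span_add span_sum span_scale span_base) auto
    show "{j. j < m \<and> var x (Bad j) = 0} \<subseteq> {..<m}" for x by auto
    show "dl x \<in> Lbl" if "x \<in> X" for x using goodD(6)[OF X[OF that]] .
    fix x y assume xy: "x \<in> X" "y \<in> X" "dl x = dl y"
      and Z: "{j. j < m \<and> var x (Bad j) = 0} = {j. j < m \<and> var y (Bad j) = 0}"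
      and s: "\<And>h. h \<in> H \<Longrightarrow> sgn (g h (\<phi> x)) = sgn (g h (\<phi> y))"
    show "x = y"
    proof (rule vertices_agree_few_bads)
      show "good x (dl x)" "good y (dl x)" using X[OF xy(1)] X[OF xy(2)] xy(3) by simp_all
      show "var x (Bad j) = 0 \<longleftrightarrow> var y (Bad j) = 0" if "j < m" for j using Z that by blast
      show "sgn (q x j * D i j' k' - q x j' * D i j k) = sgn (q y j * D i j' k' - q y j' * D i j k)"
        if "seg i j k" "seg i j' k'" for i j k j' k'
        using s[of "Inl ((i, j, k), (i, j', k'))"] that
        by (simp add: H_def g_def \<phi>_var segments_def)
      show "sgn (due x i - zval x - (\<Sum>j<m. \<Sum>k<c j. L i j k * q x j)) =
          sgn (due y i - zval y - (\<Sum>j<m. \<Sum>k<c j. L i j k * q y j))"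
        if "i < n" "c \<in> {..<m} \<rightarrow>\<^sub>E {..K}" for i c
        using s[of "Inr (i, c)"] that by (simp add: H_def g_def \<phi>_var \<phi>_z)
    qed
  qed
  also have "\<dots> \<le> (K + 5) ^ vertex_bound_degree d"
  proof (rule code_bound)
    have "card H \<le> card (segments I \<times> segments I) + card ({..<n} \<times> ({..<m} \<rightarrow>\<^sub>E {..K}))"
      unfolding H_def using finite_segments
      by (intro order_trans[OF card_Un_le] add_mono card_image_le) (auto intro!: finite_PiE)
    also have "\<dots> = card (segments I) * card (segments I) + n * (K + 1) ^ m"
      by (simp add: card_cartesian_product card_PiE)
    also have "\<dots> \<le> (K + 1) * (K + 1) * (K + 1) ^ d + (K + 1) * (K + 1) * (K + 1) ^ d"
    proof (intro add_mono)
      have "card (segments I) * card (segments I) \<le> (K + 1) * (K + 1)"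
        using card_segments by (intro mult_le_mono) auto
      also have "\<dots> \<le> (K + 1) * (K + 1) * (K + 1) ^ d" by (rule le_mult_power)
      finally show "card (segments I) * card (segments I) \<le> (K + 1) * (K + 1) * (K + 1) ^ d" .
      have "n \<le> (K + 1) * (K + 1)" by (simp add: input_size_def)
      then show "n * (K + 1) ^ m \<le> (K + 1) * (K + 1) * (K + 1) ^ d"
        using m by (intro mult_le_mono power_increasing) auto
    qed
    finally show "card H \<le> 2 * (K + 1) ^ (d + 2)" unfolding mult_mult_power by linarith
    have "card B \<le> Suc (card (unit_point ` Bad ` {..<m}))" unfolding B_def by (rule card_insert_le_m1) auto
    also have "card (unit_point ` Bad ` {..<m}) \<le> m"
      by (metis card_image_le card_lessThan finite_imageI finite_lessThan order_trans)
    finally show "card B \<le> d + 1" using m by simp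
  qed (use m card_labels_le in auto)
  finally show ?thesis .
qed

lemma vertices_few_agents:
  assumes n: "n \<le> d" and X: "\<And>x. x \<in> X \<Longrightarrow> good x (dl x)"
  shows "card X \<le> (K + 5) ^ vertex_bound_degree d"
proof -
  define H :: "((nat \<times> nat \<times> nat) \<times> (nat \<times> nat \<times> nat) + nat \<times> nat \<times> nat) set"
    where "H = Inl ` (segments I \<times> segments I) \<union> Inr ` segments I"
  define g where "g h y = (case h of
      Inl ((i, j, k), (i', j', k')) \<Rightarrow> D i j k * var y (Agent i) - D i' j' k' * var y (Agent i')
    | Inr (i, j, k) \<Rightarrow> D i j k * var y (Agent i) - zval y)"
    for h :: "(nat \<times> nat \<times> nat) \<times> (nat \<times> nat \<times> nat) + nat \<times> nat \<times> nat" and y :: point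
  define B where "B = insert (0, 1) (unit_point ` Agent ` {..<n})"
  \<comment> \<open>The coordinate of \<open>z\<close> is reused to hold the constant
    \<open>P\<close>, which makes the comparisons of \<open>D * \<rho>\<close> with \<open>P\<close>
    linear.\<close>
  define \<phi> where "\<phi> x = P *\<^sub>R (0, 1) + (\<Sum>i<n. \<rho> x i *\<^sub>R unit_point (Agent i))" for x
  have \<phi>_var: "var (\<phi> x) (Agent i) = \<rho> x i" if "i < n" for x i
  proof -
    have "var (\<phi> x) (Agent i) = (\<Sum>i'<n. \<rho> x i' * (if i = i' then 1 else 0))"
      by (simp add: \<phi>_def fst_sum lookup_sum)
    also have "\<dots> = (\<Sum>i'<n. if i = i' then \<rho> x i' else 0)" by (intro sum.cong) auto
    finally show ?thesis using that by simp
  qed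
  have \<phi>_z: "zval (\<phi> x) = P" for x by (simp add: \<phi>_def snd_sum)
  have "card X \<le> (2 * card H + 1) ^ card B * 2 ^ n * card Lbl"
  proof (rule card_by_code)
    show "finite H" using finite_segments by (auto simp: H_def)
    show "finite B" "finite Lbl" by (simp_all add: B_def)
    show "linear (g h)" for h
      unfolding g_def
      by (rule linearI; cases h) (auto simp: algebra_simps split: prod.splits)
    show "\<phi> x \<in> span B" for x
      unfolding \<phi>_def B_def by (intro span_add span_sum span_scale span_base) auto
    show "{i. i < n \<and> var x (Agent i) = 0} \<subseteq> {..<n}" for x by auto
    show "dl x \<in> Lbl" if "x \<in> X" for x using goodD(6)[OF X[OF that]] .
    fix x y assume xy: "x \<in> X" "y \<in> X" "dl x = dl y"
      and Z: "{i. i < n \<and> var x (Agent i) = 0} = {i. i < n \<and> var y (Agent i) = 0}"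
      and s: "\<And>h. h \<in> H \<Longrightarrow> sgn (g h (\<phi> x)) = sgn (g h (\<phi> y))"
    show "x = y"
    proof (rule vertices_agree_few_agents)
      show "good x (dl x)" "good y (dl x)" using X[OF xy(1)] X[OF xy(2)] xy(3) by simp_all
      show "var x (Agent i) = 0 \<longleftrightarrow> var y (Agent i) = 0" if "i < n" for i using Z that by blast
      show "sgn (D i j k * \<rho> x i - D i' j k' * \<rho> x i') = sgn (D i j k * \<rho> y i - D i' j k' * \<rho> y i')"
        if "seg i j k" "seg i' j k'" for i j k i' k'
        using s[of "Inl ((i, j, k), (i', j, k'))"] that
        by (simp add: H_def g_def \<phi>_var segments_def)
      show "sgn (D i j k * \<rho> x i - P) = sgn (D i j k * \<rho> y i - P)" if "seg i j k" for i j k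
        using s[of "Inr (i, j, k)"] that by (simp add: H_def g_def \<phi>_var \<phi>_z segments_def)
    qed
  qed
  also have "\<dots> \<le> (K + 5) ^ vertex_bound_degree d"
  proof (rule code_bound)
    have "card H \<le> card (segments I \<times> segments I) + card (segments I)"
      unfolding H_def using finite_segments
      by (intro order_trans[OF card_Un_le] add_mono card_image_le) auto
    also have "\<dots> = card (segments I) * card (segments I) + card (segments I)"
      by (simp add: card_cartesian_product)
    also have "\<dots> \<le> K * K + K" using card_segments by (intro add_mono mult_le_mono)
    also have "\<dots> \<le> 2 * ((K + 1) * (K + 1))" by (simp add: algebra_simps)
    also have "\<dots> \<le> 2 * ((K + 1) * (K + 1) * (K + 1) ^ d)" by (intro mult_le_mono le_mult_power order_refl)
    finally show "card H \<le> 2 * (K + 1) ^ (d + 2)" unfolding mult_mult_power .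
    have "card B \<le> Suc (card (unit_point ` Agent ` {..<n}))" unfolding B_def by (rule card_insert_le_m1) auto
    also have "card (unit_point ` Agent ` {..<n}) \<le> n"
      by (metis card_image_le card_lessThan finite_imageI finite_lessThan order_trans)
    finally show "card B \<le> d + 1" using n by simp
  qed (use n card_labels_le in auto)
  finally show ?thesis .
qed

theorem run_length:
  assumes nd: "nondeg" and run: "is_run vs" and d: "n \<le> d \<or> m \<le> d"
  shows "length vs - 1 \<le> (K + 5) ^ vertex_bound_degree d"
proof -
  \<comment> \<open>Every vertex but the last was left by a pivot, so it has positive
    \<open>z\<close> and a double label; their number is the number of pivots.\<close>
  define X where "X = set (butlast vs)"
  have "length vs - 1 = card X"
    using run_distinct[OF nd run] by (simp add: X_def distinct_card distinct_butlast)
  moreover have "\<exists>l. good x l" if x: "x \<in> X" for x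
  proof -
    obtain t where "t < length (butlast vs)" "butlast vs ! t = x"
      using x in_set_conv_nth[of x "butlast vs"] unfolding X_def by metis
    then have t: "Suc t < length vs" "x = vs ! t" using nth_butlast[of t vs] by auto
    obtain l where l: "0 < zval (vs ! t)" "double (vs ! t) l"
      using run_step[OF run t(1)] by blast
    then have "good x l"
      using run_generic[OF nd run _ l(1)] run_pos[OF run _ l(1)] t by (simp add: good_def)
    then show ?thesis ..
  qed
  then have "good x (SOME l. good x l)" if "x \<in> X" for x using someI_ex[of "good x"] that by simp
  ultimately show ?thesis
    using vertices_few_bads[of d X "\<lambda>x. SOME l. good x l"] vertices_few_agents[of d X "\<lambda>x. SOME l. good x l"] d
    by auto
qed

end

section \<open>Counted computations\<close>

lemma counted_bind_simps [simp]:
  "fst (counted_bind c f) = fst (f (fst c))"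
  "snd (counted_bind c f) = snd c + snd (f (fst c))"
  by (auto simp: counted_bind_def split: prod.splits)

lemma counted_primitives [simp]:
  "fst (return x) = x" "snd (return x) = 0"
  "fst (add_op a b) = a + b" "snd (add_op a b) = 1"
  "fst (sub_op a b) = a - b" "snd (sub_op a b) = 1"
  "fst (mul_op a b) = a * b" "snd (mul_op a b) = 1"
  "fst (div_op a b) = a / b" "snd (div_op a b) = 1"
  "fst (less_op a b) = (a < b)" "snd (less_op a b) = 1"
  by (simp_all add: return_def add_op_def sub_op_def mul_op_def div_op_def less_op_def)

lemma fst_map_counted [simp]: "fst (map_counted f xs) = map (\<lambda>x. fst (f x)) xs"
  by (induction xs) auto

lemma snd_map_counted_le:
  "(\<And>x. x \<in> set xs \<Longrightarrow> snd (f x) \<le> b) \<Longrightarrow> snd (map_counted f xs) \<le> length xs * b"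
proof (induction xs)
  case (Cons x xs)
  have "snd (f x) \<le> b" "snd (map_counted f xs) \<le> length xs * b" using Cons by auto
  then show ?case by simp
qed simp

lemma sum_counted_simps [simp]: "fst (sum_counted xs) = sum_list xs" "snd (sum_counted xs) = length xs"
  by (induction xs) auto

lemma snd_least_counted_le: "snd (least_counted xs) \<le> length xs"
  by (induction xs) (auto split: option.splits)

lemma least_counted_None_iff: "fst (least_counted xs) = None \<longleftrightarrow> xs = []"
  by (cases xs) (auto split: option.splits)

lemma least_counted_Some:
  "fst (least_counted xs) = Some x \<Longrightarrow> x \<in> set xs \<and> (\<forall>y\<in>set xs. fst x \<le> fst y)"
proof (induction xs arbitrary: x)
  case (Cons a xs)
  show ?case
  proof (cases "fst (least_counted xs)")
    case None
    then show ?thesis using Cons.prems by (simp add: least_counted_None_iff)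
  next
    case (Some y)
    then have "x = (if fst y < fst a then y else a)" using Cons.prems by simp
    then show ?thesis using Cons.IH[OF Some] by (auto split: if_splits)
  qed
qed simp

lemma fst_ratios: "fst (ratios e xs) = map (\<lambda>(r, v). (last v / v ! e, r)) (filter (\<lambda>(r, v). 0 < v ! e) xs)"
  by (induction e xs rule: ratios.induct) auto

lemma snd_ratios_le: "snd (ratios e xs) \<le> 2 * length xs"
  by (induction e xs rule: ratios.induct) auto

section \<open>Tableaus\<close>

definition valid_tableau :: "nat \<Rightarrow> real list list \<Rightarrow> bool" where
  "valid_tableau N T \<longleftrightarrow> length T = N \<and> (\<forall>q<N. length (T ! q) = 2 * N + 2)"

text \<open>\<open>X\<close> assigns values to the columns up to \<open>2 * N\<close>, including
  that of \<open>z\<close>; the last column holds the right-hand sides. Row operations keep this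
  solution set.\<close>

definition sat :: "nat \<Rightarrow> real list list \<Rightarrow> (nat \<Rightarrow> real) \<Rightarrow> bool" where
  "sat N T X \<longleftrightarrow> (\<forall>q<N. (\<Sum>c\<le>2*N. T ! q ! c * X c) = T ! q ! (2*N+1))"

definition basic_tableau :: "nat \<Rightarrow> real list list \<Rightarrow> nat list \<Rightarrow> bool" where
  "basic_tableau N T B \<longleftrightarrow> valid_tableau N T \<and> length B = N \<and> distinct B \<and> set B \<subseteq> {..2*N} \<and>
     (\<forall>q<N. \<forall>q'<N. T ! q' ! (B ! q) = (if q' = q then 1 else 0))"

lemma last_row: "valid_tableau N T \<Longrightarrow> q < N \<Longrightarrow> last (T ! q) = T ! q ! (2*N+1)"
  by (subst last_conv_nth) (auto simp: valid_tableau_def)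

abbreviation pivoted :: "real list list \<Rightarrow> nat \<Rightarrow> nat \<Rightarrow> real list list" where
  "pivoted T r e \<equiv> fst (pivot_tableau T r e)"

lemma pivoted_nth:
  assumes "valid_tableau N T" "r < N" "q < N" "c < 2*N+2"
  shows "pivoted T r e ! q ! c =
    (if q = r then T ! r ! c / T ! r ! e else T ! q ! c - T ! q ! e * (T ! r ! c / T ! r ! e))"
  using assms by (auto simp: valid_tableau_def pivot_tableau_def nth_enumerate_eq)

lemma valid_pivoted: "valid_tableau N T \<Longrightarrow> r < N \<Longrightarrow> valid_tableau N (pivoted T r e)"
  by (auto simp: valid_tableau_def pivot_tableau_def nth_enumerate_eq)

text \<open>There are \<open>2 * N + 2\<close> divisions in the pivot row, and at most two
  operations per entry in each of the \<open>N\<close> rows, the pivot row included for a uniform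
  bound.\<close>

lemma snd_pivot_le:
  assumes "valid_tableau N T" "r < N"
  shows "snd (pivot_tableau T r e) \<le> (2 * N + 2) * (2 * N + 1)"
proof -
  define pr where "pr = fst (map_counted (\<lambda>a. div_op a (T ! r ! e)) (T ! r))"
  have 1: "snd (map_counted (\<lambda>a. div_op a (T ! r ! e)) (T ! r)) \<le> length (T ! r) * 1"
    by (rule snd_map_counted_le) simp
  have 2: "snd (map_counted (\<lambda>(q, v). if q = r then return pr
      else map_counted (\<lambda>(a, b). do { t \<leftarrow> mul_op (v ! e) b; sub_op a t }) (zip v pr)) (List.enumerate 0 T))
    \<le> length (List.enumerate 0 T) * ((2 * N + 2) * 2)"
  proof (rule snd_map_counted_le)
    fix x assume "x \<in> set (List.enumerate 0 T)"
    obtain q v where x: "x = (q, v)" by (cases x)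
    have "snd (map_counted (\<lambda>(a, b). do { t \<leftarrow> mul_op (v ! e) b; sub_op a t }) (zip v pr))
      \<le> length (zip v pr) * 2"
      by (rule snd_map_counted_le) auto
    also have "\<dots> \<le> (2 * N + 2) * 2"
    proof (rule mult_le_mono1)
      have "length (zip v pr) \<le> length pr" by simp
      also have "\<dots> = 2 * N + 2" using assms by (simp add: pr_def valid_tableau_def)
      finally show "length (zip v pr) \<le> 2 * N + 2" .
    qed
    finally show "snd (case x of (q, v) \<Rightarrow> if q = r then return pr
      else map_counted (\<lambda>(a, b). do { t \<leftarrow> mul_op (v ! e) b; sub_op a t }) (zip v pr)) \<le> (2 * N + 2) * 2"
      by (simp add: x)
  qed
  have "snd (pivot_tableau T r e) \<le> length (T ! r) * 1 + length (List.enumerate 0 T) * ((2 * N + 2) * 2)"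
    unfolding pivot_tableau_def counted_bind_simps using 1 2 unfolding pr_def by (rule add_mono)
  also have "\<dots> = (2 * N + 2) + N * ((2 * N + 2) * 2)"
    using assms by (simp add: valid_tableau_def)
  finally have "snd (pivot_tableau T r e) \<le> (2 * N + 2) + N * ((2 * N + 2) * 2)" .
  then show ?thesis by (simp add: algebra_simps)
qed

lemma sat_pivoted:
  assumes "valid_tableau N T" "r < N" "e \<le> 2*N" "T ! r ! e \<noteq> 0"
  shows "sat N (pivoted T r e) X \<longleftrightarrow> sat N T X"
proof -
  define row where "row q = (\<Sum>c\<le>2*N. T ! q ! c * X c)" for q
  have new: "(\<Sum>c\<le>2*N. pivoted T r e ! q ! c * X c) =
      (if q = r then row r / T ! r ! e else row q - T ! q ! e * (row r / T ! r ! e))" if "q < N" for q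
    using pivoted_nth[OF assms(1,2) that]
    by (simp add: row_def sum_divide_distrib sum_distrib_left left_diff_distrib sum_subtractf mult.assoc)
  have rhs: "pivoted T r e ! q ! (2*N+1) = (if q = r then T ! r ! (2*N+1) / T ! r ! e
      else T ! q ! (2*N+1) - T ! q ! e * (T ! r ! (2*N+1) / T ! r ! e))" if "q < N" for q
    using pivoted_nth[OF assms(1,2) that] by simp
  have "sat N (pivoted T r e) X \<longleftrightarrow> (\<forall>q<N. (if q = r then row r / T ! r ! e else row q - T ! q ! e * (row r / T ! r ! e)) =
    (if q = r then T ! r ! (2*N+1) / T ! r ! e
      else T ! q ! (2*N+1) - T ! q ! e * (T ! r ! (2*N+1) / T ! r ! e)))"
    unfolding sat_def using new rhs by simp
  also have "\<dots> \<longleftrightarrow> (\<forall>q<N. row q = T ! q ! (2*N+1))"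
  proof
    assume *: "\<forall>q<N. (if q = r then row r / T ! r ! e else row q - T ! q ! e * (row r / T ! r ! e)) =
    (if q = r then T ! r ! (2*N+1) / T ! r ! e
      else T ! q ! (2*N+1) - T ! q ! e * (T ! r ! (2*N+1) / T ! r ! e))"
    have r: "row r = T ! r ! (2*N+1)" using *[rule_format, OF assms(2)] assms(4) by simp
    show "\<forall>q<N. row q = T ! q ! (2*N+1)"
    proof (intro allI impI)
      fix q assume "q < N"
      with * r show "row q = T ! q ! (2*N+1)" by (cases "q = r") auto
    qed
  qed (use assms in auto)
  finally show ?thesis by (simp add: sat_def row_def)
qed

lemma basic_pivoted:
  assumes "basic_tableau N T B" "r < N" "e \<le> 2*N" "T ! r ! e \<noteq> 0" "e \<notin> set B"
  shows "basic_tableau N (pivoted T r e) (B[r := e])"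
proof -
  have val: "valid_tableau N T" and B: "length B = N" "distinct B" "set B \<subseteq> {..2*N}"
    and unit: "\<And>q q'. q < N \<Longrightarrow> q' < N \<Longrightarrow> T ! q' ! (B ! q) = (if q' = q then 1 else 0)"
    using assms(1) by (auto simp: basic_tableau_def)
  have "pivoted T r e ! q' ! (B[r := e] ! q) = (if q' = q then 1 else 0)" if q: "q < N" "q' < N" for q q'
  proof (cases "q = r")
    case True
    then show ?thesis using pivoted_nth[OF val assms(2) q(2), of e e] assms(2,3,4) B by simp
  next
    case False
    have "B ! q \<in> set B" using q B by simp
    then have "B ! q \<le> 2 * N" using B by auto
    then show ?thesis
      using pivoted_nth[OF val assms(2) q(2), of "B ! q" e] False unit[OF q] unit[OF q(1) assms(2)]
      by (cases "q' = q") auto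
  qed
  moreover have "set (B[r := e]) \<subseteq> {..2*N}" using B assms(3) set_update_subset_insert[of B r e] by auto
  ultimately show ?thesis
    using valid_pivoted[OF val assms(2)] B assms(5) by (simp add: basic_tableau_def distinct_list_update)
qed

lemma set_basis_update:
  assumes "distinct B" "r < length B"
  shows "set (B[r := e]) = insert e (set B - {B ! r})"
  using assms by (simp add: set_update_distinct)

lemma col_value_basic:
  assumes "basic_tableau N T B" "q < N"
  shows "col_value T B (B ! q) = T ! q ! (2*N+1)"
proof -
  have "map_of (zip B (map last T)) (B ! q) = Some (map last T ! q)"
    using assms by (intro map_of_zip_nth) (auto simp: basic_tableau_def valid_tableau_def)
  then show ?thesis
    using assms last_row[of N T q] by (simp add: col_value_def basic_tableau_def valid_tableau_def)
qed

lemma col_value_nonbasic: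
  assumes "c \<notin> set B"
  shows "col_value T B c = 0"
proof -
  have "map_of (zip B (map last T)) c = None"
    using assms by (auto simp: map_of_eq_None_iff dest: set_zip_leftD)
  then show ?thesis by (simp add: col_value_def)
qed

lemma sum_basis:
  assumes "basic_tableau N T B"
  shows "(\<Sum>c\<in>set B. F c) = (\<Sum>q<N. F (B ! q))"
proof -
  have "bij_betw ((!) B) {..<N} (set B)"
    using assms bij_betw_nth[of B "{..<N}" "set B"] by (auto simp: basic_tableau_def)
  then show ?thesis by (rule sum.reindex_bij_betw[symmetric])
qed

lemma row_basis:
  assumes bt: "basic_tableau N T B" and q: "q < N"
  shows "(\<Sum>c\<le>2*N. T ! q ! c * X c) = X (B ! q) + (\<Sum>c\<in>{..2*N} - set B. T ! q ! c * X c)"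
proof -
  have "(\<Sum>c\<le>2*N. T ! q ! c * X c) = (\<Sum>c\<in>set B. T ! q ! c * X c) + (\<Sum>c\<in>{..2*N} - set B. T ! q ! c * X c)"
    using bt by (subst sum.subset_diff[of "set B"]) (auto simp: basic_tableau_def)
  also have "(\<Sum>c\<in>set B. T ! q ! c * X c) = (\<Sum>q'<N. if q' = q then X (B ! q) else 0)"
    unfolding sum_basis[OF bt] using bt q by (intro sum.cong) (auto simp: basic_tableau_def)
  finally show ?thesis using q by simp
qed

lemma sat_basic:
  assumes "basic_tableau N T B"
  shows "sat N T X \<longleftrightarrow>
    (\<forall>q<N. X (B ! q) = T ! q ! (2*N+1) - (\<Sum>c\<in>{..2*N} - set B. T ! q ! c * X c))"
  unfolding sat_def using row_basis[OF assms] by (auto simp: algebra_simps)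

lemma sat_col_value:
  assumes "basic_tableau N T B"
  shows "sat N T (col_value T B)"
  unfolding sat_basic[OF assms]
  using col_value_basic[OF assms] by (simp add: col_value_nonbasic)

lemma in_set_basis: "basic_tableau N T B \<Longrightarrow> c \<in> set B \<longleftrightarrow> (\<exists>q<N. c = B ! q)"
  by (auto simp: basic_tableau_def in_set_conv_nth)

section \<open>The tableau program follows the complementary path\<close>

lemma sum_list_concat_map: "sum_list (concat xss) = sum_list (map sum_list xss)"
  for xss :: "'a::monoid_add list list"
  by (induction xss) auto

lemma distinct_label_list: "distinct (label_list I)"
proof -
  have d1: "distinct (concat (map (\<lambda>i. concat (map (\<lambda>j. map (f i j) [0..<h i j]) [0..<b])) [0..<a]))"
    if inj: "\<And>i j k i' j' k'. f i j k = f i' j' k' \<longleftrightarrow> i = i' \<and> j = j' \<and> k = k'"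
    for f :: "nat \<Rightarrow> nat \<Rightarrow> nat \<Rightarrow> label" and h a b
  proof -
    have inner: "distinct (concat (map (\<lambda>j. map (f i j) [0..<h i j]) [0..<b]))" for i
      by (induction b) (auto simp: distinct_map inj_on_def inj)
    show ?thesis
      by (induction a) (auto simp: inner inj)
  qed
  show ?thesis
    unfolding label_list_def using d1[of Flow] d1[of Surplus]
    by (auto simp: distinct_map inj_on_def)
qed

context bads_lcp
begin

section \<open>Columns of the tableau as slacks of the LCP\<close>

abbreviation "ls \<equiv> label_list I"
abbreviation "N \<equiv> length ls"

lemma N_eq: "N = n + m + 2 * (\<Sum>i<n. \<Sum>j<m. pieces I i j)" by (rule length_label_list)

lemma N_pos: "0 < N" using n_pos N_eq by simp

lemma ls_in: "c < N \<Longrightarrow> ls ! c \<in> Lbl" by (simp add: labels_def)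

lemma in_ls: "l \<in> Lbl \<Longrightarrow> \<exists>c<N. l = ls ! c" by (auto simp: labels_def in_set_conv_nth)

lemma ls_eq_iff: "c < N \<Longrightarrow> c' < N \<Longrightarrow> ls ! c = ls ! c' \<longleftrightarrow> c = c'"
  using distinct_label_list by (simp add: nth_eq_iff_index_eq)

lemma sum_ls:
  "(\<Sum>c<N. F (ls ! c)) = (\<Sum>i<n. F (Agent i)) + (\<Sum>j<m. F (Bad j)) +
     (\<Sum>i<n. \<Sum>j<m. \<Sum>k<pieces I i j. F (Flow i j k)) + (\<Sum>i<n. \<Sum>j<m. \<Sum>k<pieces I i j. F (Surplus i j k))"
  for F :: "label \<Rightarrow> real"
proof -
  have "(\<Sum>c<N. F (ls ! c)) = sum_list (map F ls)"
    by (simp add: sum_list_sum_nth atLeast0LessThan)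
  also have "\<dots> = (\<Sum>i<n. F (Agent i)) + (\<Sum>j<m. F (Bad j)) +
     (\<Sum>i<n. \<Sum>j<m. \<Sum>k<pieces I i j. F (Flow i j k)) + (\<Sum>i<n. \<Sum>j<m. \<Sum>k<pieces I i j. F (Surplus i j k))"
    by (simp add: label_list_def map_concat sum_list_concat_map comp_def
        interv_sum_list_conv_sum_set_nat atLeast0LessThan add.assoc)
  finally show ?thesis .
qed

abbreviation "entry l l' \<equiv> fst (matrix_entry I \<epsilon> l l')"
abbreviation z_coeff :: "label \<Rightarrow> real" where
  "z_coeff l \<equiv> (case l of Agent _ \<Rightarrow> - 1 | _ \<Rightarrow> 0)"

lemma len_entry [simp]: "fst (len_entry I \<epsilon> i j k) = L i j k" "snd (len_entry I \<epsilon> i j k) \<le> 1"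
  by (simp_all add: len_entry_def len_def)

lemma if_conj_sum3:
  fixes X :: "nat \<Rightarrow> nat \<Rightarrow> nat \<Rightarrow> real"
  assumes "seg i j k"
  shows "(\<Sum>i'<n. \<Sum>j'<m. \<Sum>k'<pieces I i' j'. if i' = i \<and> j' = j \<and> k' = k then X i' j' k' else 0) = X i j k"
proof -
  have "(\<Sum>k'<pieces I i' j'. if i' = i \<and> j' = j \<and> k' = k then X i' j' k' else 0) =
      (if j' = j then if i' = i then X i j k else 0 else 0)" if "i' < n" "j' < m" for i' j'
    using assms by (cases "i' = i \<and> j' = j") auto
  then have "(\<Sum>i'<n. \<Sum>j'<m. \<Sum>k'<pieces I i' j'. if i' = i \<and> j' = j \<and> k' = k then X i' j' k' else 0) =
      (\<Sum>i'<n. \<Sum>j'<m. if j' = j then if i' = i then X i j k else 0 else 0)"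
    by (intro sum.cong) auto
  also have "\<dots> = (\<Sum>i'<n. if i' = i then X i j k else 0)" using assms by simp
  finally show ?thesis using assms by simp
qed

lemma entry_sum:
  assumes "l \<in> Lbl"
  shows "(\<Sum>c<N. entry l (ls ! c) * var x (ls ! c)) + z_coeff l * zval x = lhs' x l"
proof (cases l)
  case (Agent i)
  have "(\<Sum>i'<n. \<Sum>j<m. \<Sum>k<pieces I i' j. entry l (Flow i' j k) * fl x i' j k) =
      (\<Sum>i'<n. if i' = i then - (\<Sum>j<m. \<Sum>k<pieces I i j. fl x i j k) else 0)"
    unfolding Agent by (intro sum.cong) (auto simp: sum_negf)
  then show ?thesis
    using assms Agent sum_ls[of "\<lambda>l'. entry l l' * var x l'"] by (simp add: sum_negf)
next
  case (Bad j)
  have "(\<Sum>i<n. \<Sum>j'<m. \<Sum>k<pieces I i j'. entry l (Flow i j' k) * fl x i j' k) =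
      (\<Sum>i<n. \<Sum>j'<m. if j' = j then (\<Sum>k<pieces I i j. fl x i j k) else 0)"
    unfolding Bad by (intro sum.cong) auto
  moreover have "(\<Sum>j'<m. entry l (Bad j') * var x (Bad j')) = (\<Sum>j'<m. if j' = j then var x (Bad j) else 0)"
    unfolding Bad by (intro sum.cong) auto
  ultimately show ?thesis
    using assms Bad sum_ls[of "\<lambda>l'. entry l l' * var x l'"] by simp
next
  case (Flow i j k)
  have "(\<Sum>i'<n. entry l (Agent i') * var x (Agent i')) = (\<Sum>i'<n. if i' = i then D i j k * var x (Agent i) else 0)"
    unfolding Flow by (intro sum.cong) auto
  moreover have "(\<Sum>j'<m. entry l (Bad j') * var x (Bad j')) = (\<Sum>j'<m. if j' = j then - var x (Bad j) else 0)"
    unfolding Flow by (intro sum.cong) auto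
  moreover have "(\<Sum>i'<n. \<Sum>j'<m. \<Sum>k'<pieces I i' j'. entry l (Surplus i' j' k') * su x i' j' k') =
     (\<Sum>i'<n. \<Sum>j'<m. \<Sum>k'<pieces I i' j'. if i' = i \<and> j' = j \<and> k' = k then - su x i' j' k' else 0)"
    unfolding Flow by (intro sum.cong) auto
  ultimately show ?thesis
    using assms Flow sum_ls[of "\<lambda>l'. entry l l' * var x l'"] if_conj_sum3[of i j k "\<lambda>i j k. - su x i j k"] by simp
next
  case (Surplus i j k)
  have "(\<Sum>j'<m. entry l (Bad j') * var x (Bad j')) = (\<Sum>j'<m. if j' = j then L i j k * var x (Bad j) else 0)"
    unfolding Surplus by (intro sum.cong) auto
  moreover have "(\<Sum>i'<n. \<Sum>j'<m. \<Sum>k'<pieces I i' j'. entry l (Flow i' j' k') * fl x i' j' k') =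
     (\<Sum>i'<n. \<Sum>j'<m. \<Sum>k'<pieces I i' j'. if i' = i \<and> j' = j \<and> k' = k then fl x i' j' k' else 0)"
    unfolding Surplus by (intro sum.cong) auto
  ultimately show ?thesis
    using assms Surplus sum_ls[of "\<lambda>l'. entry l l' * var x l'"] if_conj_sum3[of i j k "\<lambda>i j k. fl x i j k"] by simp
qed

lemma rhs_entry: "fst (rhs_entry I P R \<epsilon> l) = rhs' l"
  by (cases l) (simp_all add: interv_sum_list_conv_sum_set_nat atLeast0LessThan)

text \<open>The dictionary between columns and constraints: a variable column measures the slack of
  its sign constraint, a slack column that of its inequality. Under it, \<open>partner\<close>
  becomes \<open>opp\<close>.\<close>

definition "con c = (if c < N then Nonneg (ls ! c) else Ineq (ls ! (c - N)))"

definition "col x c = (if c < 2 * N then cval (con c) x else zval x)"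

lemma con_cons: "c < 2 * N \<Longrightarrow> con c \<in> cons" by (auto simp: con_def mem_cons intro!: ls_in)

lemma cons_con: "c \<in> cons \<Longrightarrow> \<exists>k<2*N. c = con k"
proof (cases c)
  case (Nonneg l)
  assume "c \<in> cons"
  then obtain k where "k < N" "l = ls ! k" using in_ls Nonneg by (auto simp: mem_cons)
  then show ?thesis by (intro exI[of _ k]) (simp add: con_def Nonneg)
next
  case (Ineq l)
  assume "c \<in> cons"
  then obtain k where "k < N" "l = ls ! k" using in_ls Ineq by (auto simp: mem_cons)
  then show ?thesis by (intro exI[of _ "k + N"]) (simp add: con_def Ineq)
qed

lemma partner_lt: "c < 2 * N \<Longrightarrow> partner N c < 2 * N" by (auto simp: partner_def)
lemma partner_partner: "c < 2 * N \<Longrightarrow> partner N (partner N c) = c" by (auto simp: partner_def)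
lemma con_partner: "c < 2 * N \<Longrightarrow> con (partner N c) = opp (con c)" by (auto simp: con_def partner_def)
lemma con_inj: "c < 2 * N \<Longrightarrow> c' < 2 * N \<Longrightarrow> con c = con c' \<Longrightarrow> c = c'"
  by (auto simp: con_def ls_eq_iff split: if_splits)

lemma same_label_con: "c < 2 * N \<Longrightarrow> c' < 2 * N \<Longrightarrow> label_of (con c) = label_of (con c') \<Longrightarrow> c' = c \<or> c' = partner N c"
  using con_inj partner_lt con_partner same_label_iff by metis

text \<open>Inverse to \<open>col\<close> on the solutions of the initial tableau: only variables
  and \<open>z\<close> are read, and the equations determine the slack columns.\<close>

definition point_of :: "(nat \<Rightarrow> real) \<Rightarrow> point" where
  "point_of X = ((\<Sum>c<N. Poly_Mapping.single (ls ! c) (X c)), X (2 * N))"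

lemma tableau_point_eq: "tableau_point I T B = point_of (col_value T B)"
  by (simp add: tableau_point_def point_of_def Let_def)

lemma var_point_of: "c < N \<Longrightarrow> var (point_of X) (ls ! c) = X c"
proof -
  assume c: "c < N"
  have "var (point_of X) (ls ! c) = (\<Sum>c'<N. if c' = c then X c else 0)"
    unfolding point_of_def using c
    by (auto simp: lookup_sum lookup_single when_def ls_eq_iff intro!: sum.cong)
  then show ?thesis using c by simp
qed

lemma supp_point_of: "supp (point_of X)"
  unfolding supp_def point_of_def using ls_in by (auto simp: lookup_sum lookup_single when_def intro!: sum.neutral)

definition "T0 = map (\<lambda>l. fst (initial_row I P R \<epsilon> l)) ls"

lemma T0_nth:
  fixes q c :: nat
  assumes "q < N"
  shows "length (T0 ! q) = 2 * N + 2"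
    "c < N \<Longrightarrow> T0 ! q ! c = entry (ls ! q) (ls ! c)"
    "c < N \<Longrightarrow> T0 ! q ! (N + c) = (if c = q then 1 else 0)"
    "T0 ! q ! (2 * N) = z_coeff (ls ! q)" "T0 ! q ! (2 * N + 1) = rhs' (ls ! q)"
proof -
  have eq: "T0 ! q = map (\<lambda>l. entry (ls ! q) l) ls @ map (\<lambda>l'. if l' = ls ! q then 1 else 0) ls @
      [z_coeff (ls ! q), rhs' (ls ! q)]"
    using assms by (simp add: T0_def initial_row_def rhs_entry)
  show "length (T0 ! q) = 2 * N + 2" by (simp add: eq)
  show "c < N \<Longrightarrow> T0 ! q ! c = entry (ls ! q) (ls ! c)" by (simp add: eq nth_append)
  show "c < N \<Longrightarrow> T0 ! q ! (N + c) = (if c = q then 1 else 0)"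
    using assms by (simp add: eq nth_append ls_eq_iff)
  show "T0 ! q ! (2 * N) = z_coeff (ls ! q)" by (simp add: eq nth_append mult_2)
  show "T0 ! q ! (2 * N + 1) = rhs' (ls ! q)" by (simp add: eq nth_append mult_2)
qed

lemma basic_T0: "basic_tableau N T0 [N..<2 * N]"
  using T0_nth by (auto simp: basic_tableau_def valid_tableau_def T0_def)

lemma sat_T0: "sat N T0 X \<longleftrightarrow> (\<forall>q<N. X (N + q) = rhs' (ls ! q) - lhs' (point_of X) (ls ! q))"
proof -
  have "(\<Sum>c\<le>2*N. T0 ! q ! c * X c) = lhs' (point_of X) (ls ! q) + X (N + q)" if q: "q < N" for q
  proof -
    have "(\<Sum>c\<le>2*N. T0 ! q ! c * X c) = (\<Sum>c<N+N. T0 ! q ! c * X c) + z_coeff (ls ! q) * X (2 * N)"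
      using T0_nth(4)[OF q] by (simp add: lessThan_Suc_atMost[symmetric] mult_2)
    also have "(\<Sum>c<N+N. T0 ! q ! c * X c) = (\<Sum>c<N. T0 ! q ! c * X c) + (\<Sum>c<N. T0 ! q ! (N + c) * X (N + c))"
      by (simp add: lessThan_atLeast0 sum.atLeastLessThan_concat[of 0 N "N + N", symmetric]
          sum.shift_bounds_nat_ivl[of _ 0 N N, simplified] add.commute)
    also have "(\<Sum>c<N. T0 ! q ! (N + c) * X (N + c)) = (\<Sum>c<N. if c = q then X (N + q) else 0)"
      using T0_nth(3)[OF q] by (intro sum.cong) auto
    also have "(\<Sum>c<N. T0 ! q ! c * X c) = (\<Sum>c<N. entry (ls ! q) (ls ! c) * var (point_of X) (ls ! c))"
      using T0_nth(2)[OF q] by (intro sum.cong) (auto simp: var_point_of)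
    finally show ?thesis
      using q entry_sum[OF ls_in[OF q], of "point_of X"] by (simp add: point_of_def)
  qed
  then show ?thesis unfolding sat_def using T0_nth(5) by (auto simp: algebra_simps)
qed

lemma col_point_of:
  assumes "sat N T0 X" "c \<le> 2 * N"
  shows "col (point_of X) c = X c"
proof -
  consider "c < N" | "N \<le> c" "c < 2 * N" | "c = 2 * N" using assms(2) by linarith
  then show ?thesis
  proof cases
    case 1
    then show ?thesis by (simp add: col_def con_def var_point_of)
  next
    case 2
    then have "c - N < N" "N + (c - N) = c" by auto
    with assms(1) have "X c = rhs' (ls ! (c - N)) - lhs' (point_of X) (ls ! (c - N))"
      unfolding sat_T0 by metis
    then show ?thesis using 2 by (simp add: col_def con_def cval.simps(2))
  next
    case 3
    then show ?thesis by (simp add: col_def point_of_def)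
  qed
qed

lemma point_of_col: "supp x \<Longrightarrow> point_of (col x) = x"
proof (rule point_eqI)
  fix l assume "supp x"
  show "var (point_of (col x)) l = var x l"
  proof (cases "l \<in> Lbl")
    case True
    then obtain c where "c < N" "l = ls ! c" using in_ls by blast
    then show ?thesis by (simp add: var_point_of col_def con_def)
  next
    case False
    then show ?thesis using \<open>supp x\<close> supp_point_of by (simp add: supp_def)
  qed
qed (simp add: point_of_def col_def)

lemma sat_col: "supp x \<Longrightarrow> sat N T0 (col x)"
  unfolding sat_T0 by (simp add: point_of_col col_def con_def cval.simps(2))

lemma col_eqI: "supp x \<Longrightarrow> supp y \<Longrightarrow> (\<And>c. c \<le> 2 * N \<Longrightarrow> col x c = col y c) \<Longrightarrow> x = y"
proof -
  assume "supp x" "supp y" and eq: "\<And>c. c \<le> 2 * N \<Longrightarrow> col x c = col y c"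
  then have "x = point_of (col x)" "y = point_of (col y)" by (simp_all add: point_of_col)
  moreover have "point_of (col x) = point_of (col y)" using eq by (simp add: point_of_def)
  ultimately show ?thesis by simp
qed

lemma tight_con: "c < 2 * N \<Longrightarrow> con c \<in> tight' x \<longleftrightarrow> col x c = 0"
  by (simp add: tight_iff con_cons col_def)

lemma feas_col: "x \<in> feas \<longleftrightarrow> supp x \<and> (\<forall>c\<le>2*N. 0 \<le> col x c)"
proof
  assume "x \<in> feas"
  then show "supp x \<and> (\<forall>c\<le>2*N. 0 \<le> col x c)" using con_cons by (auto simp: feas_iff col_def)
next
  assume *: "supp x \<and> (\<forall>c\<le>2*N. 0 \<le> col x c)"
  have "0 \<le> cval c x" if c: "c \<in> cons" for c
  proof -
    obtain k where "k < 2 * N" "c = con k" using cons_con[OF c] by blast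
    then show ?thesis using * by (auto simp: col_def dest: spec[of _ k])
  qed
  moreover have "0 \<le> zval x" using * by (auto simp: col_def dest: spec[of _ "2 * N"])
  ultimately show "x \<in> feas" using * by (simp add: feas_iff)
qed

lemma lcp_col: "lcp x \<longleftrightarrow> x \<in> feas \<and> (\<forall>c<N. col x c = 0 \<or> col x (c + N) = 0)"
proof -
  have "(\<forall>l\<in>Lbl. Nonneg l \<in> tight' x \<or> Ineq l \<in> tight' x) \<longleftrightarrow> (\<forall>c<N. con c \<in> tight' x \<or> con (c + N) \<in> tight' x)"
    using ls_in in_ls by (fastforce simp: con_def)
  also have "\<dots> \<longleftrightarrow> (\<forall>c<N. col x c = 0 \<or> col x (c + N) = 0)"
    by (simp add: tight_con)
  finally show ?thesis by (simp add: lcp_iff)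
qed

end

lemma basis_le: "basic_tableau N T B \<Longrightarrow> b < N \<Longrightarrow> B ! b \<in> set B \<and> B ! b \<le> 2 * N"
proof -
  assume b: "basic_tableau N T B" "b < N"
  then have "B ! b \<in> set B" by (intro nth_mem) (simp add: basic_tableau_def)
  moreover have "set B \<subseteq> {..2 * N}" using b by (simp add: basic_tableau_def)
  ultimately show ?thesis by auto
qed

context bads_lcp
begin

section \<open>Tableaus equivalent to the initial one, and their pivots\<close>

definition tab :: "real list list \<Rightarrow> nat list \<Rightarrow> bool" where
  "tab T B \<longleftrightarrow> basic_tableau N T B \<and> (\<forall>X. sat N T X \<longleftrightarrow> sat N T0 X)"

abbreviation "tp T B \<equiv> tableau_point I T B"

lemma col_tp: "tab T B \<Longrightarrow> c \<le> 2 * N \<Longrightarrow> col (tp T B) c = col_value T B c"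
  using sat_col_value[of N T B] by (simp add: tableau_point_eq col_point_of tab_def)

lemma col_tp_basic: "tab T B \<Longrightarrow> b < N \<Longrightarrow> col (tp T B) (B ! b) = T ! b ! (2*N+1)"
proof -
  assume t: "tab T B" "b < N"
  then have "B ! b \<le> 2 * N" using basis_le[of N T B b] by (simp add: tab_def)
  then show ?thesis using t col_value_basic[of N T B b] by (simp add: col_tp tab_def)
qed

lemma col_tp_nonbasic: "tab T B \<Longrightarrow> c \<le> 2 * N \<Longrightarrow> c \<notin> set B \<Longrightarrow> col (tp T B) c = 0"
  by (simp add: col_tp col_value_nonbasic)

lemma supp_tp: "supp (tp T B)" by (simp add: tableau_point_eq supp_point_of)

lemma tab_determined:
  assumes t: "tab T B" and y: "supp y" "\<And>c. c \<le> 2 * N \<Longrightarrow> c \<notin> set B \<Longrightarrow> col y c = 0"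
  shows "y = tp T B"
proof (rule col_eqI[OF y(1) supp_tp])
  fix c assume c: "c \<le> 2 * N"
  have bt: "basic_tableau N T B" using t by (simp add: tab_def)
  have "sat N T (col y)" using t sat_col[OF y(1)] by (simp add: tab_def)
  then have b: "col y (B ! b) = T ! b ! (2*N+1)" if "b < N" for b
    unfolding sat_basic[OF bt] using that y(2) by simp
  show "col y c = col (tp T B) c"
  proof (cases "c \<in> set B")
    case True
    then obtain b where "b < N" "c = B ! b" using in_set_basis[OF bt] by blast
    then show ?thesis using b col_tp_basic[OF t] by simp
  next
    case False
    then show ?thesis using y(2) col_tp_nonbasic[OF t] c by simp
  qed
qed

definition complementary :: "nat list \<Rightarrow> bool" where
  "complementary B \<longleftrightarrow> (\<forall>c<N. \<not> (c \<in> set B \<and> c + N \<in> set B))"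

lemma complementary_partner: "complementary B \<Longrightarrow> c < 2 * N \<Longrightarrow> c \<in> set B \<Longrightarrow> partner N c \<notin> set B"
  by (auto simp: complementary_def partner_def dest: spec[of _ "c - N"])

text \<open>The nonbasic columns vanish and determine the basic ones, which makes the point extreme;
  of two partners one is nonbasic, which is complementarity.\<close>

lemma tab_vertex:
  assumes t: "tab T B" and nn: "\<And>b. b < N \<Longrightarrow> 0 \<le> T ! b ! (2*N+1)" and comp: "complementary B"
  shows "vertex (tp T B)"
proof -
  have bt: "basic_tableau N T B" using t by (simp add: tab_def)
  have feas: "tp T B \<in> feas"
    unfolding feas_col
  proof (intro conjI allI impI supp_tp)
    fix c assume c: "c \<le> 2 * N"
    show "0 \<le> col (tp T B) c"
      using col_tp_basic[OF t] nn col_tp_nonbasic[OF t c] in_set_basis[OF bt, of c]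
      by (cases "c \<in> set B") auto
  qed
  moreover have "lcp (tp T B)"
    unfolding lcp_col
  proof (intro conjI allI impI feas)
    fix c assume "c < N"
    then show "col (tp T B) c = 0 \<or> col (tp T B) (c + N) = 0"
      using comp col_tp_nonbasic[OF t, of c] col_tp_nonbasic[OF t, of "c + N"]
      by (auto simp: complementary_def)
  qed
  moreover have "tp T B extreme_point_of feas"
  proof (rule extremeI[OF feas])
    fix y assume y: "y \<in> feas" "tight' (tp T B) \<subseteq> tight' y" "zval (tp T B) = 0 \<longrightarrow> zval y = 0"
    show "y = tp T B"
    proof (rule tab_determined[OF t feas_supp[OF y(1)]])
      fix c assume c: "c \<le> 2 * N" "c \<notin> set B"
      then have 0: "col (tp T B) c = 0" by (rule col_tp_nonbasic[OF t])
      show "col y c = 0"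
      proof (cases "c = 2 * N")
        case True
        then show ?thesis using y(3) 0 by (simp add: col_def)
      next
        case False
        then show ?thesis using y(2) 0 c tight_con[of c "tp T B"] tight_con[of c y] by auto
      qed
    qed
  qed
  ultimately show ?thesis by (simp add: vertex_solution_def)
qed

text \<open>The invariant before a pivot. Column \<open>e\<close> and its partner are both nonbasic,
  so they carry the double label; at the previous point \<open>u\<close> the constraint of
  \<open>e\<close> was tight and its partner slack, so \<open>relax\<close> selects exactly the
  column that enters.\<close>

definition ready :: "real list list \<Rightarrow> nat list \<Rightarrow> nat \<Rightarrow> point \<Rightarrow> bool" where
  "ready T B e u \<longleftrightarrow> tab T B \<and> 2 * N \<in> set B \<and> e < 2 * N \<and> e \<notin> set B \<and> partner N e \<notin> set B \<and>
     complementary B \<and> col u e = 0 \<and> 0 < col u (partner N e)"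

lemma pivot_tab:
  assumes "tab T B" "r < N" "e \<le> 2 * N" "T ! r ! e \<noteq> 0" "e \<notin> set B"
  shows "tab (pivoted T r e) (B[r := e])"
  using assms basic_pivoted[of N T B r e] sat_pivoted[of N T r e]
  by (auto simp: tab_def basic_tableau_def)

lemma ready_double:
  assumes "ready T B e u"
  shows "double (tp T B) (label_of (con e))"
proof -
  have "con e \<in> tight' (tp T B)" "opp (con e) \<in> tight' (tp T B)"
    using assms col_tp_nonbasic[of T B e] col_tp_nonbasic[of T B "partner N e"] partner_lt[of e]
    by (auto simp: ready_def tight_con simp flip: con_partner)
  then show ?thesis by (cases "con e") (auto simp: double_iff)
qed

text \<open>The partner of a basic column other than \<open>z\<close> is nonbasic, so if the column
  vanished, its label would be a second double label; \<open>z\<close> is positive by assumption.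
  Hence no pivot is degenerate.\<close>

lemma ready_pos:
  assumes r: "ready T B e u" and g: "generic (tp T B)" and b: "b < N"
  shows "0 < T ! b ! (2*N+1)"
proof -
  have t: "tab T B" and bt: "basic_tableau N T B" using r by (auto simp: ready_def tab_def)
  have Bb: "B ! b \<in> set B" "B ! b \<le> 2 * N" using basis_le[OF bt b] by auto
  have "0 \<le> col (tp T B) (B ! b)"
    using g Bb by (auto simp: generic_def feas_col dest: vertex_feas)
  moreover have "col (tp T B) (B ! b) \<noteq> 0"
  proof
    assume 0: "col (tp T B) (B ! b) = 0"
    show False
    proof (cases "B ! b = 2 * N")
      case True
      then show False using 0 g by (simp add: col_def generic_def)
    next
      case False
      then have lt: "B ! b < 2 * N" using Bb by simp
      have "partner N (B ! b) \<notin> set B"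
        using r complementary_partner[OF _ lt Bb(1)] by (simp add: ready_def)
      then have "con (B ! b) \<in> tight' (tp T B)" "opp (con (B ! b)) \<in> tight' (tp T B)"
        using 0 lt col_tp_nonbasic[OF t, of "partner N (B ! b)"] partner_lt[OF lt]
        by (auto simp: tight_con simp flip: con_partner)
      then have "double (tp T B) (label_of (con (B ! b)))"
        by (cases "con (B ! b)") (auto simp: double_iff)
      then have "label_of (con e) = label_of (con (B ! b))"
        using ready_double[OF r] g unfolding generic_def by blast
      then have "B ! b = e \<or> B ! b = partner N e"
        using same_label_con[of e "B ! b"] r lt by (auto simp: ready_def)
      then show False using r Bb by (auto simp: ready_def)
    qed
  qed
  ultimately show ?thesis using col_tp_basic[OF t b] by simp
qed

lemma ready_relaxed:
  assumes "ready T B e u"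
  shows "relax u (label_of (con e)) = con e"
proof -
  have "e < 2 * N" "con e \<in> tight' u" "opp (con e) \<notin> tight' u"
    using assms partner_lt[of e] by (auto simp: ready_def tight_con simp flip: con_partner)
  then show ?thesis by (cases "con e") (auto simp: relaxed_cases)
qed

text \<open>Without a positive entry the entering column could grow forever, giving a ray of
  solutions. By \<open>no_secondary_ray\<close> it is the primary ray, so the vertex is
  \<open>start\<close>; but the program never enters that ray again.\<close>

lemma no_ray_step:
  assumes nd: "nondeg" and run: "is_run vs" and v: "last vs = tp T B"
    and r: "ready T B e ((ray # vs) ! (length vs - 1))" and z: "0 < zval (last vs)"
  shows "\<exists>b<N. 0 < T ! b ! e"
proof (rule ccontr)
  assume no: "\<not> ?thesis"
  have t: "tab T B" and bt: "basic_tableau N T B" and e: "e < 2 * N" "e \<notin> set B" "partner N e \<notin> set B"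
    using r by (auto simp: ready_def tab_def)
  have ne: "vs \<noteq> []" using run by (simp add: lemke_run_def)
  then have last: "last vs = vs ! (length vs - 1)" "length vs - 1 < length vs" by (simp_all add: last_conv_nth)
  have g: "generic (tp T B)" using run_generic[OF nd run last(2)] last(1) z v by simp
  have pos: "pos (tp T B)" using run_pos[OF run last(2)] last(1) z v by simp
  \<comment> \<open>The direction of the edge: the entering column grows at rate 1, the basic column
    of row \<open>b\<close> changes at rate \<open>- (T ! b ! e)\<close>, and the other nonbasic
    columns stay 0. The sum merely selects the row of \<open>c\<close>.\<close>
  define dir where "dir c = (if c = e then 1 else - (\<Sum>b<N. if B ! b = c then T ! b ! e else 0))" for c
  have dir_B: "dir (B ! b) = - (T ! b ! e)" if b: "b < N" for b
  proof -
    have "B ! b \<noteq> e" using e b bt by (auto simp: basic_tableau_def)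
    moreover have "(\<Sum>b'<N. if B ! b' = B ! b then T ! b' ! e else 0) = (\<Sum>b'<N. if b' = b then T ! b ! e else 0)"
      using bt b by (intro sum.cong) (auto simp: basic_tableau_def nth_eq_iff_index_eq)
    ultimately show ?thesis using b by (simp add: dir_def)
  qed
  have dir_N: "dir c = (if c = e then 1 else 0)" if "c \<notin> set B" for c
  proof -
    have "(\<Sum>b<N. if B ! b = c then T ! b ! e else 0) = 0"
      using that bt by (intro sum.neutral) (auto simp: basic_tableau_def)
    then show ?thesis by (simp add: dir_def)
  qed
  have dir_nn: "0 \<le> dir c" for c
  proof (cases "c \<in> set B")
    case True
    then obtain b where b: "b < N" "c = B ! b" using in_set_basis[OF bt] by blast
    then have "T ! b ! e \<le> 0" using no by (meson not_less)
    then show ?thesis using dir_B[OF b(1)] b(2) by simp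
  qed (simp add: dir_N)
  define X where "X s c = col_value T B c + s * dir c" for s c
  have sat: "sat N T0 (X s)" for s
  proof -
    have "(\<Sum>c\<in>{..2*N} - set B. T ! b ! c * X s c) = s * T ! b ! e" for b
    proof -
      have "(\<Sum>c\<in>{..2*N} - set B. T ! b ! c * X s c) = (\<Sum>c\<in>{..2*N} - set B. if c = e then s * T ! b ! e else 0)"
        by (intro sum.cong) (auto simp: X_def col_value_nonbasic dir_N)
      then show ?thesis using e by simp
    qed
    then have "sat N T (X s)"
      unfolding sat_basic[OF bt] using col_value_basic[OF bt] dir_B by (simp add: X_def)
    then show ?thesis using t by (simp add: tab_def)
  qed
  define d where "d = point_of dir"
  have line: "point_of (X s) = tp T B + s *\<^sub>R d" for s
  proof (rule point_eqI)
    show "zval (point_of (X s)) = zval (tp T B + s *\<^sub>R d)"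
      by (simp add: tableau_point_eq d_def point_of_def X_def)
    fix l
    show "var (point_of (X s)) l = var (tp T B + s *\<^sub>R d) l"
    proof (cases "l \<in> Lbl")
      case True
      then obtain c where "c < N" "l = ls ! c" using in_ls by blast
      then show ?thesis by (simp add: tableau_point_eq d_def var_point_of X_def)
    next
      case False
      then show ?thesis using supp_point_of unfolding tableau_point_eq d_def by (simp add: supp_def)
    qed
  qed
  have colx: "col (tp T B + s *\<^sub>R d) c = X s c" if "c \<le> 2 * N" for s c
    using col_point_of[OF sat that] line by metis
  have "lcp (tp T B + s *\<^sub>R d)" if s: "0 \<le> s" for s
    unfolding lcp_col feas_col
  proof (intro conjI allI impI)
    show "supp (tp T B + s *\<^sub>R d)" using supp_point_of line by metis
    fix c assume c: "c \<le> 2 * N"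
    have "0 \<le> col_value T B c" using g c unfolding generic_def
      by (metis col_tp[OF t c] feas_col vertex_feas)
    then show "0 \<le> col (tp T B + s *\<^sub>R d) c" using colx[OF c] s dir_nn[of c] by (simp add: X_def)
  next
    fix c assume c: "c < N"
    have *: "col (tp T B + s *\<^sub>R d) c' = 0" if "c' \<notin> set B" "c' \<noteq> e" "c' \<le> 2 * N" for c'
      using colx[OF that(3)] that by (simp add: X_def col_value_nonbasic dir_N)
    show "col (tp T B + s *\<^sub>R d) c = 0 \<or> col (tp T B + s *\<^sub>R d) (c + N) = 0"
    proof (cases "e = c \<or> e = c + N")
      case True
      then have "partner N e = c + N \<or> partner N e = c" using c by (auto simp: partner_def)
      moreover have "partner N e \<noteq> e" using e(1) N_pos by (auto simp: partner_def)
      ultimately show ?thesis using *[OF e(3)] c by auto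
    next
      case False
      then show ?thesis using * r c unfolding ready_def complementary_def by fastforce
    qed
  qed
  then have "d = 0 \<or> fst (tp T B) = 0 \<and> fst d = 0" using pos by (intro no_secondary_ray)
  moreover have "d \<noteq> 0"
  proof
    assume "d = 0"
    then have "col (tp T B + 1 *\<^sub>R d) e = col (tp T B + 0 *\<^sub>R d) e" by simp
    then show False using colx[of e 1] colx[of e 0] e by (simp add: X_def dir_N)
  qed
  ultimately have fst0: "fst (tp T B) = 0" "fst d = 0" by auto
  have "vertex (tp T B)" using g by (simp add: generic_def)
  then have start: "last vs = start"
    using zero_z_vertex[of "zval (tp T B)"] fst0(1) v by (metis prod.collapse)
  \<comment> \<open>Vertices are not repeated, so \<open>start\<close> occurs at index 0 only, and
    the previous point is \<open>ray\<close>.\<close>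
  have "length vs = 1"
  proof -
    have "vs ! (length vs - 1) = vs ! 0"
      using start last run ne by (simp add: lemke_run_def hd_conv_nth)
    then have "length vs - 1 = 0"
      using nth_eq_iff_index_eq[OF run_distinct[OF nd run] last(2), of 0] ne by simp
    then show ?thesis using last(2) by linarith
  qed
  then have u: "0 < col ray (partner N e)" using r by (simp add: ready_def)
  \<comment> \<open>No variable moves along \<open>d\<close>, so \<open>e\<close> would be a slack
    column. Its partner is then a variable, which is 0 on the primary ray, against
    \<open>u\<close>.\<close>
  show False
  proof (cases "e < N")
    case True
    then have "var d (ls ! e) = 1" using e by (simp add: d_def var_point_of dir_N)
    then show False using fst0 by simp
  next
    case False
    then have "partner N e < N" using e by (simp add: partner_def)
    then show False using u by (simp add: col_def con_def ray_eq)
  qed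
qed

text \<open>The minimum ratio test keeps the right-hand sides nonnegative. Since they were positive,
  the ratio \<open>\<theta>\<close> is positive and the pivot reaches a different vertex, so tableau
  pivots are genuine steps of the path. The column that leaves becomes the last constraint to turn
  tight, and its partner enters next.\<close>

lemma pivot_ready:
  assumes nd: "nondeg" and run: "is_run vs" and v: "last vs = tp T B"
    and r: "ready T B e ((ray # vs) ! (length vs - 1))" and z: "0 < zval (last vs)"
    and b: "b < N" "0 < T ! b ! e"
    and min: "\<And>b'. b' < N \<Longrightarrow> 0 < T ! b' ! e \<Longrightarrow> last (T ! b) / T ! b ! e \<le> last (T ! b') / T ! b' ! e"
  defines "T' \<equiv> pivoted T b e" and "B' \<equiv> B[b := e]"
  shows "is_run (vs @ [tp T' B'])" "0 \<le> zval (tp T' B')"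
    "0 < zval (tp T' B') \<Longrightarrow> ready T' B' (partner N (B ! b)) (tp T B)"
proof -
  let ?u = "(ray # vs) ! (length vs - 1)"
  have t: "tab T B" and bt: "basic_tableau N T B" and val: "valid_tableau N T"
    and e: "e < 2 * N" "e \<notin> set B" "partner N e \<notin> set B" and comp: "complementary B"
    using r by (auto simp: ready_def tab_def basic_tableau_def)
  have ne: "vs \<noteq> []" using run by (simp add: lemke_run_def)
  then have last: "last vs = vs ! (length vs - 1)" "length vs - 1 < length vs" by (simp_all add: last_conv_nth)
  have g: "generic (tp T B)" using run_generic[OF nd run last(2)] last(1) z v by simp
  note rp = ready_pos[OF r g]
  have t': "tab T' B'" unfolding T'_def B'_def using t b e by (intro pivot_tab) auto
  have len: "length B = N" "distinct B" using bt by (auto simp: basic_tableau_def)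
  have setB': "set B' = insert e (set B - {B ! b})"
    unfolding B'_def using len b by (intro set_basis_update) auto
  define \<theta> where "\<theta> = T ! b ! (2*N+1) / T ! b ! e"
  have \<theta>: "0 < \<theta>" using rp[OF b(1)] b(2) by (simp add: \<theta>_def)
  have rhs': "T' ! b' ! (2*N+1) = (if b' = b then \<theta> else T ! b' ! (2*N+1) - T ! b' ! e * \<theta>)" if "b' < N" for b'
    unfolding T'_def \<theta>_def using pivoted_nth[OF val b(1) that] by simp
  have nn: "0 \<le> T' ! b' ! (2*N+1)" if b': "b' < N" for b'
  proof (cases "0 < T ! b' ! e")
    case True
    then have "\<theta> \<le> T ! b' ! (2*N+1) / T ! b' ! e"
      using min[OF b' True] last_row[OF val] b b' by (simp add: \<theta>_def)
    then show ?thesis using rhs'[OF b'] True \<theta> by (simp add: field_simps)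
  next
    case False
    then have "T ! b' ! e * \<theta> \<le> 0" using \<theta> by (simp add: mult_nonpos_nonneg)
    then show ?thesis using rhs'[OF b'] \<theta> rp[OF b'] by simp
  qed
  have comp': "complementary B'"
    unfolding complementary_def
  proof (intro allI impI notI)
    fix c assume c: "c < N" "c \<in> set B' \<and> c + N \<in> set B'"
    consider "c = e" | "c + N = e" | "c \<in> set B \<and> c + N \<in> set B" using c setB' by auto
    then show False
    proof cases
      case 1
      then have "partner N e = c + N" using c by (simp add: partner_def)
      then show False using e c setB' N_pos 1 by auto
    next
      case 2
      then have "partner N e = c" using c by (auto simp: partner_def)
      then show False using e c setB' N_pos 2 by auto
    next
      case 3
      then show False using comp c(1) unfolding complementary_def by blast
    qed
  qed
  have vert: "vertex (tp T' B')" by (rule tab_vertex[OF t' nn comp'])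
  show z': "0 \<le> zval (tp T' B')" using vertex_feas[OF vert] by (simp add: feas_iff)
  have "col (tp T' B') e = \<theta>"
    using col_tp_basic[OF t' b(1)] rhs'[OF b(1)] len b(1) by (simp add: B'_def)
  moreover have "col (tp T B) e = 0" using col_tp_nonbasic[OF t] e by simp
  ultimately have neq: "tp T' B' \<noteq> tp T B" using \<theta> by auto
  have col_pos: "0 < col (tp T B) c" if c: "c \<in> set B" for c
  proof -
    obtain b' where "b' < N" "c = B ! b'" using in_set_basis[OF bt] c by blast
    then show ?thesis using rp col_tp_basic[OF t] by simp
  qed
  have sub: "tight' (tp T B) - {con e} \<subseteq> tight' (tp T' B')"
  proof
    fix c' assume c': "c' \<in> tight' (tp T B) - {con e}"
    then obtain c where c: "c < 2 * N" "c' = con c" using cons_con[of c'] by (auto simp: tight_iff)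
    then have "col (tp T B) c = 0" "c \<noteq> e" using c' by (auto simp: tight_con)
    then have "c \<notin> set B'" using col_pos[of c] setB' by auto
    then show "c' \<in> tight' (tp T' B')" using c col_tp_nonbasic[OF t', of c] by (simp add: tight_con)
  qed
  have step: "pivot_step I P R \<epsilon> ?u (last vs) (tp T' B')"
    unfolding pivot_step_def edge_def v
    using z v ready_double[OF r] ready_relaxed[OF r] sub neq vert vertex_lcp[OF vert]
    by (intro conjI exI[of _ "label_of (con e)"]) auto
  show "is_run (vs @ [tp T' B'])"
    unfolding lemke_run_def
  proof (intro conjI allI impI)
    show "hd (vs @ [tp T' B']) = start" using run ne by (simp add: lemke_run_def)
    fix s assume s: "Suc s < length (vs @ [tp T' B'])"
    have eq: "(ray # vs @ [tp T' B']) ! s = (ray # vs) ! s" using s by (cases s) (auto simp: nth_append)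
    show "pivot_step I P R \<epsilon> ((ray # vs @ [tp T' B']) ! s) ((vs @ [tp T' B']) ! s) ((vs @ [tp T' B']) ! Suc s)"
    proof (cases "Suc s < length vs")
      case True
      then show ?thesis using run unfolding eq by (simp add: lemke_run_def nth_append)
    next
      case False
      then have "s = length vs - 1" using s by simp
      then show ?thesis unfolding eq using step last ne by (simp add: nth_append)
    qed
  qed simp
  assume zp: "0 < zval (tp T' B')"
  \<comment> \<open>A column outside the basis has value 0, so a positive \<open>z\<close> is still
    basic and did not leave.\<close>
  have zB': "2 * N \<in> set B'"
  proof (rule ccontr)
    assume "2 * N \<notin> set B'"
    then have "col (tp T' B') (2 * N) = 0" using col_tp_nonbasic[OF t'] by simp
    then show False using zp by (simp add: col_def)
  qed
  have Bb: "B ! b \<in> set B" "B ! b \<le> 2 * N" using basis_le[OF bt b(1)] by auto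
  have "B ! b \<noteq> 2 * N" using zB' setB' e by auto
  then have lt: "B ! b < 2 * N" using Bb by simp
  have pB: "partner N (B ! b) \<notin> set B" by (rule complementary_partner[OF comp lt Bb(1)])
  have "partner N (B ! b) \<noteq> e"
  proof
    assume "partner N (B ! b) = e"
    then have "B ! b = partner N e" using partner_partner[OF lt] by simp
    then show False using e Bb by simp
  qed
  then have p1: "partner N (B ! b) \<notin> set B'" using pB setB' by simp
  have p2: "B ! b \<notin> set B'" using setB' Bb e by auto
  show "ready T' B' (partner N (B ! b)) (tp T B)"
    unfolding ready_def partner_partner[OF lt]
    using t' zB' partner_lt[OF lt] p1 p2 comp' col_tp_nonbasic[OF t, of "partner N (B ! b)"] pB col_pos[OF Bb(1)]
    by auto
qed

definition inv :: "lemke_state \<Rightarrow> bool" where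
  "inv st \<longleftrightarrow> is_run (visited st) \<and> last (visited st) = tp (tableau st) (basis st) \<and>
     tab (tableau st) (basis st) \<and>
     (running st \<longleftrightarrow> 0 < zval (last (visited st))) \<and>
     (if running st then ready (tableau st) (basis st) (entering st) ((ray # visited st) ! (length (visited st) - 1))
      else zval (last (visited st)) = 0)"

lemma set_ratios:
  "(x, b) \<in> set (fst (ratios e (List.enumerate 0 T))) \<longleftrightarrow>
     b < length T \<and> 0 < T ! b ! e \<and> x = last (T ! b) / T ! b ! e"
  by (auto simp: fst_ratios in_set_enumerate_eq image_iff)

lemma step_inv:
  assumes nd: "nondeg" and i: "inv st" and run: "running st"
  shows "inv (fst (lemke_step I st))" "length (visited (fst (lemke_step I st))) = Suc (length (visited st))"
    "snd (lemke_step I st) \<le> 8 * (N + 1)\<^sup>2"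
proof -
  define T B e vs where "T = tableau st" and "B = basis st" and "e = entering st" and "vs = visited st"
  have lr: "is_run vs" and v: "last vs = tp T B" and z: "0 < zval (last vs)"
    and r: "ready T B e ((ray # vs) ! (length vs - 1))"
    using i run by (auto simp: inv_def T_def B_def e_def vs_def)
  have val: "valid_tableau N T" using r by (simp add: ready_def tab_def basic_tableau_def)
  then have lenT: "length T = N" by (simp add: valid_tableau_def)
  define rs where "rs = fst (ratios e (List.enumerate 0 T))"
  obtain b0 where b0: "b0 < N" "0 < T ! b0 ! e" using no_ray_step[OF nd lr v r z] by blast
  then have "(last (T ! b0) / T ! b0 ! e, b0) \<in> set rs" by (simp add: rs_def set_ratios lenT)
  then have "rs \<noteq> []" by auto
  then obtain x b where m: "fst (least_counted rs) = Some (x, b)"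
    using least_counted_None_iff[of rs] by (cases "fst (least_counted rs)") auto
  note least = least_counted_Some[OF m]
  have b: "b < N" "0 < T ! b ! e" "x = last (T ! b) / T ! b ! e"
    using least set_ratios[of x b e T] lenT by (auto simp: rs_def)
  have min: "last (T ! b) / T ! b ! e \<le> last (T ! b') / T ! b' ! e" if "b' < N" "0 < T ! b' ! e" for b'
  proof -
    have "(last (T ! b') / T ! b' ! e, b') \<in> set rs" using that by (simp add: rs_def set_ratios lenT)
    then show ?thesis using least b(3) by force
  qed
  define T' B' where "T' = pivoted T b e" and "B' = B[b := e]"
  note piv = pivot_ready[OF nd lr v r z b(1,2) min, folded T'_def B'_def]
  have t': "tab T' B'"
    unfolding T'_def B'_def using r b by (intro pivot_tab) (auto simp: ready_def)
  have cz: "col_value T' B' (2 * N) = zval (tp T' B')"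
    using col_tp[OF t', of "2 * N"] by (simp add: col_def)
  have st': "fst (lemke_step I st) = \<lparr>tableau = T', basis = B', entering = partner N (B ! b),
      running = (0 < zval (tp T' B')), visited = vs @ [tp T' B']\<rparr>"
    using m cz unfolding rs_def T_def B_def e_def vs_def T'_def B'_def
    by (simp add: lemke_step_def Let_def)
  show "length (visited (fst (lemke_step I st))) = Suc (length (visited st))"
    by (simp add: st' vs_def)
  have "vs \<noteq> []" using lr by (simp add: lemke_run_def)
  then have "(ray # vs @ [tp T' B']) ! length vs = tp T B"
    using v by (cases "length vs") (auto simp: nth_append last_conv_nth)
  then show "inv (fst (lemke_step I st))"
    unfolding st' inv_def using piv t' by auto
  have 1: "snd (ratios e (List.enumerate 0 T)) \<le> 2 * N"
    using snd_ratios_le[of e "List.enumerate 0 T"] lenT by simp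
  have "length rs \<le> N"
    unfolding rs_def fst_ratios using length_filter_le[of _ "List.enumerate 0 T"] lenT by simp
  then have 2: "snd (least_counted rs) \<le> N" using snd_least_counted_le[of rs] by linarith
  have 3: "snd (pivot_tableau T b e) \<le> (2 * N + 2) * (2 * N + 1)" by (rule snd_pivot_le[OF val b(1)])
  have "snd (lemke_step I st) = snd (ratios e (List.enumerate 0 T)) + (snd (least_counted rs) + (snd (pivot_tableau T b e) + 1))"
    using m unfolding rs_def T_def e_def by (simp add: lemke_step_def Let_def)
  also have "\<dots> \<le> 2 * N + (N + ((2 * N + 2) * (2 * N + 1) + 1))" using 1 2 3 by (intro add_mono) auto
  also have "\<dots> \<le> 8 * (N + 1)\<^sup>2" by (simp add: power2_eq_square algebra_simps)
  finally show "snd (lemke_step I st) \<le> 8 * (N + 1)\<^sup>2" .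
qed

lemma rhs_nonneg:
  assumes "l \<in> Lbl" "\<And>i. l \<noteq> Agent i"
  shows "0 \<le> rhs' l"
proof (cases l)
  case (Flow i j k)
  then show ?thesis using DR[of i j k] assms by simp
next
  case (Surplus i j k)
  then show ?thesis using L_pos[of i j k] P_pos assms by simp
qed (use assms P_pos in auto)

lemma init_inv:
  "inv (fst (lemke_init I P R \<epsilon>))" "length (visited (fst (lemke_init I P R \<epsilon>))) = 1"
  "snd (lemke_init I P R \<epsilon>) \<le> 8 * (N + 1)\<^sup>2"
proof -
  define xs where "xs = zip (map last T0) [0..<N]"
  have valT0: "valid_tableau N T0" using basic_T0 by (simp add: basic_tableau_def)
  have lenT0: "length T0 = N" by (simp add: T0_def)
  have xs: "(x, b) \<in> set xs \<longleftrightarrow> b < N \<and> x = rhs' (ls ! b)" for x b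
    using T0_nth(5) last_row[OF valT0] lenT0 by (auto simp: xs_def set_zip intro!: exI[of _ b])
  have "xs \<noteq> []" using xs[of "rhs' (ls ! 0)" 0] N_pos by auto
  then obtain x b where m: "fst (least_counted xs) = Some (x, b)"
    using least_counted_None_iff[of xs] by (cases "fst (least_counted xs)") auto
  note least = least_counted_Some[OF m]
  have b: "b < N" "x = rhs' (ls ! b)" using least xs[of x b] by auto
  have min: "rhs' (ls ! b) \<le> rhs' l" if "l \<in> Lbl" for l
  proof -
    obtain c where "c < N" "l = ls ! c" using in_ls[OF \<open>l \<in> Lbl\<close>] by blast
    then have "(rhs' l, c) \<in> set xs" using xs by simp
    then show ?thesis using least b(2) by force
  qed
  have ag: "rhs' (Agent i) = - (P * (\<Sum>j<m. W i j))" for i by simp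
  have neg: "rhs' (ls ! b) < 0"
    using min[of "Agent 0"] n_pos P_pos sum_W_pos[of 0] ag[of 0] by (smt (verit) mem_labels(1) mult_pos_pos)
  \<comment> \<open>Only budget rows have negative right-hand sides, so the most negative one
    belongs to an agent; there the coefficient of \<open>z\<close> is -1 and can serve as
    pivot.\<close>
  obtain i where i: "ls ! b = Agent i" "i < n"
    using rhs_nonneg[OF ls_in[OF b(1)]] neg ls_in[OF b(1)] by (metis mem_labels(1) not_less)
  have z0: "- rhs' (ls ! b) = zval start"
  proof (rule antisym)
    show "- rhs' (ls ! b) \<le> zval start" using zval_start_ge[OF i(2)] i by simp
    obtain i' where "i' < n" "zval start = P * (\<Sum>j<m. W i' j)" using zval_start by blast
    then show "zval start \<le> - rhs' (ls ! b)" using min[of "Agent i'"] ag[of i'] by simp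
  qed
  define T B where "T = pivoted T0 b (2 * N)" and "B = [N..<2 * N][b := 2 * N]"
  have T0bz: "T0 ! b ! (2 * N) = - 1" using T0_nth(4)[OF b(1)] i by simp
  have t: "tab T B"
    unfolding T_def B_def using b T0bz basic_T0 by (intro pivot_tab) (auto simp: tab_def)
  have setB: "set B = insert (2 * N) ({N..<2 * N} - {N + b})"
    unfolding B_def using b by (subst set_basis_update) auto
  have cz: "col_value T B (2 * N) = zval (tp T B)"
    using col_tp[OF t, of "2 * N"] by (simp add: col_def)
  have "col (tp T B) (B ! b) = T ! b ! (2*N+1)" by (rule col_tp_basic[OF t b(1)])
  then have "zval (tp T B) = T ! b ! (2*N+1)" using b by (simp add: B_def col_def)
  also have "\<dots> = zval start"
    unfolding T_def using pivoted_nth[OF valT0 b(1) b(1)] T0_nth(5)[OF b(1)] T0bz z0 by simp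
  finally have zt: "zval (tp T B) = zval start" .
  have start: "tp T B = start"
  proof (rule point_eqI)
    fix l
    show "var (tp T B) l = var start l"
    proof (cases "l \<in> Lbl")
      case True
      then obtain c where c: "c < N" "l = ls ! c" using in_ls by blast
      then have "c \<notin> set B" using setB by auto
      then have "col (tp T B) c = 0" using c by (intro col_tp_nonbasic[OF t]) auto
      then show ?thesis using c by (simp add: col_def con_def start_vertex_def)
    next
      case False
      then show ?thesis using supp_tp by (simp add: supp_def start_vertex_def)
    qed
  qed (rule zt)
  have T0_eq: "fst (map_counted (initial_row I P R \<epsilon>) ls) = T0" by (simp add: T0_def)
  have st: "fst (lemke_init I P R \<epsilon>) = \<lparr>tableau = T, basis = B, entering = partner N (N + b),
      running = True, visited = [start]\<rparr>"
    using m cz zt zval_start_pos start T0_eq unfolding T_def B_def xs_def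
    by (simp add: lemke_init_def Let_def)
  show "length (visited (fst (lemke_init I P R \<epsilon>))) = 1" by (simp add: st)
  \<comment> \<open>The slack of this agent's budget leaves first, so its variable \<open>r\<close>
    enters, as \<open>ray_relaxed\<close> prescribes.\<close>
  have p: "partner N (N + b) = b" "partner N b = N + b" using b by (auto simp: partner_def)
  have "con (N + b) = Ineq (Agent i)" using i by (simp add: con_def)
  then have c1: "0 < col ray (N + b)"
    using b zval_start_ge[OF i(2)] by (simp add: col_def ray_eq cval.simps(2))
  have c2: "col ray b = 0" using b by (simp add: col_def con_def ray_eq)
  have "complementary B" using setB by (auto simp: complementary_def)
  then have "ready T B (partner N (N + b)) ray"
    unfolding p(1) ready_def p(2) using t setB b c1 c2 by auto
  then show "inv (fst (lemke_init I P R \<epsilon>))"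
    using t start zval_start_pos by (simp add: inv_def st lemke_run_def)
  have me: "snd (matrix_entry I \<epsilon> l l') \<le> 1" for l l'
    using len_entry(2) by (cases l; cases l') auto
  have re: "snd (rhs_entry I P R \<epsilon> l) \<le> N + 2" for l
  proof (cases l)
    case (Surplus i j k)
    then show ?thesis using len_entry(2)[of i j k] N_pos by simp
  qed (use N_eq in auto)
  have "snd (map_counted (initial_row I P R \<epsilon>) ls) \<le> N * (2 * N + 2)"
  proof (rule snd_map_counted_le)
    fix l
    have "snd (map_counted (matrix_entry I \<epsilon> l) ls) \<le> N * 1" by (rule snd_map_counted_le) (rule me)
    then show "snd (initial_row I P R \<epsilon> l) \<le> 2 * N + 2" using re[of l] by (simp add: initial_row_def)
  qed
  moreover have "snd (least_counted xs) \<le> N" using snd_least_counted_le[of xs] by (simp add: xs_def lenT0)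
  moreover have "snd (pivot_tableau T0 b (2 * N)) \<le> (2 * N + 2) * (2 * N + 1)" by (rule snd_pivot_le[OF valT0 b(1)])
  moreover have "snd (lemke_init I P R \<epsilon>) = snd (map_counted (initial_row I P R \<epsilon>) ls) +
      (snd (least_counted xs) + (snd (pivot_tableau T0 b (2 * N)) + 1))"
    using m T0_eq unfolding xs_def by (simp add: lemke_init_def Let_def)
  ultimately have "snd (lemke_init I P R \<epsilon>) \<le> N * (2 * N + 2) + (N + ((2 * N + 2) * (2 * N + 1) + 1))"
    by linarith
  also have "\<dots> \<le> 8 * (N + 1)\<^sup>2" by (simp add: power2_eq_square algebra_simps)
  finally show "snd (lemke_init I P R \<epsilon>) \<le> 8 * (N + 1)\<^sup>2" .
qed

text \<open>At most \<open>M + 1\<close> visited vertices cost at most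
  \<open>8 * (N + 1)\<^sup>2\<close> operations each. With \<open>N + 1 \<le> 2 * (K + 5)\<close>
  and \<open>M + 1 \<le> 2 * M\<close> this is at most \<open>64 * M * (K + 5)\<^sup>2\<close>, and
  absorbing 64 into \<open>(K + 5) ^ 3\<close> raises the exponent by 5 in total.\<close>

theorem program_runs:
  assumes nd: "nondeg" and d: "n \<le> d \<or> m \<le> d"
  shows "runs_within I P R \<epsilon> ((K + 5) ^ (vertex_bound_degree d + 5))"
proof -
  define M where "M = (K + 5) ^ vertex_bound_degree d"
  have len: "length vs \<le> M + 1" if "is_run vs" for vs
    using run_length[OF nd that d] unfolding M_def by linarith
  define Inv where "Inv s \<longleftrightarrow> inv (fst s) \<and> snd s \<le> length (visited (fst s)) * (8 * (N + 1)\<^sup>2)" for s :: "lemke_state \<times> nat"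
  have init: "Inv (lemke_init I P R \<epsilon>)" using init_inv by (simp add: Inv_def)
  have step: "Inv (counted_bind s (lemke_step I)) \<and>
      M + 2 - length (visited (fst (counted_bind s (lemke_step I)))) < M + 2 - length (visited (fst s))"
    if s: "Inv s" "running (fst s)" for s
  proof -
    note si = step_inv[OF nd _ s(2)]
    have i: "inv (fst s)" using s by (simp add: Inv_def)
    have "length (visited (fst s)) \<le> M + 1" using len i by (simp add: inv_def)
    then show ?thesis using si[OF i] s(1) by (simp add: Inv_def)
  qed
  have "\<exists>t. lemke_program I P R \<epsilon> = Some t"
    unfolding lemke_program_def
    by (rule measure_while_option_Some[where P = Inv and f = "\<lambda>s. M + 2 - length (visited (fst s))"])
      (use step init in auto)
  then obtain st ops where prog: "lemke_program I P R \<epsilon> = Some (st, ops)" by (metis prod.exhaust)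
  have Inv: "Inv (st, ops)"
    by (rule while_option_rule[OF _ prog[unfolded lemke_program_def], where P = Inv]) (use step init in auto)
  have "\<not> running st" using while_option_stop[OF prog[unfolded lemke_program_def]] by simp
  then have i: "is_run (visited st)" "zval (last (visited st)) = 0"
    using Inv by (auto simp: Inv_def inv_def)
  have big: "M \<le> (K + 5) ^ (vertex_bound_degree d + 5)"
    unfolding M_def by (intro power_increasing) auto
  have "ops \<le> length (visited st) * (8 * (N + 1)\<^sup>2)" using Inv by (simp add: Inv_def)
  also have "\<dots> \<le> (M + 1) * (8 * (2 * (K + 5))\<^sup>2)"
  proof (intro mult_le_mono order_refl power_mono)
    show "N + 1 \<le> 2 * (K + 5)" by (simp add: N_eq input_size_def)
  qed (use len[OF i(1)] in auto)
  also have "(2 * (K + 5))\<^sup>2 = 4 * (K + 5)\<^sup>2" by (simp only: power_mult_distrib) simp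
  also have "(M + 1) * (8 * (4 * (K + 5)\<^sup>2)) = 32 * (M + 1) * (K + 5)\<^sup>2" by (simp only: mult_ac)
  also have "\<dots> \<le> 64 * M * (K + 5)\<^sup>2"
  proof -
    have "1 \<le> M" unfolding M_def by (rule one_le_power) simp
    then show ?thesis by (intro mult_le_mono1) simp
  qed
  also have "\<dots> \<le> (K + 5) ^ 3 * M * (K + 5)\<^sup>2"
  proof (intro mult_le_mono1)
    have "(5 :: nat) ^ 3 \<le> (K + 5) ^ 3" by (intro power_mono) auto
    then show "64 \<le> (K + 5) ^ 3" by simp
  qed
  also have "\<dots> = (K + 5) ^ (3 + vertex_bound_degree d + 2)" by (simp only: power_add M_def)
  also have "3 + vertex_bound_degree d + 2 = vertex_bound_degree d + 5" by simp
  finally have "ops \<le> (K + 5) ^ (vertex_bound_degree d + 5)" .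
  then show ?thesis
    unfolding runs_within_def using prog i run_length[OF nd _ d] big unfolding M_def
    by (meson order_trans)
qed

end

section \<open>Generic perturbations\<close>

context bads_lcp
begin

text \<open>Every label has a tight constraint, and each of two double labels would contribute one
  more. A visited vertex with positive \<open>z\<close> also has positive prices, so the hypothesis
  is only asked for such points.\<close>

lemma nondegenerate_if_few_tight:
  assumes few: "\<And>x. lcp x \<Longrightarrow> pos x \<Longrightarrow> 0 < zval x \<Longrightarrow> card (tight' x) \<le> card Lbl + 1"
  shows "nondeg"
  unfolding nondegenerate_def
proof (intro allI impI)
  fix vs assume vs: "is_run vs \<and> 0 < zval (last vs)"
  then have ne: "vs \<noteq> []" by (simp add: lemke_run_def)
  define x where "x = last vs"
  have x: "x = vs ! (length vs - 1)" "length vs - 1 < length vs" using ne by (simp_all add: x_def last_conv_nth)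
  have vert: "vertex x" using run_vertex[of vs "length vs - 1"] vs x by simp
  have pos: "pos x" using run_pos[of vs "length vs - 1"] vs x by (simp add: x_def)
  have z: "0 < zval x" using vs by (simp add: x_def)
  have uniq: "l1 = l2" if l: "double x l1" "double x l2" for l1 l2
  proof (rule ccontr)
    assume ne: "l1 \<noteq> l2"
    define c where "c l = (if Nonneg l \<in> tight' x then Nonneg l else Ineq l)" for l
    have c1: "label_of (c l) = l" for l by (simp add: c_def)
    then have "inj_on c Lbl" by (metis inj_onI)
    then have card_c: "card (c ` Lbl) = card Lbl" by (rule card_image)
    have no: "Ineq l1 \<notin> c ` Lbl" "Ineq l2 \<notin> insert (Ineq l1) (c ` Lbl)"
      using l ne by (auto simp: c_def double_iff split: if_splits)
    have "card (insert (Ineq l2) (insert (Ineq l1) (c ` Lbl))) = card Lbl + 2"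
      using no card_c by simp
    moreover have "insert (Ineq l2) (insert (Ineq l1) (c ` Lbl)) \<subseteq> tight' x"
      using l vertex_lcp[OF vert] by (auto simp: c_def double_iff lcp_iff)
    moreover have "finite (tight' x)" by (rule finite_subset[of _ cons]) (auto simp: tight_iff)
    ultimately have "card Lbl + 2 \<le> card (tight' x)" by (metis card_mono)
    then show False using few[OF vertex_lcp[OF vert] pos z] by simp
  qed
  then show "\<exists>!l. double (last vs) l"
    using double_label_exists[OF vert z] unfolding x_def by blast
qed

end

subsection \<open>Piecewise linear utilities with given slopes and lengths\<close>

text \<open>Each slope is weighted with the part of \<open>[0, x]\<close> that falls into its
  segment, the last segment being unbounded. It supplies the utility that an instance with altered
  slopes and lengths must carry.\<close>

definition plc_fun :: "nat \<Rightarrow> (nat \<Rightarrow> real) \<Rightarrow> (nat \<Rightarrow> real) \<Rightarrow> real \<Rightarrow> real" where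
  "plc_fun K D L x = - (\<Sum>k<K. D k *
     (if Suc k = K then max 0 (x - (\<Sum>k'<k. L k')) else max 0 (min (L k) (x - (\<Sum>k'<k. L k')))))"

lemma plc_disutility_plc_fun:
  assumes "0 < K" "\<And>k. k < K \<Longrightarrow> 0 < D k" "\<And>k. Suc k < K \<Longrightarrow> D k < D (Suc k) \<and> 0 < L k"
  shows "plc_disutility (plc_fun K D L) K D L"
proof -
  define S where "S k = (\<Sum>k'<k. L k')" for k
  have S_Suc: "S (Suc k) = S k + L k" for k by (simp add: S_def)
  have S_mono: "S k \<le> S k'" if "k \<le> k'" "k' < K" for k k'
    using that
  proof (induction k' rule: dec_induct)
    case (step k')
    then show ?case using assms(3)[of k'] S_Suc[of k'] by auto
  qed simp
  have val: "plc_fun K D L x = - (\<Sum>k'<k. D k' * L k') - D k * (x - S k)"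
    if k: "k < K" "S k \<le> x" "Suc k < K \<longrightarrow> x \<le> S (Suc k)" for k x
  proof -
    define t where "t k = D k * (if Suc k = K then max 0 (x - S k) else max 0 (min (L k) (x - S k)))" for k
    have "(\<Sum>k'<K. t k') = (\<Sum>k'<k. t k') + (\<Sum>k'\<in>{k..<K}. t k')"
      using k(1) by (metis less_imp_le_nat lessThan_atLeast0 sum.atLeastLessThan_concat zero_le)
    also have "(\<Sum>k'\<in>{k..<K}. t k') = t k + (\<Sum>k'\<in>{Suc k..<K}. t k')"
      using k(1) by (simp add: sum.atLeast_Suc_lessThan)
    also have "(\<Sum>k'\<in>{Suc k..<K}. t k') = 0"
    proof (intro sum.neutral ballI)
      fix k' assume k': "k' \<in> {Suc k..<K}"
      then have "x \<le> S k'" using k(3) S_mono[of "Suc k" k'] by auto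
      then show "t k' = 0" using k' by (simp add: t_def max_def min_def)
    qed
    also have "t k = D k * (x - S k)"
      using k S_Suc[of k] by (auto simp: t_def max_def min_def)
    also have "(\<Sum>k'<k. t k') = (\<Sum>k'<k. D k' * L k')"
    proof (intro sum.cong refl)
      fix k' assume k': "k' \<in> {..<k}"
      then have "L k' \<le> x - S k'" "0 < L k'" "Suc k' \<noteq> K"
        using S_mono[of "Suc k'" k] S_Suc[of k'] k assms(3)[of k'] by auto
      then show "t k' = D k' * L k'" by (simp add: t_def)
    qed
    finally have "(\<Sum>k'<K. t k') = (\<Sum>k'<k. D k' * L k') + D k * (x - S k)" by simp
    moreover have "plc_fun K D L x = - (\<Sum>k'<K. t k')" by (simp only: plc_fun_def t_def S_def)
    ultimately show ?thesis by linarith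
  qed
  have "plc_fun K D L x = plc_fun K D L (S k) - D k * (x - S k)"
    if k: "k < K" "S k \<le> x" "Suc k < K \<longrightarrow> x \<le> S (Suc k)" for k x
  proof -
    have "Suc k < K \<longrightarrow> S k \<le> S (Suc k)" using S_mono[of k "Suc k"] by simp
    then show ?thesis using val[OF k] val[of k "S k"] k(1) by simp
  qed
  moreover have "plc_fun K D L 0 = 0"
    using val[of 0 0] S_mono[of 0 1] assms(1) by (simp add: S_def)
  ultimately show ?thesis
    using assms unfolding plc_disutility_def S_def lessThan_Suc_atMost by blast
qed

subsection \<open>Affine constraints\<close>

definition affine_map :: "('a::real_vector \<Rightarrow> real) \<Rightarrow> bool" where
  "affine_map f \<longleftrightarrow> (\<exists>b h. linear h \<and> f = (\<lambda>x. b + h x))"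

lemma affine_map_linear: "linear f \<Longrightarrow> affine_map f"
  unfolding affine_map_def by (intro exI[of _ 0] exI[of _ f]) simp

lemma affine_map_const: "affine_map (\<lambda>_. b)"
  unfolding affine_map_def by (intro exI[of _ b] exI[of _ "\<lambda>_. 0"]) (simp add: linear_zero)

lemma affine_map_add: "affine_map f \<Longrightarrow> affine_map g \<Longrightarrow> affine_map (\<lambda>x. f x + g x)"
proof -
  assume "affine_map f" "affine_map g"
  then obtain b h b' h' where "linear h" "f = (\<lambda>x. b + h x)" "linear h'" "g = (\<lambda>x. b' + h' x)"
    unfolding affine_map_def by blast
  then show ?thesis
    unfolding affine_map_def
    by (intro exI[of _ "b + b'"] exI[of _ "\<lambda>x. h x + h' x"]) (auto intro: linear_compose_add)
qed

lemma affine_map_cmult: "affine_map f \<Longrightarrow> affine_map (\<lambda>x. c * f x)"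
proof -
  assume "affine_map f"
  then obtain b h where "linear h" "f = (\<lambda>x. b + h x)" unfolding affine_map_def by blast
  then show ?thesis
    unfolding affine_map_def using linear_compose_scale_right[of h c]
    by (intro exI[of _ "c * b"] exI[of _ "\<lambda>x. c * h x"]) (auto simp: algebra_simps)
qed

lemma affine_map_diff: "affine_map f \<Longrightarrow> affine_map g \<Longrightarrow> affine_map (\<lambda>x. f x - g x)"
  using affine_map_add[of f "\<lambda>x. (-1) * g x"] affine_map_cmult[of g "-1"] by simp

lemma affine_map_sum: "(\<And>a. a \<in> A \<Longrightarrow> affine_map (f a)) \<Longrightarrow> affine_map (\<lambda>x. \<Sum>a\<in>A. f a x)"
  by (induction A rule: infinite_finite_induct) (auto intro: affine_map_const affine_map_add)

lemmas affine_map_var = affine_map_linear[OF linear_var(1)] affine_map_linear[OF linear_var(2)]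
lemmas affine_intros = affine_map_add affine_map_diff affine_map_cmult affine_map_sum affine_map_var affine_map_const

lemma covered_cut_affine:
  assumes "covered d S" "affine_map f" "s \<in> S" "f s \<noteq> 0" "x0 \<in> S" "f x0 = 0"
  shows "\<exists>d'. d = Suc d' \<and> covered d' (S \<inter> {x. f x = 0})"
proof -
  obtain b h where "linear h" and f: "f = (\<lambda>x. b + h x)" using assms(2) unfolding affine_map_def by blast
  show ?thesis
  proof (rule covered_cut[OF assms(1) \<open>linear h\<close> assms(3), of b])
    show "b + h s \<noteq> 0" "S \<inter> {x. b + h x = 0} \<noteq> {}" using assms(4-6) f by auto
    fix d' assume "d = Suc d'" "covered d' (S \<inter> {x. b + h x = 0})"
    then show ?thesis using f by auto
  qed
qed

text \<open>The direction \<open>u k\<close> leaves \<open>x0\<close> so that only equation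
  \<open>k\<close> fails. This point still satisfies the equations already imposed, so imposing
  equation \<open>k\<close> is a proper cut.\<close>

lemma covered_cut_set:
  assumes "finite Q" "covered d S" "x0 \<in> S"
    and "\<And>k. k \<in> Q \<Longrightarrow> affine_map (f k) \<and> f k x0 = 0"
    and "\<And>k. k \<in> Q \<Longrightarrow> x0 + u k \<in> S \<and> f k (x0 + u k) \<noteq> 0 \<and> (\<forall>k'\<in>Q - {k}. f k' (x0 + u k) = 0)"
  shows "\<exists>d'. d' + card Q = d \<and> covered d' {x \<in> S. \<forall>k\<in>Q. f k x = 0}"
  using assms(1,4,5)
proof (induction Q rule: finite_induct)
  case empty
  then show ?case using assms(2) by auto
next
  case (insert k Q)
  have "\<exists>d'. d' + card Q = d \<and> covered d' {x \<in> S. \<forall>k\<in>Q. f k x = 0}"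
    by (rule insert.IH) (use insert.prems in auto)
  then obtain d' where d': "d' + card Q = d" "covered d' {x \<in> S. \<forall>k\<in>Q. f k x = 0}" by blast
  have "\<exists>d''. d' = Suc d'' \<and> covered d'' ({x \<in> S. \<forall>k\<in>Q. f k x = 0} \<inter> {x. f k x = 0})"
    using insert.prems insert.hyps assms(3)
    by (intro covered_cut_affine[OF d'(2), where s = "x0 + u k" and ?x0.0 = x0]) auto
  then obtain d'' where "d' = Suc d''" "covered d'' ({x \<in> S. \<forall>k\<in>Q. f k x = 0} \<inter> {x. f k x = 0})" by blast
  moreover have "{x \<in> S. \<forall>k\<in>Q. f k x = 0} \<inter> {x. f k x = 0} = {x \<in> S. \<forall>k\<in>insert k Q. f k x = 0}" by auto
  ultimately show ?case using d'(1) insert.hyps by (intro exI[of _ d'']) auto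
qed

section \<open>Private parameters and patterns of tight constraints\<close>

datatype param = PSteep nat nat nat | PLen nat nat nat | PEndow nat

context bads_lcp
begin

text \<open>
  The perturbed instance: all slopes, all lengths and the endowments of bad \<open>0\<close> are free, except
  that the last agent absorbs the changes of the others so that the supply of bad \<open>0\<close> stays \<open>1\<close>.
\<close>

definition Wp :: "(param \<Rightarrow> real) \<Rightarrow> nat \<Rightarrow> nat \<Rightarrow> real" where
  "Wp \<theta> i j = (if j = 0 then if Suc i < n then \<theta> (PEndow i) else 1 - (\<Sum>i'<n - 1. \<theta> (PEndow i')) else W i j)"

definition pert :: "(param \<Rightarrow> real) \<Rightarrow> splc_instance" where
  "pert \<theta> = I\<lparr>endow := Wp \<theta>,
     util := \<lambda>i j. plc_fun (pieces I i j) (\<lambda>k. \<theta> (PSteep i j k)) (\<lambda>k. \<theta> (PLen i j k)),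
     steep := \<lambda>i j k. \<theta> (PSteep i j k), seglen := \<lambda>i j k. \<theta> (PLen i j k)\<rparr>"

lemma pert_simps [simp]:
  "num_agents (pert \<theta>) = n" "num_bads (pert \<theta>) = m" "pieces (pert \<theta>) = pieces I"
  "endow (pert \<theta>) = Wp \<theta>" "steep (pert \<theta>) i j k = \<theta> (PSteep i j k)" "seglen (pert \<theta>) i j k = \<theta> (PLen i j k)"
  by (simp_all add: pert_def)

lemma pert_labels [simp]: "labels (pert \<theta>) = Lbl"
  by (simp add: labels_def label_list_def)

lemma pert_input_size [simp]: "input_size (pert \<theta>) = K"
  by (simp add: input_size_def)

lemma pert_len: "len (pert \<theta>) \<epsilon> i j k = (if Suc k = pieces I i j then 1 + \<epsilon> else \<theta> (PLen i j k))"
  by (simp add: len_def)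

lemma Wp_sum: assumes "j < m" shows "(\<Sum>i<n. Wp \<theta> i j) = 1"
proof (cases "j = 0")
  case True
  have "(\<Sum>i<n. Wp \<theta> i 0) = (\<Sum>i<n - 1. Wp \<theta> i 0) + Wp \<theta> (n - 1) 0"
    using n_pos by (metis Suc_diff_1 sum.lessThan_Suc)
  also have "(\<Sum>i<n - 1. Wp \<theta> i 0) = (\<Sum>i<n - 1. \<theta> (PEndow i))"
    by (intro sum.cong) (auto simp: Wp_def)
  also have "Wp \<theta> (n - 1) 0 = 1 - (\<Sum>i<n - 1. \<theta> (PEndow i))"
    using n_pos by (simp add: Wp_def)
  finally show ?thesis using True by simp
next
  case False
  then show ?thesis using W_sum[OF assms] by (simp add: Wp_def)
qed

definition agents_of :: "constr set \<Rightarrow> nat set" where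
  "agents_of T = {i. i < n \<and> Ineq (Agent i) \<in> T}"

text \<open>The parameters charged to the constraints of \<open>T\<close>. Last segments have no
  length parameter, and if every agent is tight one budget equation stays uncharged; it reappears as
  the summed equation in \<open>S0\<close>.\<close>

definition act :: "constr set \<Rightarrow> param set" where
  "act T = {PSteep i j k | i j k. Ineq (Flow i j k) \<in> T} \<union>
     {PLen i j k | i j k. Ineq (Surplus i j k) \<in> T \<and> Suc k < pieces I i j} \<union>
     PEndow ` (agents_of T - {n - 1}) \<union>
     (if n - 1 \<in> agents_of T \<and> agents_of T \<noteq> {..<n} then {PEndow (Max ({..<n} - agents_of T))} else {})"

text \<open>
  Once the endowments of the agents outside \<open>A\<close> are fixed, so is the aggregate endowment of \<open>A\<close>: the
  sum of the budget equations over \<open>A\<close> replaces the equation of the last agent, and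
  its private parameter belongs to the largest agent outside \<open>A\<close>.
\<close>

definition gc :: "constr set \<Rightarrow> param \<Rightarrow> (param \<Rightarrow> real) \<Rightarrow> point \<Rightarrow> real" where
  "gc T c \<theta> x = (case c of
      PSteep i j k \<Rightarrow> \<theta> c * \<rho> x i - q x j + su x i j k
    | PLen i j k \<Rightarrow> \<theta> c * q x j - fl x i j k
    | PEndow i \<Rightarrow> if i \<in> agents_of T
        then earn x i + zval x - \<theta> c * q x 0 - (\<Sum>j\<in>{..<m} - {0}. W i j * q x j)
        else (\<Sum>i'\<in>agents_of T. earn x i' + zval x)
          - (1 - (\<Sum>i'\<in>{..<n} - agents_of T. \<theta> (PEndow i'))) * q x 0
          - (\<Sum>j\<in>{..<m} - {0}. (\<Sum>i'\<in>agents_of T. W i' j) * q x j))"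

text \<open>The conditions of \<open>T\<close> that contain no parameter. The endowments of each bad
  sum to 1, so the sum of all budget equations does not mention them.\<close>

definition S0 :: "constr set \<Rightarrow> point set" where
  "S0 T = {x. supp x \<and> (\<forall>l. Nonneg l \<in> T \<longrightarrow> var x l = 0) \<and> (\<forall>j. Ineq (Bad j) \<in> T \<longrightarrow> q x j - paid x j = 0) \<and>
     (agents_of T = {..<n} \<longrightarrow> (\<Sum>i<n. earn x i + zval x) - (\<Sum>j<m. q x j) = 0)}"

text \<open>The subtraction does not truncate for the patterns in \<open>Ts\<close>, as the second
  part of \<open>covered_S0\<close> confirms.\<close>

definition dim0 :: "constr set \<Rightarrow> nat" where
  "dim0 T = card Lbl + 1 - card {l. Nonneg l \<in> T} - card {j. Ineq (Bad j) \<in> T}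
     - (if agents_of T = {..<n} then 1 else 0)"

text \<open>The last condition gives each equation of a bad a flow variable of its own that is not
  forced to 0, which makes these equations independent. Patterns at positive prices have it, because
  a fully paid bad has a positive flow.\<close>

definition Ts :: "constr set set" where
  "Ts = {T. T \<subseteq> cons \<and> S0 T \<noteq> {} \<and>
     (\<forall>j. Ineq (Bad j) \<in> T \<longrightarrow> (\<exists>i k. seg i j k \<and> Nonneg (Flow i j k) \<notin> T))}"

lemma covered_supp: "covered (card Lbl + 1) {x. supp x}"
proof -
  define B where "B = insert (0, 1) (unit_point ` Lbl)"
  have "x \<in> span B" if x: "supp x" for x
  proof -
    have "x = zval x *\<^sub>R (0, 1) + (\<Sum>l\<in>Lbl. var x l *\<^sub>R unit_point l)"
    proof (rule point_eqI)
      fix l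
      have "(\<Sum>l'\<in>Lbl. var x l' * var (unit_point l') l) = (\<Sum>l'\<in>Lbl. if l' = l then var x l else 0)"
        by (intro sum.cong) auto
      also have "\<dots> = var x l" using x by (simp add: supp_def)
      finally show "var x l = var (zval x *\<^sub>R (0, 1) + (\<Sum>l\<in>Lbl. var x l *\<^sub>R unit_point l)) l"
        by (simp add: fst_sum lookup_sum)
    qed (simp add: snd_sum)
    moreover have "zval x *\<^sub>R (0, 1) + (\<Sum>l\<in>Lbl. var x l *\<^sub>R unit_point l) \<in> span B"
      unfolding B_def by (intro span_add span_sum span_scale span_base) auto
    ultimately show ?thesis by simp
  qed
  moreover have "card B \<le> Suc (card (unit_point ` Lbl))" unfolding B_def by (rule card_insert_le_m1) auto
  then have "card B \<le> card Lbl + 1" using card_image_le[OF finite_labels, of unit_point] by simp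
  moreover have "finite B" by (simp add: B_def)
  ultimately show ?thesis unfolding covered_def by (intro exI[of _ 0] exI[of _ B]) auto
qed

lemma paid_unit:
  assumes "seg i j k"
  shows "paid (x + unit_point (Flow i j k)) j' = paid x j' + (if j' = j then 1 else 0)"
    "q (x + unit_point l) j' = q x j' - (if l = Bad j' then 1 else 0)"
proof -
  have "paid (x + unit_point (Flow i j k)) j' =
      paid x j' + (\<Sum>i'<n. \<Sum>k'<pieces I i' j'. if Flow i' j' k' = Flow i j k then 1 else 0)"
    by (simp add: sum.distrib)
  also have "(\<Sum>i'<n. \<Sum>k'<pieces I i' j'. if Flow i' j' k' = Flow i j k then 1 else (0::real)) =
      (\<Sum>i'<n. if i' = i then if j' = j then 1 else 0 else 0)"
  proof (intro sum.cong refl)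
    fix i' assume "i' \<in> {..<n}"
    have "(\<Sum>k'<pieces I i' j'. if Flow i' j' k' = Flow i j k then 1 else (0::real)) =
        (\<Sum>k'<pieces I i' j'. if k' = k then if i' = i \<and> j' = j then 1 else 0 else 0)"
      by (intro sum.cong) auto
    also have "\<dots> = (if i' = i then if j' = j then 1 else 0 else 0)" using assms by auto
    finally show "(\<Sum>k'<pieces I i' j'. if Flow i' j' k' = Flow i j k then 1 else (0::real)) =
        (if i' = i then if j' = j then 1 else 0 else 0)" .
  qed
  also have "\<dots> = (if j' = j then 1 else 0)" using assms by simp
  finally show "paid (x + unit_point (Flow i j k)) j' = paid x j' + (if j' = j then 1 else 0)" .
qed auto

lemma covered_S0:
  assumes "T \<in> Ts"
  shows "covered (dim0 T) (S0 T)" "card {l. Nonneg l \<in> T} + card {j. Ineq (Bad j) \<in> T} +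
     (if agents_of T = {..<n} then 1 else 0) \<le> card Lbl + 1"
proof -
  obtain x0 where x0: "x0 \<in> S0 T" using assms by (auto simp: Ts_def)
  have T: "T \<subseteq> cons" using assms by (simp add: Ts_def)
  define Q1 where "Q1 = {l. Nonneg l \<in> T}"
  define Q2 where "Q2 = {j. Ineq (Bad j) \<in> T}"
  have Q1: "Q1 \<subseteq> Lbl" using T by (auto simp: Q1_def mem_cons dest: subsetD)
  have Q2: "Q2 \<subseteq> {..<m}" using T by (auto simp: Q2_def mem_cons dest: subsetD)
  have fin: "finite Q1" "finite Q2" using finite_subset[OF Q1] finite_subset[OF Q2] by auto
  define S1 where "S1 = {x. supp x \<and> (\<forall>l\<in>Q1. var x l = 0)}"
  define S2 where "S2 = {x \<in> S1. \<forall>j\<in>Q2. q x j - paid x j = 0}"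
  have "\<exists>d'. d' + card Q1 = card Lbl + 1 \<and> covered d' {x \<in> {x. supp x}. \<forall>l\<in>Q1. var x l = 0}"
    using Q1 x0 by (intro covered_cut_set[OF fin(1) covered_supp, where u = unit_point and ?x0.0 = x0])
      (auto simp: S0_def Q1_def supp_unit_point intro!: affine_intros)
  then obtain d1 where d1: "d1 + card Q1 = card Lbl + 1" "covered d1 S1" by (auto simp: S1_def)
  have "\<forall>j\<in>Q2. \<exists>i k. seg i j k \<and> Nonneg (Flow i j k) \<notin> T" using assms by (auto simp: Ts_def Q2_def)
  then obtain \<phi> \<psi> where \<phi>: "\<And>j. j \<in> Q2 \<Longrightarrow> seg (\<phi> j) j (\<psi> j) \<and> Nonneg (Flow (\<phi> j) j (\<psi> j)) \<notin> T" by metis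
  \<comment> \<open>Raising one free flow of bad \<open>j\<close> changes what is paid for
    \<open>j\<close> and nothing else in these equations.\<close>
  have "\<exists>d'. d' + card Q2 = d1 \<and> covered d' {x \<in> S1. \<forall>j\<in>Q2. q x j - paid x j = 0}"
  proof (rule covered_cut_set[OF fin(2) d1(2), where u = "\<lambda>j. unit_point (Flow (\<phi> j) j (\<psi> j))" and ?x0.0 = x0])
    show "x0 \<in> S1" using x0 by (auto simp: S0_def S1_def Q1_def)
    show "affine_map (\<lambda>x. q x j - paid x j) \<and> q x0 j - paid x0 j = 0" if "j \<in> Q2" for j
      using x0 that by (auto simp: S0_def Q2_def intro!: affine_intros)
    fix j assume j: "j \<in> Q2"
    have "x0 + unit_point (Flow (\<phi> j) j (\<psi> j)) \<in> S1"
      using x0 \<phi>[OF j] by (auto simp: S0_def S1_def Q1_def supp_unit_point)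
    moreover have "q x0 j' - paid x0 j' = 0" if "j' \<in> Q2" for j' using x0 that by (auto simp: S0_def Q2_def)
    ultimately show "x0 + unit_point (Flow (\<phi> j) j (\<psi> j)) \<in> S1 \<and>
        q (x0 + unit_point (Flow (\<phi> j) j (\<psi> j))) j - paid (x0 + unit_point (Flow (\<phi> j) j (\<psi> j))) j \<noteq> 0 \<and>
        (\<forall>k'\<in>Q2 - {j}. q (x0 + unit_point (Flow (\<phi> j) j (\<psi> j))) k' - paid (x0 + unit_point (Flow (\<phi> j) j (\<psi> j))) k' = 0)"
      using j \<phi>[OF j] unfolding paid_unit[OF conjunct1[OF \<phi>[OF j]]] by auto
  qed
  then obtain d2 where d2: "d2 + card Q2 = d1" "covered d2 S2" by (auto simp: S2_def)
  have "covered (dim0 T) (S0 T) \<and> card {l. Nonneg l \<in> T} + card {j. Ineq (Bad j) \<in> T} +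
     (if agents_of T = {..<n} then 1 else 0) \<le> card Lbl + 1"
  proof (cases "agents_of T = {..<n}")
    case False
    then have S0: "S0 T = S2" by (auto simp: S0_def S1_def S2_def Q1_def Q2_def)
    have "dim0 T = d2"
      unfolding dim0_def Q1_def[symmetric] Q2_def[symmetric] using False d1(1) d2(1) by simp
    then show ?thesis
      using S0 d2 d1(1) False unfolding Q1_def[symmetric] Q2_def[symmetric] by simp
  next
    case True
    define F where "F x = (\<Sum>i<n. earn x i + zval x) - (\<Sum>j<m. q x j)" for x
    \<comment> \<open>Raising \<open>z\<close> alone violates only the summed budget equation, in
      which \<open>z\<close> has coefficient \<open>n\<close>.\<close>
    have "\<exists>d'. d2 = Suc d' \<and> covered d' (S2 \<inter> {x. F x = 0})"
    proof (rule covered_cut_affine[OF d2(2), where s = "x0 + (0, 1)" and ?x0.0 = x0])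
      show "affine_map F" unfolding F_def by (intro affine_intros)
      show "x0 \<in> S2" "F x0 = 0" using x0 True by (auto simp: S0_def S1_def S2_def Q1_def Q2_def F_def)
      show "x0 + (0, 1) \<in> S2" using x0 by (auto simp: S0_def S1_def S2_def Q1_def Q2_def)
      have "F (x0 + (0, 1)) = F x0 + real n" by (simp add: F_def sum.distrib algebra_simps)
      then show "F (x0 + (0, 1)) \<noteq> 0" using \<open>F x0 = 0\<close> n_pos by simp
    qed
    then obtain d3 where d3: "d2 = Suc d3" "covered d3 (S2 \<inter> {x. F x = 0})" by blast
    have S0: "S0 T = S2 \<inter> {x. F x = 0}" using True by (auto simp: S0_def S1_def S2_def Q1_def Q2_def F_def)
    have "dim0 T = d3"
      unfolding dim0_def Q1_def[symmetric] Q2_def[symmetric] using True d1(1) d2(1) d3(1) by simp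
    then show ?thesis
      using S0 d3 d2(1) d1(1) True unfolding Q1_def[symmetric] Q2_def[symmetric] by simp
  qed
  then show "covered (dim0 T) (S0 T)" "card {l. Nonneg l \<in> T} + card {j. Ineq (Bad j) \<in> T} +
     (if agents_of T = {..<n} then 1 else 0) \<le> card Lbl + 1" by auto
qed

end

lemma finite_affine_root:
  fixes a b :: real
  assumes "a \<noteq> 0" "\<And>t. f t = a * t + b"
  shows "finite {t. f t = 0}"
proof -
  have "{t. f t = 0} \<subseteq> {- b / a}"
  proof
    fix t assume "t \<in> {t. f t = 0}"
    then have "a * t = - b" using assms(2)[of t] by simp
    then show "t \<in> {- b / a}" using assms(1) by (simp add: field_simps)
  qed
  then show ?thesis by (rule finite_subset) simp
qed

context bads_lcp
begin

text \<open>A private parameter enters its constraint with coefficient \<open>\<rho>\<close> for a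
  slope, \<open>q\<close> for a length, and plus or minus \<open>q x 0\<close> for an endowment; on
  this set no coefficient vanishes.\<close>

definition interior_points :: "point set" where
  "interior_points = {x. (\<forall>j<m. 0 < q x j) \<and> (\<forall>i<n. 0 < \<rho> x i)}"

lemma affine_gc: "affine_map (gc T c \<theta>)"
proof (cases c)
  case (PSteep i j k)
  have "affine_map (\<lambda>x. \<theta> c * \<rho> x i - q x j + su x i j k)" by (intro affine_intros)
  then show ?thesis by (simp add: gc_def[abs_def] PSteep)
next
  case (PLen i j k)
  have "affine_map (\<lambda>x. \<theta> c * q x j - fl x i j k)" by (intro affine_intros)
  then show ?thesis by (simp add: gc_def[abs_def] PLen)
next
  case (PEndow i)
  have "affine_map (\<lambda>x. earn x i + zval x - \<theta> c * q x 0 - (\<Sum>j\<in>{..<m} - {0}. W i j * q x j))"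
    by (intro affine_intros)
  moreover have "affine_map (\<lambda>x. (\<Sum>i'\<in>agents_of T. earn x i' + zval x)
          - (1 - (\<Sum>i'\<in>{..<n} - agents_of T. \<theta> (PEndow i'))) * q x 0
          - (\<Sum>j\<in>{..<m} - {0}. (\<Sum>i'\<in>agents_of T. W i' j) * q x j))"
    by (intro affine_intros)
  ultimately show ?thesis by (cases "i \<in> agents_of T") (simp_all add: gc_def[abs_def] PEndow)
qed

lemma agents_of_subset: "agents_of T \<subseteq> {..<n}" by (auto simp: agents_of_def)

lemma act_PEndow:
  assumes "PEndow i \<in> act T"
  shows "i < n - 1" "i \<notin> agents_of T \<Longrightarrow> i \<in> {..<n} - agents_of T \<and> (\<forall>i'\<in>{..<n} - agents_of T. i' \<le> i)"
proof -
  let ?C = "{..<n} - agents_of T"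
  have Max: "Max ?C \<in> ?C" "\<forall>i'\<in>?C. i' \<le> Max ?C" if "agents_of T \<noteq> {..<n}"
  proof -
    have "?C \<noteq> {}" using that agents_of_subset[of T] by blast
    then show "Max ?C \<in> ?C" "\<forall>i'\<in>?C. i' \<le> Max ?C" using Max_in[of ?C] Max_ge[of ?C] by blast+
  qed
  have cases: "i \<in> agents_of T - {n - 1} \<or> (n - 1 \<in> agents_of T \<and> agents_of T \<noteq> {..<n} \<and> i = Max ?C)"
    using assms by (auto simp: act_def split: if_splits)
  then show "i < n - 1"
  proof
    assume "i \<in> agents_of T - {n - 1}"
    then show ?thesis using agents_of_subset[of T] by force
  next
    assume *: "n - 1 \<in> agents_of T \<and> agents_of T \<noteq> {..<n} \<and> i = Max ?C"
    then have "i \<in> ?C" using Max by blast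
    moreover have "i \<noteq> n - 1" using * calculation by auto
    ultimately show ?thesis by auto
  qed
  assume "i \<notin> agents_of T"
  then show "i \<in> ?C \<and> (\<forall>i'\<in>?C. i' \<le> i)" using cases Max by blast
qed

lemma finite_gc:
  assumes T: "T \<in> Ts" and c: "c \<in> act T" and x: "x \<in> interior_points"
  shows "finite {t. gc T c (\<theta>(c := t)) x = 0}"
proof (cases c)
  case (PSteep i j k)
  then have "Ineq (Flow i j k) \<in> T" using c by (auto simp: act_def split: if_splits)
  then have "seg i j k" using T by (auto simp: Ts_def mem_cons dest: subsetD)
  then have "0 < \<rho> x i" using x by (simp add: interior_points_def)
  then show ?thesis
    by (intro finite_affine_root[of "\<rho> x i" _ "su x i j k - q x j"]) (auto simp: gc_def PSteep algebra_simps)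
next
  case (PLen i j k)
  then have "Ineq (Surplus i j k) \<in> T" using c by (auto simp: act_def split: if_splits)
  then have "seg i j k" using T by (auto simp: Ts_def mem_cons dest: subsetD)
  then have "0 < q x j" using x by (simp add: interior_points_def)
  then show ?thesis
    by (intro finite_affine_root[of "q x j" _ "- fl x i j k"]) (auto simp: gc_def PLen algebra_simps)
next
  case (PEndow i)
  have q0: "0 < q x 0" using x m_pos by (simp add: interior_points_def)
  show ?thesis
  proof (cases "i \<in> agents_of T")
    case True
    show ?thesis
    proof (rule finite_affine_root)
      show "- q x 0 \<noteq> 0" using q0 by simp
      show "gc T c (\<theta>(c := t)) x = (- q x 0) * t +
          (earn x i + zval x - (\<Sum>j\<in>{..<m} - {0}. W i j * q x j))" for t
        using True by (simp add: gc_def PEndow algebra_simps)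
    qed
  next
    case False
    then have i: "i \<in> {..<n} - agents_of T" using act_PEndow(2) c PEndow by blast
    have s: "(\<Sum>i'\<in>{..<n} - agents_of T. (\<theta>(c := t)) (PEndow i')) =
        t + (\<Sum>i'\<in>{..<n} - agents_of T - {i}. \<theta> (PEndow i'))" for t
    proof -
      have "(\<Sum>i'\<in>{..<n} - agents_of T. (\<theta>(c := t)) (PEndow i')) =
        (\<theta>(c := t)) (PEndow i) + (\<Sum>i'\<in>{..<n} - agents_of T - {i}. (\<theta>(c := t)) (PEndow i'))"
        using i by (intro sum.remove) auto
      also have "(\<Sum>i'\<in>{..<n} - agents_of T - {i}. (\<theta>(c := t)) (PEndow i')) =
        (\<Sum>i'\<in>{..<n} - agents_of T - {i}. \<theta> (PEndow i'))"
        by (intro sum.cong) (auto simp: PEndow)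
      finally show ?thesis by (simp add: PEndow)
    qed
    show ?thesis
    proof (rule finite_affine_root)
      show "q x 0 \<noteq> 0" using q0 by simp
      show "gc T c (\<theta>(c := t)) x = q x 0 * t + ((\<Sum>i'\<in>agents_of T. earn x i' + zval x)
          - (1 - (\<Sum>i'\<in>{..<n} - agents_of T - {i}. \<theta> (PEndow i'))) * q x 0
          - (\<Sum>j\<in>{..<m} - {0}. (\<Sum>i'\<in>agents_of T. W i' j) * q x j))" for t
        unfolding gc_def PEndow param.case if_not_P[OF False] s[unfolded PEndow]
        by (simp add: algebra_simps)
    qed
  qed
qed

text \<open>The aggregated budget equation depends on all endowments outside
  \<open>agents_of T\<close>; its own parameter belongs to the largest such agent, so later
  endowments do not occur in it.\<close>

lemma gc_later:
  assumes "c \<in> act T" "c \<noteq> c'" "\<And>i i'. c = PEndow i \<Longrightarrow> c' = PEndow i' \<Longrightarrow> i < i'"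
  shows "gc T c (\<theta>(c' := t)) = gc T c \<theta>"
proof (cases c)
  case (PEndow i)
  show ?thesis
  proof (cases "i \<in> agents_of T")
    case True
    then show ?thesis using assms(2) by (auto simp: gc_def PEndow)
  next
    case False
    have "(\<theta>(c' := t)) (PEndow i') = \<theta> (PEndow i')" if "i' \<in> {..<n} - agents_of T" for i'
    proof -
      have "i' \<le> i" using act_PEndow(2)[of i T] assms(1) that False PEndow by blast
      then have "c' \<noteq> PEndow i'" using assms(3)[OF PEndow] by fastforce
      then show ?thesis by simp
    qed
    then have "(\<Sum>i'\<in>{..<n} - agents_of T. (\<theta>(c' := t)) (PEndow i')) =
        (\<Sum>i'\<in>{..<n} - agents_of T. \<theta> (PEndow i'))"
      by (intro sum.cong) auto
    then show ?thesis unfolding gc_def PEndow param.case if_not_P[OF False] by presburger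
  qed
qed (use assms(2) in \<open>auto simp: gc_def\<close>)

definition params :: "param set" where
  "params = (\<lambda>(i, j, k). PSteep i j k) ` segments I \<union> (\<lambda>(i, j, k). PLen i j k) ` segments I \<union> PEndow ` {..<n - 1}"

lemma act_params: assumes "T \<in> Ts" shows "act T \<subseteq> params"
proof
  fix c assume c: "c \<in> act T"
  have T: "d \<in> T \<Longrightarrow> label_of d \<in> Lbl" for d using assms by (auto simp: Ts_def mem_cons dest: subsetD)
  show "c \<in> params"
  proof (cases c)
    case (PSteep i j k)
    then have "seg i j k" using c T[of "Ineq (Flow i j k)"] by (auto simp: act_def split: if_splits)
    then show ?thesis by (force simp: params_def segments_def PSteep)
  next
    case (PLen i j k)
    then have "seg i j k" using c T[of "Ineq (Surplus i j k)"] by (auto simp: act_def split: if_splits)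
    then show ?thesis by (force simp: params_def segments_def PLen)
  next
    case (PEndow i)
    then show ?thesis using act_PEndow(1)[of i T] c by (simp add: params_def)
  qed
qed

lemma finite_Ts: "finite Ts"
  by (rule finite_subset[of _ "Pow cons"]) (auto simp: Ts_def)

lemma finite_params: "finite params"
  by (simp add: params_def finite_segments)

lemma generic_theta:
  assumes "\<delta> > 0"
  obtains \<theta> where "\<And>c. c \<in> params \<Longrightarrow> \<theta>0 c < \<theta> c \<and> \<theta> c < \<theta>0 c + \<delta>" "\<And>c. c \<notin> params \<Longrightarrow> \<theta> c = \<theta>0 c"
    "\<And>T x. T \<in> Ts \<Longrightarrow> x \<in> S0 T \<Longrightarrow> x \<in> interior_points \<Longrightarrow> (\<And>c. c \<in> act T \<Longrightarrow> gc T c \<theta> x = 0) \<Longrightarrow>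
       card (act T) \<le> dim0 T"
proof -
  obtain as where as: "set as = (\<lambda>(i, j, k). PSteep i j k) ` segments I \<union> (\<lambda>(i, j, k). PLen i j k) ` segments I" "distinct as"
    using finite_distinct_list[of "(\<lambda>(i, j, k). PSteep i j k) ` segments I \<union> (\<lambda>(i, j, k). PLen i j k) ` segments I"]
      finite_segments by auto
  \<comment> \<open>Endowments are listed by increasing agent, so the parameter owned by an
    aggregated equation comes after all other endowments in it.\<close>
  define ps where "ps = as @ map PEndow [0..<n - 1]"
  have set_ps: "set ps = params" by (simp add: ps_def as params_def atLeast0LessThan)
  have dist: "distinct ps" using as by (auto simp: ps_def distinct_map inj_on_def)
  have no: "PEndow i \<notin> set as" for i using as by auto
  have "sorted_wrt (\<lambda>c c'. c \<noteq> c' \<and> (\<forall>i i'. c = PEndow i \<longrightarrow> c' = PEndow i' \<longrightarrow> i < i')) ps"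
    unfolding ps_def sorted_wrt_append sorted_wrt_map
  proof (intro conjI)
    show "sorted_wrt (\<lambda>c c'. c \<noteq> c' \<and> (\<forall>i i'. c = PEndow i \<longrightarrow> c' = PEndow i' \<longrightarrow> i < i')) as"
      unfolding sorted_wrt_iff_nth_less using as(2) no nth_mem
      by (metis distinct_conv_nth less_irrefl order.strict_trans)
    show "sorted_wrt (\<lambda>x y. PEndow x \<noteq> PEndow y \<and> (\<forall>i i'. PEndow x = PEndow i \<longrightarrow> PEndow y = PEndow i' \<longrightarrow> i < i')) [0..<n - 1]"
      by (rule sorted_wrt_mono_rel[OF _ sorted_wrt_upt]) auto
    show "\<forall>x\<in>set as. \<forall>y\<in>set (map PEndow [0..<n - 1]). x \<noteq> y \<and> (\<forall>i i'. x = PEndow i \<longrightarrow> y = PEndow i' \<longrightarrow> i < i')"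
      using no by auto
  qed
  then have later: "sorted_wrt (\<lambda>c c'. \<forall>T\<in>Ts. c \<in> act T \<longrightarrow> (\<forall>\<theta> t. gc T c (\<theta>(c' := t)) = gc T c \<theta>)) ps"
    by (rule sorted_wrt_mono_rel[rotated]) (auto intro!: gc_later)
  obtain \<theta> where \<theta>: "\<forall>c\<in>set ps. \<theta>0 c < \<theta> c \<and> \<theta> c < \<theta>0 c + \<delta>" "\<forall>c. c \<notin> set ps \<longrightarrow> \<theta> c = \<theta>0 c"
    "\<forall>T\<in>Ts. {x \<in> S0 T. \<forall>c\<in>act T \<inter> set ps. gc T c \<theta> x = 0} \<inter> interior_points \<noteq> {} \<longrightarrow>
       (\<exists>d'. d' + card (act T \<inter> set ps) = dim0 T \<and>
          covered d' {x \<in> S0 T. \<forall>c\<in>act T \<inter> set ps. gc T c \<theta> x = 0})"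
    using generic_parameters[OF finite_Ts dist assms later, of interior_points dim0 S0 \<theta>0]
      finite_gc covered_S0(1) affine_gc unfolding affine_map_def by blast
  show thesis
  proof (rule that[of \<theta>])
    fix T x assume T: "T \<in> Ts" and x: "x \<in> S0 T" "x \<in> interior_points" "\<And>c. c \<in> act T \<Longrightarrow> gc T c \<theta> x = 0"
    have eq: "act T \<inter> set ps = act T" using act_params[OF T] set_ps by auto
    have "\<exists>d'. d' + card (act T \<inter> set ps) = dim0 T" using \<theta>(3) T x by blast
    then show "card (act T) \<le> dim0 T" unfolding eq by auto
  qed (use \<theta> set_ps in auto)
qed

text \<open>The tight constraints split into those of \<open>S0\<close> and those with private
  parameters. The former are independent, so they lower the dimension to \<open>dim0 T\<close>, and
  by genericity the latter number at most \<open>dim0 T\<close>.\<close>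

lemma card_tight_le:
  assumes J: "bads_lcp (pert \<theta>) P R \<epsilon>" and x: "lcp_solution (pert \<theta>) P R \<epsilon> x" and pos: "\<And>j. j < m \<Longrightarrow> 0 < q x j"
    and gen: "\<And>T x. T \<in> Ts \<Longrightarrow> x \<in> S0 T \<Longrightarrow> x \<in> interior_points \<Longrightarrow>
      (\<And>c. c \<in> act T \<Longrightarrow> gc T c \<theta> x = 0) \<Longrightarrow> card (act T) \<le> dim0 T"
  shows "card (tight (pert \<theta>) P R \<epsilon> x) \<le> card Lbl + 1"
proof -
  interpret J: bads_lcp "pert \<theta>" P R \<epsilon> by (rule J)
  define T where "T = tight (pert \<theta>) P R \<epsilon> x"
  have cons_eq: "J.cons = cons" unfolding set_eq_iff J.mem_cons mem_cons by simp
  have Tc: "T \<subseteq> cons" unfolding T_def cons_eq[symmetric] using J.tight_iff by blast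
  have tN: "Nonneg l \<in> T \<longleftrightarrow> l \<in> Lbl \<and> var x l = 0" for l
    unfolding T_def J.tight_iff J.mem_cons by simp
  have tA: "Ineq (Agent i) \<in> T \<longleftrightarrow> i < n \<and> earn x i + zval x - (\<Sum>j<m. Wp \<theta> i j * q x j) = 0" for i
    unfolding T_def J.tight_iff J.mem_cons J.cval_market by simp
  have tB: "Ineq (Bad j) \<in> T \<longleftrightarrow> j < m \<and> q x j - paid x j = 0" for j
    unfolding T_def J.tight_iff J.mem_cons J.cval_market by simp
  have tF: "Ineq (Flow i j k) \<in> T \<longleftrightarrow> seg i j k \<and> \<theta> (PSteep i j k) * \<rho> x i - q x j + su x i j k = 0" for i j k
    unfolding T_def J.tight_iff J.mem_cons J.cval_market by simp
  have tS: "Ineq (Surplus i j k) \<in> T \<longleftrightarrow> seg i j k \<and> len (pert \<theta>) \<epsilon> i j k * q x j - fl x i j k = 0" for i j k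
    unfolding T_def J.tight_iff J.mem_cons J.cval_market by simp
  have xf: "x \<in> J.feas" by (rule J.lcp_feas[OF x])
  have int: "x \<in> interior_points"
    using pos J.rho_pos[OF x _ pos[OF m_pos]] m_pos by (simp add: interior_points_def)
  define A where "A = agents_of T"
  have A: "i \<in> A \<longleftrightarrow> i < n \<and> earn x i + zval x - (\<Sum>j<m. Wp \<theta> i j * q x j) = 0" for i
    by (auto simp: A_def agents_of_def tA)
  have An: "A \<subseteq> {..<n}" by (auto simp: A)
  have split0: "(\<Sum>j<m. F j) = F 0 + (\<Sum>j\<in>{..<m} - {0}. F j)" for F :: "nat \<Rightarrow> real"
    using m_pos by (intro sum.remove) auto
  have sumA: "(\<Sum>i\<in>B. earn x i + zval x) = (\<Sum>j<m. (\<Sum>i\<in>B. Wp \<theta> i j) * q x j)" if "B \<subseteq> A" for B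
  proof -
    have "(\<Sum>i\<in>B. earn x i + zval x) = (\<Sum>i\<in>B. \<Sum>j<m. Wp \<theta> i j * q x j)"
      using that A by (intro sum.cong) auto
    also have "\<dots> = (\<Sum>j<m. (\<Sum>i\<in>B. Wp \<theta> i j) * q x j)"
      by (subst sum.swap) (simp add: sum_distrib_right)
    finally show ?thesis .
  qed
  have S0: "x \<in> S0 T"
    unfolding S0_def
  proof (intro CollectI conjI allI impI)
    show "supp x" using J.feas_supp[OF xf] unfolding J.supp_def supp_def by simp
    show "(\<Sum>i<n. earn x i + zval x) - (\<Sum>j<m. q x j) = 0" if "agents_of T = {..<n}"
      using sumA[of "{..<n}"] that by (simp add: A_def Wp_sum)
  qed (use tN tB in auto)
  have Ts: "T \<in> Ts"
    unfolding Ts_def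
  proof (intro CollectI conjI allI impI)
    fix j assume "Ineq (Bad j) \<in> T"
    then have j: "j < m" "paid x j = q x j" using tB by auto
    then have "0 < paid x j" using pos by simp
    then obtain i k where "i < n" "k < pieces I i j" "fl x i j k \<noteq> 0"
      by (metis (mono_tags, lifting) less_irrefl lessThan_iff sum.neutral)
    then show "\<exists>i k. seg i j k \<and> Nonneg (Flow i j k) \<notin> T" using j tN by blast
  qed (use Tc S0 in auto)
  have gz: "gc T c \<theta> x = 0" if c: "c \<in> act T" for c
  proof (cases c)
    case (PSteep i j k)
    then have "Ineq (Flow i j k) \<in> T" using c by (auto simp: act_def split: if_splits)
    then show ?thesis using tF by (simp add: gc_def PSteep)
  next
    case (PLen i j k)
    then have "Ineq (Surplus i j k) \<in> T" "Suc k < pieces I i j" using c by (auto simp: act_def split: if_splits)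
    then show ?thesis using tS by (simp add: gc_def PLen pert_len)
  next
    case (PEndow i)
    have i: "i < n - 1" using act_PEndow(1) c PEndow by blast
    show ?thesis
    proof (cases "i \<in> A")
      case True
      have "(\<Sum>j<m. Wp \<theta> i j * q x j) = \<theta> (PEndow i) * q x 0 + (\<Sum>j\<in>{..<m} - {0}. W i j * q x j)"
        unfolding split0 using i by (auto simp: Wp_def intro!: sum.cong)
      then show ?thesis using True A[of i] by (simp add: gc_def PEndow A_def)
    next
      case False
      have n1: "n - 1 \<in> A" using c False by (auto simp: act_def PEndow A_def split: if_splits)
      \<comment> \<open>Here \<open>i\<close> stands in for the last agent, whose endowment is not
        free. Unit supply expresses the aggregate endowment of \<open>A\<close> by the endowments
        outside \<open>A\<close>, and these are free since \<open>A\<close> contains the last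
        agent.\<close>
      have "(\<Sum>i'\<in>A. Wp \<theta> i' 0) = (\<Sum>i'<n. Wp \<theta> i' 0) - (\<Sum>i'\<in>{..<n} - A. Wp \<theta> i' 0)"
        using An by (simp add: sum_diff)
      also have "(\<Sum>i'\<in>{..<n} - A. Wp \<theta> i' 0) = (\<Sum>i'\<in>{..<n} - A. \<theta> (PEndow i'))"
      proof (intro sum.cong refl)
        fix i' assume i': "i' \<in> {..<n} - A"
        then have "i' \<noteq> n - 1" using n1 by auto
        then have "Suc i' < n" using i' by auto
        then show "Wp \<theta> i' 0 = \<theta> (PEndow i')" by (simp add: Wp_def)
      qed
      also have "(\<Sum>i'<n. Wp \<theta> i' 0) = 1" by (rule Wp_sum[OF m_pos])
      finally have W0: "(\<Sum>i'\<in>A. Wp \<theta> i' 0) = 1 - (\<Sum>i'\<in>{..<n} - A. \<theta> (PEndow i'))" .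
      have "(\<Sum>j\<in>{..<m} - {0}. (\<Sum>i'\<in>A. Wp \<theta> i' j) * q x j) = (\<Sum>j\<in>{..<m} - {0}. (\<Sum>i'\<in>A. W i' j) * q x j)"
        by (intro sum.cong) (auto simp: Wp_def)
      then have "(\<Sum>i'\<in>A. earn x i' + zval x) = (1 - (\<Sum>i'\<in>{..<n} - A. \<theta> (PEndow i'))) * q x 0
          + (\<Sum>j\<in>{..<m} - {0}. (\<Sum>i'\<in>A. W i' j) * q x j)"
        using sumA[of A] unfolding split0[of "\<lambda>j. (\<Sum>i\<in>A. Wp \<theta> i j) * q x j"] W0 by simp
      then show ?thesis
        using False unfolding gc_def PEndow param.case A_def[symmetric] by simp
    qed
  qed
  have le: "card (act T) \<le> dim0 T" by (rule gen[OF Ts S0 int gz])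
  define Q1 Q2 where "Q1 = {l. Nonneg l \<in> T}" and "Q2 = {j. Ineq (Bad j) \<in> T}"
  define E1 where "E1 = {PSteep i j k | i j k. Ineq (Flow i j k) \<in> T} \<union>
     {PLen i j k | i j k. Ineq (Surplus i j k) \<in> T \<and> Suc k < pieces I i j}"
  define E2 where "E2 = PEndow ` (A - {n - 1}) \<union> (if n - 1 \<in> A \<and> A \<noteq> {..<n} then {PEndow (Max ({..<n} - A))} else {})"
  have act: "act T = E1 \<union> E2" by (simp add: act_def E1_def E2_def A_def Un_assoc)
  have "finite (act T)" using act_params[OF Ts] finite_params finite_subset by blast
  then have fE: "finite E1" "finite E2" using act by auto
  have fA: "finite A" using An finite_subset by blast
  have "E1 \<inter> E2 = {}" by (auto simp: E1_def E2_def split: if_splits)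
  then have card_act: "card (act T) = card E1 + card E2" unfolding act using fE by (intro card_Un_disjoint)
  \<comment> \<open>Each tight budget has its own endowment parameter, the last agent's being the
    substitute, except for one budget when all are tight.\<close>
  have card_E2: "card A \<le> card E2 + (if A = {..<n} then 1 else 0)"
  proof -
    have c1: "card (PEndow ` (A - {n - 1})) = card (A - {n - 1})" by (intro card_image) (simp add: inj_on_def)
    show ?thesis
    proof (cases "n - 1 \<in> A")
      case True
      then have cA: "card A = Suc (card (A - {n - 1}))" using fA by (metis card_Suc_Diff1)
      show ?thesis
      proof (cases "A = {..<n}")
        case True
        then show ?thesis using cA c1 by (simp add: E2_def)
      next
        case False
        have "PEndow (Max ({..<n} - A)) \<notin> PEndow ` (A - {n - 1})"
          using Max_in[of "{..<n} - A"] False An by auto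
        then have "card E2 = Suc (card (A - {n - 1}))"
          using False True fA c1 by (simp add: E2_def)
        then show ?thesis using cA by simp
      qed
    next
      case False
      then have "A \<noteq> {..<n}" using n_pos by auto
      then show ?thesis using False c1 by (simp add: E2_def)
    qed
  qed
  define h where "h c = (case c of PSteep i j k \<Rightarrow> Ineq (Flow i j k) | PLen i j k \<Rightarrow> Ineq (Surplus i j k)
    | PEndow i \<Rightarrow> Ineq (Agent i))" for c
  have fQ: "finite Q1" "finite Q2"
    using finite_subset[of Q1 Lbl] finite_subset[of Q2 "{..<m}"] by (auto simp: Q1_def Q2_def tN tB)
  have "T \<subseteq> Nonneg ` Q1 \<union> (\<lambda>j. Ineq (Bad j)) ` Q2 \<union> (\<lambda>i. Ineq (Agent i)) ` A \<union> h ` E1"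
  proof
    fix c assume c: "c \<in> T"
    show "c \<in> Nonneg ` Q1 \<union> (\<lambda>j. Ineq (Bad j)) ` Q2 \<union> (\<lambda>i. Ineq (Agent i)) ` A \<union> h ` E1"
    proof (cases c)
      case (Nonneg l)
      then show ?thesis using c by (auto simp: Q1_def)
    next
      case (Ineq l)
      show ?thesis
      proof (cases l)
        case (Agent i)
        then show ?thesis using c Ineq tA A by auto
      next
        case (Bad j)
        then show ?thesis using c Ineq by (auto simp: Q2_def)
      next
        case (Flow i j k)
        then have "c = h (PSteep i j k)" "PSteep i j k \<in> E1" using c Ineq by (auto simp: E1_def h_def)
        then show ?thesis by blast
      next
        \<comment> \<open>For a last segment the flow would have to be \<open>1 + \<epsilon>\<close>
          times the price, more than is paid for the whole bad; so only segments with a length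
          parameter remain.\<close>
        case (Surplus i j k)
        then have s: "seg i j k" "len (pert \<theta>) \<epsilon> i j k * q x j = fl x i j k" using c Ineq tS by auto
        have "fl x i j k \<le> q x j" using J.flow_le_q[OF xf] s(1) by simp
        moreover have "0 < \<epsilon> * q x j" using pos[of j] s(1) eps_pos by simp
        moreover have "fl x i j k = q x j + \<epsilon> * q x j" if "Suc k = pieces I i j"
          using s(2) that by (simp add: pert_len algebra_simps)
        ultimately have "Suc k \<noteq> pieces I i j" by force
        then have "c = h (PLen i j k)" "PLen i j k \<in> E1" using c Ineq Surplus s(1) by (auto simp: E1_def h_def)
        then show ?thesis by blast
      qed
    qed
  qed
  then have "card T \<le> card (Nonneg ` Q1 \<union> (\<lambda>j. Ineq (Bad j)) ` Q2 \<union> (\<lambda>i. Ineq (Agent i)) ` A \<union> h ` E1)"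
    using fQ fE fA by (intro card_mono) auto
  also have "\<dots> \<le> card Q1 + card Q2 + card A + card E1"
    using fQ fE fA by (intro order_trans[OF card_Un_le] add_mono card_image_le)
  finally have "card T \<le> card Q1 + card Q2 + card A + card E1" .
  moreover have "card Q1 + card Q2 + (if A = {..<n} then 1 else 0) \<le> card Lbl + 1"
    using covered_S0(2)[OF Ts] by (simp add: Q1_def Q2_def A_def)
  moreover have "dim0 T = card Lbl + 1 - card Q1 - card Q2 - (if A = {..<n} then 1 else 0)"
    by (simp add: dim0_def Q1_def Q2_def A_def)
  ultimately have "card T \<le> card Lbl + 1" using le card_act card_E2 by linarith
  then show ?thesis by (simp add: T_def)
qed

section \<open>Small generic perturbations are instances\<close>

lemma pert_instance:
  assumes D: "\<And>i j k. seg i j k \<Longrightarrow> D i j k < \<theta> (PSteep i j k)"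
      "\<And>i j k. seg i j (Suc k) \<Longrightarrow> \<theta> (PSteep i j k) < D i j (Suc k)"
    and L: "\<And>i j k. seg i j k \<Longrightarrow> seglen I i j k < \<theta> (PLen i j k)"
    and W: "\<And>i. i < n \<Longrightarrow> 0 < Wp \<theta> i 0"
  shows "bads_lcp (pert \<theta>) P R \<epsilon>"
proof
  have plc': "plc_disutility (util (pert \<theta>) i j) (pieces I i j) (\<lambda>k. \<theta> (PSteep i j k)) (\<lambda>k. \<theta> (PLen i j k))"
    if ij: "i < n" "j < m" for i j
  proof -
    have "util (pert \<theta>) i j = plc_fun (pieces I i j) (\<lambda>k. \<theta> (PSteep i j k)) (\<lambda>k. \<theta> (PLen i j k))"
      by (simp add: pert_def)
    moreover have "0 < \<theta> (PSteep i j k)" if "k < pieces I i j" for k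
      using D(1)[of i j k] D_pos[of i j k] ij that by simp
    moreover have "\<theta> (PSteep i j k) < \<theta> (PSteep i j (Suc k)) \<and> 0 < \<theta> (PLen i j k)" if "Suc k < pieces I i j" for k
    proof -
      have "0 < seglen I i j k" using plc[OF ij] that by (simp add: plc_disutility_def)
      then show ?thesis
        using D(1)[of i j "Suc k"] D(2)[of i j k] L[of i j k] ij that by simp
    qed
    ultimately show ?thesis using pieces_pos[OF ij] by (auto intro: plc_disutility_plc_fun)
  qed
  have steep_eta: "steep (pert \<theta>) i j = (\<lambda>k. \<theta> (PSteep i j k))" "seglen (pert \<theta>) i j = (\<lambda>k. \<theta> (PLen i j k))" for i j
    by (simp_all add: fun_eq_iff)
  have W0: "0 \<le> Wp \<theta> i j" if "i < n" "j < m" for i j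
    using W[OF that(1)] W_nonneg[OF that] by (cases "j = 0") (auto simp: Wp_def)
  show "bads_instance (pert \<theta>)"
    unfolding bads_instance_def pert_simps steep_eta
    using n_pos m_pos W0 W Wp_sum plc' by blast
  let ?S = "(\<lambda>(i, j, k). steep (pert \<theta>) i j k) ` segments (pert \<theta>)"
  have seg_eq: "segments (pert \<theta>) = segments I" by (simp add: segments_def)
  have "(0, 0, 0) \<in> segments I" using n_pos m_pos pieces_pos by (simp add: segments_def)
  then have "Min ?S \<in> ?S" unfolding seg_eq using finite_segments by (intro Min_in) auto
  then obtain i j k where s: "seg i j k" "Min ?S = \<theta> (PSteep i j k)"
    unfolding seg_eq by (auto simp: segments_def)
  \<comment> \<open>Slopes are only moved upwards, so the given \<open>R\<close> still exceeds the
    quotient of \<open>P\<close> by the smallest slope.\<close>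
  have "P < D i j k * R" by (rule DR[OF s(1)])
  also have "\<dots> < \<theta> (PSteep i j k) * R" using D(1)[OF s(1)] R_pos by simp
  finally have "P / Min ?S < R"
    unfolding s(2) using D(1)[OF s(1)] D_pos[OF s(1)] by (simp add: field_simps)
  then show "lcp_constants (pert \<theta>) P R \<epsilon>"
    using P_pos eps_pos by (simp add: lcp_constants_def)
qed

lemma perturbation_exists:
  assumes "\<delta> > 0"
  shows "\<exists>I'. perturbation \<delta> I I' \<and> bads_lcp I' P R \<epsilon> \<and> nondegenerate I' P R \<epsilon> \<and> input_size I' = K"
proof -
  define \<eta> where "\<eta> = min (\<delta> / 4) (1 / 2)"
  have \<eta>: "0 < \<eta>" "\<eta> \<le> \<delta> / 4" "\<eta> \<le> 1 / 2" using assms by (auto simp: \<eta>_def)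
  \<comment> \<open>Endowments of bad \<open>0\<close> may be 0. Mixing them with the uniform
    distribution keeps their sum and makes each at least \<open>\<eta> / n\<close>, which leaves
    room for the last agent to absorb changes.\<close>
  define W1 where "W1 i = (1 - \<eta>) * W i 0 + \<eta> / n" for i
  have W_le: "W i 0 \<le> 1" if "i < n" for i
    using member_le_sum[of i "{..<n}" "\<lambda>i. W i 0"] W_sum[OF m_pos] W_nonneg[OF _ m_pos] that by auto
  have W1_ge: "\<eta> / n \<le> W1 i" if "i < n" for i
    using W_nonneg[OF that m_pos] \<eta> by (simp add: W1_def)
  have W1_close: "\<bar>W1 i - W i 0\<bar> \<le> \<delta> / 4" if "i < n" for i
  proof -
    have "W1 i - W i 0 = \<eta> * (1 / n - W i 0)" by (simp add: W1_def algebra_simps)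
    moreover have "0 \<le> 1 / real n" "1 / real n \<le> 1" using n_pos by auto
    then have "\<bar>1 / n - W i 0\<bar> \<le> 1"
      using W_le[OF that] W_nonneg[OF that m_pos] by linarith
    ultimately have "\<bar>W1 i - W i 0\<bar> \<le> \<eta> * 1" using \<eta>(1) by (simp add: abs_mult)
    then show ?thesis using \<eta> by simp
  qed
  have W1_sum: "(\<Sum>i<n. W1 i) = 1"
    using W_sum[OF m_pos] n_pos by (simp add: W1_def sum.distrib flip: sum_distrib_left)
  \<comment> \<open>Shifts smaller than every difference of consecutive slopes keep the slopes
    increasing.\<close>
  define gaps where "gaps = (\<lambda>(i, j, k). D i j k - D i j (k - 1)) ` {(i, j, k) \<in> segments I. 0 < k}"
  have "finite gaps"
    unfolding gaps_def by (intro finite_imageI finite_subset[OF _ finite_segments]) auto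
  moreover have "0 < a" if "a \<in> gaps" for a
    using that D_mono by (auto simp: gaps_def segments_def)
  \<comment> \<open>The factor \<open>n + 1\<close> allows for the last agent, which absorbs the
    shifts of all others at once; the two bounds keep it within \<open>\<delta> / 4\<close> of
    \<open>W1\<close> and positive.\<close>
  ultimately have "\<exists>t>0. \<forall>a\<in>insert (\<delta> / 4 / (n + 1)) (insert (\<eta> / n / (n + 1)) gaps). t * \<bar>1\<bar> \<le> a"
    using assms \<eta>(1) n_pos by (intro small_step) auto
  then obtain t where t: "t > 0" "t \<le> \<delta> / 4 / (n + 1)" "t \<le> \<eta> / n / (n + 1)" and gap: "\<And>a. a \<in> gaps \<Longrightarrow> t \<le> a"
    by auto
  have t1: "(n + 1) * t \<le> \<delta> / 4" "(n + 1) * t \<le> \<eta> / n"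
  proof -
    have "(n + 1) * t \<le> X" if "t \<le> X / (n + 1)" for X
      using that by (simp add: pos_le_divide_eq mult.commute)
    then show "(n + 1) * t \<le> \<delta> / 4" "(n + 1) * t \<le> \<eta> / n" using t(2,3) by blast+
  qed
  have t2: "t \<le> \<delta> / 4"
  proof -
    have "1 * t \<le> (n + 1) * t" using t(1) by (intro mult_right_mono) auto
    then show ?thesis using t1 by simp
  qed
  define \<theta>0 where "\<theta>0 c = (case c of PSteep i j k \<Rightarrow> D i j k | PLen i j k \<Rightarrow> seglen I i j k | PEndow i \<Rightarrow> W1 i)" for c
  obtain \<theta> where \<theta>: "\<And>c. c \<in> params \<Longrightarrow> \<theta>0 c < \<theta> c \<and> \<theta> c < \<theta>0 c + t"
    and "\<And>c. c \<notin> params \<Longrightarrow> \<theta> c = \<theta>0 c"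
    and gen: "\<And>T x. T \<in> Ts \<Longrightarrow> x \<in> S0 T \<Longrightarrow> x \<in> interior_points \<Longrightarrow> (\<And>c. c \<in> act T \<Longrightarrow> gc T c \<theta> x = 0) \<Longrightarrow>
       card (act T) \<le> dim0 T"
    by (rule generic_theta[OF t(1), of \<theta>0]) blast
  have steep: "D i j k < \<theta> (PSteep i j k) \<and> \<theta> (PSteep i j k) < D i j k + t" if "seg i j k" for i j k
    using \<theta>[of "PSteep i j k"] that by (force simp: params_def segments_def \<theta>0_def)
  have len: "seglen I i j k < \<theta> (PLen i j k) \<and> \<theta> (PLen i j k) < seglen I i j k + t" if "seg i j k" for i j k
    using \<theta>[of "PLen i j k"] that by (force simp: params_def segments_def \<theta>0_def)
  have endow: "W1 i < \<theta> (PEndow i) \<and> \<theta> (PEndow i) < W1 i + t" if "i < n - 1" for i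
    using \<theta>[of "PEndow i"] that by (simp add: params_def \<theta>0_def)
  have last: "W1 (n - 1) = 1 - (\<Sum>i<n - 1. W1 i)"
  proof -
    have "(\<Sum>i<n. W1 i) = (\<Sum>i<n - 1. W1 i) + W1 (n - 1)" using n_pos by (metis Suc_diff_1 sum.lessThan_Suc)
    then show ?thesis using W1_sum by simp
  qed
  have sum_lower: "(\<Sum>i<n - 1. W1 i) \<le> (\<Sum>i<n - 1. \<theta> (PEndow i))"
    using endow by (intro sum_mono) (auto intro: less_imp_le)
  have "(\<Sum>i<n - 1. \<theta> (PEndow i)) \<le> (\<Sum>i<n - 1. W1 i + t)"
    using endow by (intro sum_mono) (auto intro: less_imp_le)
  also have "\<dots> = (\<Sum>i<n - 1. W1 i) + (n - 1) * t" by (simp add: sum.distrib)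
  also have "real (n - 1) * t \<le> n * t" using t(1) by (intro mult_right_mono) auto
  finally have sum_upper: "(\<Sum>i<n - 1. \<theta> (PEndow i)) \<le> (\<Sum>i<n - 1. W1 i) + n * t" by simp
  have Wp_last: "W1 (n - 1) - n * t \<le> Wp \<theta> (n - 1) 0" "Wp \<theta> (n - 1) 0 \<le> W1 (n - 1)"
    using sum_lower sum_upper last n_pos by (auto simp: Wp_def)
  have nt: "real n * t < (n + 1) * t" using t(1) by simp
  have Wp_pos: "0 < Wp \<theta> i 0" if i: "i < n" for i
  proof (cases "i = n - 1")
    case True
    then show ?thesis using Wp_last(1) W1_ge[OF i] t1(2) nt by simp
  next
    case False
    then have i': "i < n - 1" using i by simp
    have "0 < \<eta> / n" using \<eta> n_pos by simp
    then have "0 < \<theta> (PEndow i)" using endow[OF i'] W1_ge[OF i] by linarith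
    moreover have "Suc i < n" using i' by simp
    ultimately show ?thesis by (simp add: Wp_def)
  qed
  have Wp_close: "\<bar>Wp \<theta> i j - W i j\<bar> < \<delta>" if "i < n" for i j
  proof (cases "j = 0")
    case True
    have "\<bar>Wp \<theta> i 0 - W1 i\<bar> \<le> \<delta> / 4"
    proof (cases "i = n - 1")
      case True
      then show ?thesis using Wp_last t1(1) nt by simp
    next
      case False
      then have i': "i < n - 1" using that by simp
      have "\<bar>\<theta> (PEndow i) - W1 i\<bar> \<le> \<delta> / 4" using endow[OF i'] t2 by linarith
      moreover have "Suc i < n" using i' by simp
      ultimately show ?thesis by (simp add: Wp_def)
    qed
    then show ?thesis using W1_close[OF that] assms unfolding True by linarith
  next
    case False
    then show ?thesis using assms by (simp add: Wp_def)
  qed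
  have J: "bads_lcp (pert \<theta>) P R \<epsilon>"
  proof (rule pert_instance)
    fix i j k assume s: "seg i j (Suc k)"
    then have "(i, j, Suc k) \<in> {(i, j, k) \<in> segments I. 0 < k}" by (simp add: segments_def)
    from imageI[OF this, of "\<lambda>(i, j, k). D i j k - D i j (k - 1)"]
    have "D i j (Suc k) - D i j k \<in> gaps" by (simp add: gaps_def)
    then show "\<theta> (PSteep i j k) < D i j (Suc k)" using gap steep[of i j k] s by fastforce
  qed (use steep len Wp_pos in auto)
  interpret J: bads_lcp "pert \<theta>" P R \<epsilon> by (rule J)
  have "nondegenerate (pert \<theta>) P R \<epsilon>"
  proof (rule J.nondegenerate_if_few_tight)
    fix x assume "lcp_solution (pert \<theta>) P R \<epsilon> x" "J.pos x"
    then show "card (tight (pert \<theta>) P R \<epsilon> x) \<le> card (labels (pert \<theta>)) + 1"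
      using card_tight_le[OF J _ _ gen] by (simp add: J.pos_def)
  qed
  moreover have "perturbation \<delta> I (pert \<theta>)"
  proof -
    have "\<bar>\<theta> (PSteep i j k) - D i j k\<bar> < \<delta>" "\<bar>\<theta> (PLen i j k) - seglen I i j k\<bar> < \<delta>" if "seg i j k" for i j k
      using steep[OF that] len[OF that] t2 assms by auto
    then show ?thesis
      using J.inst Wp_close by (simp add: perturbation_def)
  qed
  ultimately show ?thesis using J pert_input_size by blast
qed

end

theorem theorem24:
  fixes d :: nat
  shows "\<exists>p :: nat poly. \<forall>I P R \<epsilon>.
    bads_instance I \<and> (num_agents I \<le> d \<or> num_bads I \<le> d) \<and> lcp_constants I P R \<epsilon> \<longrightarrow>
      (nondegenerate I P R \<epsilon> \<longrightarrow> runs_within I P R \<epsilon> (poly p (input_size I))) \<and>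
      (\<forall>\<delta>>0. \<exists>I'. perturbation \<delta> I I' \<and> lcp_constants I' P R \<epsilon> \<and> nondegenerate I' P R \<epsilon> \<and>
         runs_within I' P R \<epsilon> (poly p (input_size I)))"
proof (intro exI[of _ "[:5, 1:] ^ (vertex_bound_degree d + 5)"] allI impI)
  fix I P R \<epsilon>
  assume I: "bads_instance I \<and> (num_agents I \<le> d \<or> num_bads I \<le> d) \<and> lcp_constants I P R \<epsilon>"
  then interpret bads_lcp I P R \<epsilon> by unfold_locales auto
  \<comment> \<open>\<open>[:5, 1:]\<close> is the linear polynomial with value \<open>k + 5\<close>
    at \<open>k\<close>.\<close>
  have poly: "poly ([:5, 1:] ^ (vertex_bound_degree d + 5)) k = (k + 5) ^ (vertex_bound_degree d + 5)" for k :: nat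
    by (simp only: poly_power) (simp add: add.commute)
  have "\<exists>I'. perturbation \<delta> I I' \<and> lcp_constants I' P R \<epsilon> \<and> nondegenerate I' P R \<epsilon> \<and>
      runs_within I' P R \<epsilon> (poly ([:5, 1:] ^ (vertex_bound_degree d + 5)) (input_size I))"
    if \<delta>: "\<delta> > 0" for \<delta>
  proof -
    obtain I' where I': "perturbation \<delta> I I'" "bads_lcp I' P R \<epsilon>" "nondegenerate I' P R \<epsilon>" "input_size I' = input_size I"
      using perturbation_exists[OF \<delta>] by blast
    interpret J: bads_lcp I' P R \<epsilon> by (rule I'(2))
    have "num_agents I' \<le> d \<or> num_bads I' \<le> d" using I I'(1) by (auto simp: perturbation_def)
    then show ?thesis using J.program_runs[OF I'(3)] J.const I' unfolding poly by metis
  qed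
  then show "(nondegenerate I P R \<epsilon> \<longrightarrow>
        runs_within I P R \<epsilon> (poly ([:5, 1:] ^ (vertex_bound_degree d + 5)) (input_size I))) \<and>
      (\<forall>\<delta>>0. \<exists>I'. perturbation \<delta> I I' \<and> lcp_constants I' P R \<epsilon> \<and> nondegenerate I' P R \<epsilon> \<and>
         runs_within I' P R \<epsilon> (poly ([:5, 1:] ^ (vertex_bound_degree d + 5)) (input_size I)))"
    using program_runs I unfolding poly by blast
qed

end
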